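(* Let $p=c_n/n$ where $c_n\ge 1$ and $c_n=o(\log n)$. Then asymptotically almost surely $\dim P_{\mathcal{G}(n,p)}=O(c_n^4e^{c_n})$.
   Context: $\mathcal{G}(n,p)$ is the Erdős–Rényi random graph on $[n]$. $P_{\mathcal{G}(n,p)}$ is the poset on $[n]$ in which $i<_P j$ iff there are vertices $i=u_1<u_2<\dots<u_k=j$ (natural order) forming a path $u_1u_2\cdots u_k$ in $\mathcal{G}(n,p)$. The dimension of a poset is the minimum number of linear orders whose intersection is its order. Asymptotically almost surely means with probability tending to 1 as $n\to\infty$. *)

theory Defs
  imports "HOL-Probability.Probability" "HOL-Library.Landau_Symbols"
begin

text \<open>A simple graph on the vertex set \<open>{1..n}\<close> is given by its set of edges, each a two-element
  set of vertices.\<close>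

definition vertex_pairs :: "nat \<Rightarrow> nat set set" where
  "vertex_pairs n = {e. e \<subseteq> {1..n} \<and> card e = 2}"

text \<open>Each pair is an edge independently with probability \<open>p\<close>. Note that \<^const>\<open>bernoulli_pmf\<close>
  truncates its parameter to the unit interval.\<close>

definition erdos_renyi :: "nat \<Rightarrow> real \<Rightarrow> nat set set pmf" where
  "erdos_renyi n p =
     map_pmf (\<lambda>f. {e \<in> vertex_pairs n. f e})
       (Pi_pmf (vertex_pairs n) False (\<lambda>_. bernoulli_pmf p))"

definition increasing_path :: "nat set set \<Rightarrow> nat list \<Rightarrow> bool" where
  "increasing_path E us \<longleftrightarrow>
     us \<noteq> [] \<and> sorted_wrt (<) us \<and> successively (\<lambda>u v. {u, v} \<in> E) us"

text \<open>The reflexive form of the order: the strict relation \<open>i < j\<close> consists of the pairs connected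
  by a path with at least two vertices, and the one-vertex paths contribute the diagonal.\<close>

definition graph_poset :: "nat \<Rightarrow> nat set set \<Rightarrow> nat rel" where
  "graph_poset n E =
     {(i, j). i \<in> {1..n} \<and> j \<in> {1..n} \<and>
        (\<exists>us. increasing_path E us \<and> hd us = i \<and> last us = j)}"

text \<open>A nonempty family of linear orders on \<open>A\<close> whose intersection is \<open>r\<close>. Each member contains
  \<open>r\<close>, so it is a linear extension of \<open>r\<close>.\<close>

definition realizer :: "'a set \<Rightarrow> 'a rel \<Rightarrow> 'a rel set \<Rightarrow> bool" where
  "realizer A r L \<longleftrightarrow>
     finite L \<and> L \<noteq> {} \<and> (\<forall>l\<in>L. linear_order_on A l) \<and> \<Inter>L = r"

text \<open>Every partial order on a finite set has a realizer, so the minimum exists there.\<close>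

definition poset_dim :: "'a set \<Rightarrow> 'a rel \<Rightarrow> nat" where
  "poset_dim A r = (LEAST d. \<exists>L. realizer A r L \<and> card L = d)"

lemma increasing_path_join:
  assumes "increasing_path E us" "increasing_path E vs" "last us = hd vs"
  shows "increasing_path E (us @ tl vs)"
proof (cases vs)
  case Nil
  then show ?thesis using assms by (simp add: increasing_path_def)
next
  case (Cons v ws)
  have le: "x \<le> last us" if "x \<in> set us" for x
  proof -
    obtain us' where us: "us = us' @ [last us]"
      using assms(1) unfolding increasing_path_def by (metis append_butlast_last_id)
    have "sorted_wrt (<) (us' @ [last us])"
      using assms(1) us unfolding increasing_path_def by metis
    moreover have "x \<in> set us' \<or> x = last us"
      using that us by (metis Un_iff empty_iff insert_iff list.set set_append)
    ultimately show ?thesis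
      by (auto simp: sorted_wrt_append)
  qed
  show ?thesis
    using assms le unfolding increasing_path_def Cons
    by (cases ws) (force simp: sorted_wrt_append successively_append_iff successively_Cons)+
qed

lemma increasing_path_hd_le_last:
  assumes "increasing_path E us"
  shows "hd us \<le> last us" and "hd us = last us \<Longrightarrow> length us = 1"
proof -
  obtain u ws where us: "us = u # ws"
    using assms by (cases us) (auto simp: increasing_path_def)
  have "u < last ws" if "ws \<noteq> []"
    using assms last_in_set[OF that] by (auto simp: increasing_path_def us)
  then show "hd us \<le> last us" and "hd us = last us \<Longrightarrow> length us = 1"
    by (auto simp: us split: if_splits)
qed

lemma graph_poset_strict_iff:
  "(i, j) \<in> graph_poset n E \<and> i \<noteq> j \<longleftrightarrow>
     i \<in> {1..n} \<and> j \<in> {1..n} \<and>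
     (\<exists>us. length us \<ge> 2 \<and> sorted_wrt (<) us \<and> successively (\<lambda>u v. {u, v} \<in> E) us \<and>
           hd us = i \<and> last us = j)"
  (is "?L \<longleftrightarrow> ?R")
proof
  assume ?L
  then obtain us where us: "increasing_path E us" "hd us = i" "last us = j"
      "i \<in> {1..n}" "j \<in> {1..n}" "i \<noteq> j"
    unfolding graph_poset_def by blast
  then have "length us \<ge> 2"
    unfolding increasing_path_def by (cases us; cases "tl us") auto
  then show ?R
    using us unfolding increasing_path_def by blast
next
  assume ?R
  then obtain us where us: "length us \<ge> 2" "sorted_wrt (<) us"
      "successively (\<lambda>u v. {u, v} \<in> E) us" "hd us = i" "last us = j" "i \<in> {1..n}" "j \<in> {1..n}"
    by blast
  then have p: "increasing_path E us"
    unfolding increasing_path_def by auto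
  then have "i \<noteq> j"
    using increasing_path_hd_le_last(2)[OF p] us by auto
  then show ?L
    using p us unfolding graph_poset_def by blast
qed

lemma partial_order_on_graph_poset: "partial_order_on {1..n} (graph_poset n E)"
  unfolding partial_order_on_def preorder_on_def
proof (intro conjI)
  show "graph_poset n E \<subseteq> {1..n} \<times> {1..n}"
    unfolding graph_poset_def by blast
  show "refl_on {1..n} (graph_poset n E)"
    unfolding refl_on_def
  proof
    fix x assume "x \<in> {1..n}"
    moreover have "increasing_path E [x]"
      by (simp add: increasing_path_def)
    ultimately show "(x, x) \<in> graph_poset n E"
      unfolding graph_poset_def by (force intro: exI[of _ "[x]"])
  qed
  show "antisym (graph_poset n E)"
    by (rule antisymI) (auto simp: graph_poset_def dest!: increasing_path_hd_le_last(1))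
  show "trans (graph_poset n E)"
  proof (rule transI)
    fix x y z assume "(x, y) \<in> graph_poset n E" "(y, z) \<in> graph_poset n E"
    then obtain us vs where *: "increasing_path E us" "hd us = x" "last us = y"
        "increasing_path E vs" "hd vs = y" "last vs = z" "x \<in> {1..n}" "z \<in> {1..n}"
      unfolding graph_poset_def by blast
    have "hd (us @ tl vs) = x"
      using * by (simp add: increasing_path_def)
    moreover have "last (us @ tl vs) = z"
      using * by (cases vs) (auto simp: increasing_path_def)
    moreover have "increasing_path E (us @ tl vs)"
      using * by (simp add: increasing_path_join)
    ultimately show "(x, z) \<in> graph_poset n E"
      unfolding graph_poset_def using * by blast
  qed
qed

end

theory Submission
  imports Defs "HOL-Library.List_Lexorder" "HOL-Library.Sublist" "HOL-Real_Asymp.Real_Asymp"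
begin

text \<open>Colour the vertices at random with \<open>r = \<Theta>(c e\<^sup>c)\<close> colours \<open>\<phi>\<close> and, independently, with
  \<open>R = e\<^bsup>O(c)\<^esup>\<close> colours \<open>\<psi>\<close>, and let \<open>s = \<Theta>(c)\<close>. Call \<open>y\<close> bad if its down-set contains \<open>s\<close> vertices
  of the same colour \<open>\<phi>\<close> or two vertices of the same colour \<open>\<psi>\<close>; this has probability \<open>e\<^bsup>-\<Omega>(c)\<^esup>\<close>.

  If \<open>y\<close> is not bad, it is separated from any \<open>x\<close> not below it by putting the colour class
  \<open>\<phi> = \<phi> x\<close> on top and ordering it by one of \<open>t = O(s\<^sup>2 log R) = O(c\<^sup>3)\<close> subsets of the \<open>R\<close> colours
  that separate any colour from fewer than \<open>s\<close> others. This takes \<open>2rt = O(c\<^sup>4 e\<^sup>c)\<close> linear orders.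

  The bad vertices generate a down-set \<open>W\<close>. A first-moment computation over tree-like unions of
  increasing paths shows that a component of \<open>W\<close> has no alternating path with more than
  \<open>O(log n / c)\<close> turns, since such a path meets many disjoint down-sets of bad vertices, and a
  second one shows that, given this, no component contains two cycles. So each component becomes
  a forest after the removal of the up-set, or of the down-set, of one vertex, and ten linear
  orders suffice for \<open>W\<close>.\<close>


section \<open>Realizers from key functions\<close>

text \<open>The expected number of increasing paths into a vertex is at most (1 + p)^n <= e^c, which
  sets the scale of \<open>r\<close>: with \<open>r\<close> a large multiple of c e^c, each witness
  of a repeated colour \<open>\<phi>\<close> contributes a factor below 1/e, and \<open>s\<close> of
  about 600 c give e^(-600 c). A repeated colour \<open>\<psi>\<close> costs 1/\<open>R\<close>,
  which must beat e^(O(c)); \<open>R\<close> enters the dimension only through its logarithm. As c =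
  o(log n), a union bound over n vertices cannot exclude bad ones. But about log n / (256 c) bad
  vertices with disjoint down-sets cost n^(-2), against n starting points. Disjointness makes the
  colours independent, and it is the reason for levels: bad vertices four levels apart have disjoint
  down-sets. A component with one cycle cannot be excluded: n starting points times one extra edge
  of weight c/n leave no decay. Two extra edges leave 1/n, which beats the n^(184/256) e^(O(c)) for
  the tree that joins them. So the keys must cope with forests plus one vertex per
  component.\<close>

definition below :: "'a rel \<Rightarrow> 'a \<Rightarrow> 'a set" where
  "below r y = {z. (z, y) \<in> r}"

text \<open>This puts \<open>y\<close> before \<open>x\<close> in the extension built from
  \<open>g\<close>: the maximal key below \<open>y\<close> is less than \<open>g x\<close>, hence
  less than the maximal key below \<open>x\<close>. So \<open>g\<close> itself need not respect the
  order.\<close>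

definition key_separates :: "'a rel \<Rightarrow> ('a \<Rightarrow> 'k::linorder) \<Rightarrow> 'a \<Rightarrow> 'a \<Rightarrow> bool" where
  "key_separates r g x y \<longleftrightarrow> (\<forall>z\<in>below r y. g z < g x)"

text \<open>Sorting by the maximal key below each vertex gives linear extensions.\<close>

lemma poset_dim_le_card_keys:
  fixes r :: "'a::linorder rel" and F :: "('a \<Rightarrow> 'k::linorder) set"
  assumes A: "finite A" and po: "partial_order_on A r" and nat: "r \<subseteq> {(x, y). x \<le> y}"
    and F: "finite F" "F \<noteq> {}"
    and sep: "\<And>x y. x \<in> A \<Longrightarrow> y \<in> A \<Longrightarrow> (x, y) \<notin> r \<Longrightarrow> \<exists>g\<in>F. key_separates r g x y"
  shows "poset_dim A r \<le> card F"
proof -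
  have sub: "r \<subseteq> A \<times> A" and refl: "refl_on A r" and tr: "trans r"
    using po unfolding partial_order_on_def preorder_on_def by auto
  have fin: "finite (below r y)" for y
    using A sub unfolding below_def by (rule_tac finite_subset[of _ A]) auto
  define f where "f g y = Max (g ` below r y)" for g :: "'a \<Rightarrow> 'k" and y
  \<comment> \<open>Any \<open>g\<close> works, because \<open>f g\<close> is monotone along
    \<open>r\<close> by construction. Ties follow the natural order, which extends \<open>r\<close>
    by assumption \<open>nat\<close>.\<close>
  define L where "L g = {(x, y). x \<in> A \<and> y \<in> A \<and> (f g x < f g y \<or> (f g x = f g y \<and> x \<le> y))}"
    for g :: "'a \<Rightarrow> 'k"
  have self: "x \<in> below r x" if "x \<in> A" for x
    using refl that unfolding below_def refl_on_def by auto
  have mono: "f g x \<le> f g y" if "(x, y) \<in> r" for g x y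
  proof -
    have "below r x \<subseteq> below r y"
      using that tr unfolding below_def by (auto dest: transD)
    moreover have "x \<in> A"
      using that sub by auto
    ultimately show ?thesis
      unfolding f_def using fin self by (intro Max_mono image_mono) auto
  qed
  have lin: "linear_order_on A (L g)" for g
  proof -
    have "refl_on A (L g)"
      unfolding refl_on_def L_def by auto
    moreover have "trans (L g)"
      unfolding L_def by (rule transI) auto
    moreover have "antisym (L g)"
      unfolding L_def by (rule antisymI) auto
    moreover have "total_on A (L g)"
      unfolding L_def total_on_def by auto
    moreover have "L g \<subseteq> A \<times> A"
      unfolding L_def by auto
    ultimately show ?thesis
      unfolding linear_order_on_def partial_order_on_def preorder_on_def by auto
  qed
  have "\<Inter>(L ` F) = r"
  proof
    show "r \<subseteq> \<Inter>(L ` F)"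
    proof (rule subrelI)
      fix x y assume xy: "(x, y) \<in> r"
      have "x \<in> A" "y \<in> A" "x \<le> y"
        using xy sub nat by auto
      then have "(x, y) \<in> L g" for g
        using mono[OF xy, of g] unfolding L_def by auto
      then show "(x, y) \<in> \<Inter>(L ` F)"
        by blast
    qed
    show "\<Inter>(L ` F) \<subseteq> r"
    proof (rule subrelI, rule ccontr)
      fix x y assume xy: "(x, y) \<in> \<Inter>(L ` F)" and n: "(x, y) \<notin> r"
      then have "x \<in> A" "y \<in> A"
        using F unfolding L_def by auto
      then obtain g where g: "g \<in> F" "\<forall>z\<in>below r y. g z < g x"
        using sep n unfolding key_separates_def by blast
      have "f g y < g x"
        unfolding f_def using g(2) fin self[OF \<open>y \<in> A\<close>] by (subst Max_less_iff) auto
      also have "g x \<le> f g x"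
        unfolding f_def using fin self[OF \<open>x \<in> A\<close>] by (intro Max_ge) auto
      finally have "f g y < f g x" .
      moreover have "(x, y) \<in> L g"
        using xy g by blast
      ultimately show False
        unfolding L_def by auto
    qed
  qed
  then have "realizer A r (L ` F)"
    unfolding realizer_def using F lin by auto
  then have "poset_dim A r \<le> card (L ` F)"
    unfolding poset_dim_def by (intro Least_le) blast
  also have "\<dots> \<le> card F"
    by (rule card_image_le[OF F(1)])
  finally show ?thesis .
qed


section \<open>Keys for forests\<close>

lemma list_less_append [simp]: "(p @ xs :: 'a::linorder list) < p @ ys \<longleftrightarrow> xs < ys"
  by (simp add: list_less_def lexord_same_pref_iff)

lemma list_less_Cons [simp]: "(x # xs :: 'a::linorder list) < y # ys \<longleftrightarrow> x < y \<or> x = y \<and> xs < ys"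
  by (auto simp: list_less_def)

lemma list_less_Nil [simp]: "([] :: 'a::linorder list) < x # xs" "\<not> xs < ([] :: 'a list)"
  by (auto simp: list_less_def)

text \<open>The tops of the vertices below \<open>y\<close> have addresses that are prefixes of the
  address of \<open>y\<close>, so one comparison with \<open>y\<close> covers them all.\<close>

lemma list_less_prefix: "prefix p q \<Longrightarrow> q < x \<Longrightarrow> p < (x :: 'a::linorder list)"
proof -
  assume p: "prefix p q" and q: "q < x"
  then obtain r where r: "q = p @ r"
    by (auto simp: prefix_def)
  have "p \<le> q"
    unfolding r by (cases r) (auto simp: list_le_def list_less_def intro: lexord_append_rightI)
  then show ?thesis using q by simp
qed

lemma prefix_neq_decomp: "prefix p q \<Longrightarrow> p \<noteq> q \<Longrightarrow> \<exists>a as. q = p @ a # as"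
  by (metis append_Nil2 list.exhaust prefixE)

text \<open>The sentinel makes a list larger than its proper extensions.\<close>

definition mirror :: "nat list \<Rightarrow> int list" where
  "mirror xs = map (\<lambda>x. - int x) xs @ [1]"

lemma mirror_append_less:
  "mirror (p @ x # xs) @ us < mirror p @ vs"
  by (simp add: mirror_def)

lemma mirror_diverge:
  "x > y \<Longrightarrow> mirror (p @ x # xs) @ us < mirror (p @ y # ys) @ vs"
  by (simp add: mirror_def)

text \<open>\<open>par\<close> may lead outside the field of \<open>cov\<close>, so one parent map
  serves every restriction of \<open>cov\<close>. The rank excludes cycles.\<close>

locale rooted_forest =
  fixes cov :: "nat rel" and par :: "nat \<Rightarrow> nat option" and rk :: "nat \<Rightarrow> nat"
  assumes rk: "par v = Some u \<Longrightarrow> rk u < rk v"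
    and cov_par: "(u, v) \<in> cov \<Longrightarrow> par u = Some v \<or> par v = Some u"
    and cov_asym: "(u, v) \<in> cov \<Longrightarrow> (v, u) \<notin> cov"
begin

primrec addr_fuel :: "nat \<Rightarrow> nat \<Rightarrow> nat list" where
  "addr_fuel 0 v = [v]"
| "addr_fuel (Suc k) v = (case par v of None \<Rightarrow> [v] | Some u \<Rightarrow> addr_fuel k u @ [v])"

text \<open>The path from the root to \<open>v\<close>. The rank drops along \<open>par\<close>, so
  fuel \<open>rk v\<close> reaches the root.\<close>

definition addr :: "nat \<Rightarrow> nat list" where
  "addr v = addr_fuel (rk v) v"

lemma addr_fuel_enough: "k \<ge> rk v \<Longrightarrow> addr_fuel k v = addr v"
proof (induction "rk v" arbitrary: k v rule: less_induct)
  case less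
  show ?case
  proof (cases "par v")
    case None
    then show ?thesis unfolding addr_def by (cases k; cases "rk v") auto
  next
    case (Some u)
    then obtain j l where jl: "rk v = Suc j" "k = Suc l" "l \<ge> j" "j \<ge> rk u"
      using rk[OF Some] less.prems by (cases k; cases "rk v") auto
    then have "addr_fuel l u = addr u" "addr_fuel j u = addr u"
      using less.hyps rk[OF Some] by auto
    then show ?thesis unfolding addr_def[of v] using jl Some by simp
  qed
qed

lemma addr_None: "par v = None \<Longrightarrow> addr v = [v]"
  unfolding addr_def by (cases "rk v") auto

lemma addr_Some: "par v = Some u \<Longrightarrow> addr v = addr u @ [v]"
  using rk[of v u] addr_fuel_enough[of u "rk v - 1"] unfolding addr_def[of v]
  by (cases "rk v") auto

lemma addr_nonempty: "addr v \<noteq> []" and last_addr: "last (addr v) = v"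
  by (cases "par v"; simp add: addr_None addr_Some)+

lemma addr_inj: "addr u = addr v \<Longrightarrow> u = v"
  using last_addr by metis

text \<open>The order \<open>cov\<^sup>*\<close> is unrelated to the tree order: \<open>pu\<close> and \<open>pd\<close> consist of the tree edges whose
  parent is the lower, respectively the upper, end.\<close>

definition pu :: "nat rel" where
  "pu = {(u, v) \<in> cov. par v = Some u}"

definition pd :: "nat rel" where
  "pd = {(u, v) \<in> cov. par u = Some v}"

lemma cov_split: "cov = pu \<union> pd"
  using cov_par unfolding pu_def pd_def by auto

text \<open>After a step away from the root the order cannot turn back: a step towards the root
  would reverse the same tree edge, against \<open>cov_asym\<close>.\<close>

lemma rtrancl_cov: "(z, y) \<in> cov\<^sup>* \<Longrightarrow> \<exists>w. (z, w) \<in> pd\<^sup>* \<and> (w, y) \<in> pu\<^sup>*"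
proof (induction rule: converse_rtrancl_induct)
  case base
  then show ?case by blast
next
  case (step z z')
  then obtain w where w: "(z', w) \<in> pd\<^sup>*" "(w, y) \<in> pu\<^sup>*" by blast
  show ?case
  proof (cases "(z, z') \<in> pd")
    case True
    then show ?thesis using w by (meson converse_rtrancl_into_rtrancl)
  next
    case False
    then have zz: "(z, z') \<in> pu" using step cov_split by blast
    have "z' = w"
    proof (rule ccontr)
      assume "z' \<noteq> w"
      then obtain a where "(z', a) \<in> pd"
        using w(1) by (meson converse_rtranclE)
      then have "a = z" "(z', a) \<in> cov" "(z, z') \<in> cov"
        using zz unfolding pu_def pd_def by auto
      then show False using cov_asym by blast
    qed
    then show ?thesis using zz w by (meson converse_rtrancl_into_rtrancl rtrancl.rtrancl_refl)
  qed
qed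

lemma rtrancl_cov_conv: "(z, y) \<in> cov\<^sup>* \<longleftrightarrow> (\<exists>w. (z, w) \<in> pd\<^sup>* \<and> (w, y) \<in> pu\<^sup>*)"
proof
  assume "\<exists>w. (z, w) \<in> pd\<^sup>* \<and> (w, y) \<in> pu\<^sup>*"
  then obtain w where w: "(z, w) \<in> pd\<^sup>*" "(w, y) \<in> pu\<^sup>*" by blast
  have "pd \<subseteq> cov" "pu \<subseteq> cov" by (auto simp: pd_def pu_def)
  then have "(z, w) \<in> cov\<^sup>*" "(w, y) \<in> cov\<^sup>*"
    using w rtrancl_mono by blast+
  then show "(z, y) \<in> cov\<^sup>*" by (rule rtrancl_trans)
qed (rule rtrancl_cov)

lemma prefix_par: "par v = Some u \<Longrightarrow> prefix (addr u) (addr v)"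
  by (simp add: addr_Some[of v u])

lemma prefix_pu: "(u, v) \<in> pu\<^sup>* \<Longrightarrow> prefix (addr u) (addr v)"
proof (induction rule: rtrancl_induct)
  case (step y z)
  then have "prefix (addr y) (addr z)" by (auto simp: pu_def intro: prefix_par)
  then show ?case using step prefix_order.trans by blast
qed auto

lemma prefix_pd: "(u, v) \<in> pd\<^sup>* \<Longrightarrow> prefix (addr v) (addr u)"
proof (induction rule: rtrancl_induct)
  case (step y z)
  then have "prefix (addr z) (addr y)" by (auto simp: pd_def intro: prefix_par)
  then show ?case using step prefix_order.trans by blast
qed auto

lemma prefix_step: "prefix p (addr v) \<Longrightarrow> p \<noteq> addr v \<Longrightarrow> p \<noteq> [] \<Longrightarrow> \<exists>u. par v = Some u \<and> prefix p (addr u)"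
  by (cases "par v") (auto simp: addr_None prefix_Cons dest!: addr_Some)

text \<open>A run of \<open>pu\<close> steps follows the unique tree path, so it contains every
  vertex whose address lies between those of its ends.\<close>

lemma pu_between:
  "(w, y) \<in> pu\<^sup>* \<Longrightarrow> prefix (addr w) (addr x) \<Longrightarrow> prefix (addr x) (addr y) \<Longrightarrow> (w, x) \<in> pu\<^sup>* \<and> (x, y) \<in> pu\<^sup>*"
proof (induction rule: rtrancl_induct)
  case base
  then have "x = w" using addr_inj prefix_order.antisym by blast
  then show ?case by simp
next
  case (step y z)
  show ?case
  proof (cases "addr x = addr z")
    case True
    then have "x = z" by (rule addr_inj)
    then show ?thesis using step.hyps by (meson rtrancl.rtrancl_into_rtrancl rtrancl.rtrancl_refl)
  next
    case False
    then obtain u where "par z = Some u" "prefix (addr x) (addr u)"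
      using prefix_step step.prems addr_nonempty by blast
    moreover have "par z = Some y"
      using step.hyps by (simp add: pu_def)
    ultimately have "(w, x) \<in> pu\<^sup>* \<and> (x, y) \<in> pu\<^sup>*" using step.IH step.prems by simp
    then show ?thesis using step.hyps by (meson rtrancl.rtrancl_into_rtrancl)
  qed
qed

lemma pd_between:
  "(x, w) \<in> pd\<^sup>* \<Longrightarrow> prefix (addr w) (addr u) \<Longrightarrow> prefix (addr u) (addr x) \<Longrightarrow> (x, u) \<in> pd\<^sup>* \<and> (u, w) \<in> pd\<^sup>*"
proof (induction rule: converse_rtrancl_induct)
  case base
  then have "u = w" using addr_inj prefix_order.antisym by blast
  then show ?case by simp
next
  case (step x z)
  show ?case
  proof (cases "addr u = addr x")
    case True
    then show ?thesis using addr_inj step.hyps by (metis converse_rtrancl_into_rtrancl rtrancl.rtrancl_refl)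
  next
    case False
    then obtain t where "par x = Some t" "prefix (addr u) (addr t)"
      using prefix_step step.prems addr_nonempty by blast
    moreover have "par x = Some z"
      using step.hyps by (simp add: pd_def)
    ultimately have "(z, u) \<in> pd\<^sup>* \<and> (u, w) \<in> pd\<^sup>*" using step.IH step.prems by simp
    then show ?thesis using step.hyps by (meson converse_rtrancl_into_rtrancl)
  qed
qed

lemma top_exists: "\<exists>w. (v, w) \<in> pd\<^sup>* \<and> w \<notin> Domain pd"
proof (induction "rk v" arbitrary: v rule: less_induct)
  case less
  show ?case
  proof (cases "v \<in> Domain pd")
    case True
    then obtain u where u: "(v, u) \<in> pd" by blast
    then have "rk u < rk v" using rk by (auto simp: pd_def)
    then show ?thesis using less u by (meson converse_rtrancl_into_rtrancl)
  qed auto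
qed

text \<open>\<open>pd\<close> is a partial function, as a vertex has one parent, so climbing from
  \<open>v\<close> ends in a unique vertex. Vertices with the same top form a block, a subtree all
  of whose edges point to that top.\<close>

definition top :: "nat \<Rightarrow> nat" where
  "top v = (SOME w. (v, w) \<in> pd\<^sup>* \<and> w \<notin> Domain pd)"

lemma top: "(v, top v) \<in> pd\<^sup>*" "top v \<notin> Domain pd"
  using someI_ex[OF top_exists[of v]] unfolding top_def by auto

lemma pd_terminal_unique:
  "(v, w) \<in> pd\<^sup>* \<Longrightarrow> (v, t) \<in> pd\<^sup>* \<Longrightarrow> w \<notin> Domain pd \<Longrightarrow> t \<notin> Domain pd \<Longrightarrow> t = w"
proof (induction rule: converse_rtrancl_induct)
  case base
  from base(1) show ?case
    by (rule converse_rtranclE) (use base in auto)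
next
  case (step v u)
  then have "v \<noteq> t" by blast
  with step.prems(1) obtain u' where u': "(v, u') \<in> pd" "(u', t) \<in> pd\<^sup>*"
    by (metis converse_rtranclE)
  then have "u' = u" using step.hyps(1) by (auto simp: pd_def)
  then show ?case using step u' by blast
qed

lemma top_unique: "(v, w) \<in> pd\<^sup>* \<Longrightarrow> w \<notin> Domain pd \<Longrightarrow> top v = w"
  using pd_terminal_unique top by blast

lemma top_pd: "(v, w) \<in> pd\<^sup>* \<Longrightarrow> top v = top w"
  using top_unique top by (meson rtrancl_trans)


text \<open>Keys 0 and 1 compare tops by address under the two opposite orders of siblings. Keys 2
  and 3 place a top after all tops in its subtree and break ties inside a block, once with ancestors
  first and once with ancestors last, again under opposite orders of siblings.\<close>

definition forest_key :: "nat \<Rightarrow> nat \<Rightarrow> int list" where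
  "forest_key i v =
     (if i = 0 then map int (addr (top v)) else
      if i = 1 then map (\<lambda>x. - int x) (addr (top v)) else
      if i = 2 then mirror (addr (top v)) @ map int (addr v)
      else mirror (addr (top v)) @ mirror (addr v))"

lemma addr_map_prefix:
  "prefix p q \<Longrightarrow> prefix (map f p) (map f q)"
  by (auto simp: prefix_def)

text \<open>For \<open>z\<close> below \<open>y\<close>, \<open>top z\<close> is an ancestor of \<open>y\<close>. If \<open>top x\<close> is not one, the first two keys
  compare \<open>top x\<close> with \<open>y\<close>. Otherwise the reversed order of the addresses of the tops decides,
  up to ties between \<open>x\<close> and the lowest block below \<open>y\<close>, which is a full subtree.\<close>

lemma forest_key_separates:
  assumes "(x, y) \<notin> cov\<^sup>*"
  shows "\<exists>i<4. \<forall>z. (z, y) \<in> cov\<^sup>* \<longrightarrow> forest_key i z < forest_key i x"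
proof -
  have topz: "\<exists>w. (z, w) \<in> pd\<^sup>* \<and> (w, y) \<in> pu\<^sup>* \<and> top z = top w \<and> prefix (addr (top z)) (addr w) \<and> prefix (addr w) (addr y)"
    if zy: "(z, y) \<in> cov\<^sup>*" for z
  proof -
    obtain w where w: "(z, w) \<in> pd\<^sup>*" "(w, y) \<in> pu\<^sup>*"
      using rtrancl_cov[OF zy] by blast
    then show ?thesis
      using top_pd[OF w(1)] prefix_pu[OF w(2)] prefix_pd[OF top(1)[of w]] by auto
  qed
  show ?thesis
  proof (cases "prefix (addr (top x)) (addr y)")
    case False
    show ?thesis
    proof (cases "prefix (addr y) (addr (top x))")
      case True
      then obtain a as where a: "addr (top x) = addr y @ a # as"
        using False prefix_neq_decomp by (metis prefix_order.refl)
      have "forest_key 0 z < forest_key 0 x" if "(z, y) \<in> cov\<^sup>*" for z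
      proof -
        have "prefix (addr (top z)) (addr y)"
          using topz[OF that] prefix_order.trans by blast
        then have "prefix (map int (addr (top z))) (map int (addr y))"
          by (rule addr_map_prefix)
        moreover have "map int (addr y) < map int (addr (top x))"
          unfolding a using list_less_append[of "map int (addr y)" "[]" "map int (a # as)"] by simp
        ultimately show ?thesis
          unfolding forest_key_def using list_less_prefix by auto
      qed
      then show ?thesis by (intro exI[of _ 0]) auto
    next
      case False2: False
      then obtain p a as b bs where ab: "a \<noteq> b" "addr (top x) = p @ a # as" "addr y = p @ b # bs"
        using False parallel_decomp[of "addr (top x)" "addr y"] by (auto simp: parallel_def)
      have pre: "prefix (map f (addr (top z))) (map f (addr y))" if "(z, y) \<in> cov\<^sup>*" for z and f :: "nat \<Rightarrow> int"
        using topz[OF that] prefix_order.trans addr_map_prefix by blast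
      show ?thesis
      proof (cases "a > b")
        case True
        then have "map int (addr y) < map int (addr (top x))"
          unfolding ab by simp
        then have "\<forall>z. (z, y) \<in> cov\<^sup>* \<longrightarrow> forest_key 0 z < forest_key 0 x"
          unfolding forest_key_def using list_less_prefix[OF pre] by auto
        then show ?thesis by (intro exI[of _ 0]) auto
      next
        case False
        then have "map (\<lambda>x. - int x) (addr y) < map (\<lambda>x. - int x) (addr (top x))"
          unfolding ab using ab(1) by simp
        then have "\<forall>z. (z, y) \<in> cov\<^sup>* \<longrightarrow> forest_key 1 z < forest_key 1 x"
          unfolding forest_key_def using list_less_prefix[OF pre] by auto
        then show ?thesis by (intro exI[of _ 1]) auto
      qed
    qed
  next
    case anc: True
    have mirror_less: "mirror (addr (top z)) @ us < mirror (addr (top x)) @ vs"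
      if xz: "prefix (addr (top x)) (addr (top z))" "top x \<noteq> top z" for z us vs
    proof -
      have "addr (top x) \<noteq> addr (top z)"
        using xz addr_inj by blast
      then obtain a as where a: "addr (top z) = addr (top x) @ a # as"
        using xz(1) prefix_neq_decomp by metis
      show ?thesis unfolding a by (rule mirror_append_less)
    qed
    show ?thesis
    proof (cases "\<forall>z. (z, y) \<in> cov\<^sup>* \<longrightarrow> prefix (addr (top x)) (addr (top z)) \<and> top x \<noteq> top z")
      case True
      then have "\<forall>z. (z, y) \<in> cov\<^sup>* \<longrightarrow> forest_key 2 z < forest_key 2 x"
        unfolding forest_key_def using mirror_less by auto
      then show ?thesis by (intro exI[of _ 2]) auto
    next
      case False
      \<comment> \<open>\<open>w0\<close> is the turning point between \<open>z0\<close> and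
        \<open>y\<close>. The next facts show that \<open>w0\<close> lies in the block of
        \<open>top x\<close>, while \<open>x\<close> is outside the subtree of \<open>w0\<close>;
        otherwise the climb from \<open>x\<close> would pass \<open>w0\<close> and so reach
        \<open>y\<close>.\<close>
      then obtain z0 w0 where z0: "\<not> (prefix (addr (top x)) (addr (top z0)) \<and> top x \<noteq> top z0)"
          "(z0, w0) \<in> pd\<^sup>*" "(w0, y) \<in> pu\<^sup>*" "top z0 = top w0" "prefix (addr (top z0)) (addr w0)" "prefix (addr w0) (addr y)"
        using topz by blast
      have notpu: "(top x, y) \<notin> pu\<^sup>*"
        using assms top(1)[of x] by (auto simp: rtrancl_cov_conv)
      have "prefix (addr (top w0)) (addr (top x))"
        using z0 anc by (metis prefix_order.trans prefix_same_cases)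
      have xw: "prefix (addr (top x)) (addr w0)"
      proof (rule ccontr)
        assume "\<not> prefix (addr (top x)) (addr w0)"
        then have "prefix (addr w0) (addr (top x))"
          using anc z0 prefix_same_cases by blast
        then show False using pu_between[OF z0(3) _ anc] notpu by blast
      qed
      then have "(top x, top w0) \<in> pd\<^sup>*"
        using pd_between[OF top(1)[of w0] \<open>prefix (addr (top w0)) (addr (top x))\<close>] by blast
      then have tops: "top x = top w0"
        using top(2)[of x] by (metis Domain.DomainI converse_rtranclE)
      have xnot: "(x, w0) \<notin> pd\<^sup>*"
        using assms z0(3) by (auto simp: rtrancl_cov_conv)
      have np: "\<not> prefix (addr w0) (addr x)"
        using pd_between[OF top(1)[of x]] tops z0 xnot by metis
      have "w0 \<noteq> top w0"
        using z0(3) notpu tops by auto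
      then obtain t where t: "(w0, t) \<in> pd"
        using top(1)[of w0] by (meson converse_rtranclE)
      \<comment> \<open>The parent edge of \<open>w0\<close> points to the root, so no
        \<open>pu\<close> run to \<open>y\<close> starts closer to the root: every turning point
        lies in the subtree of \<open>w0\<close>.\<close>
      have no_pu: "(v, w0) \<notin> pu" for v
        using t cov_asym by (auto simp: pu_def pd_def)
      have main: "(prefix (addr (top x)) (addr (top z)) \<and> top x \<noteq> top z) \<or> (top z = top x \<and> prefix (addr w0) (addr z))"
        if z: "(z, y) \<in> cov\<^sup>*" for z
      proof -
        obtain w where w: "(z, w) \<in> pd\<^sup>*" "(w, y) \<in> pu\<^sup>*" "top z = top w" "prefix (addr w) (addr y)"
          using topz[OF z] by blast
        have "prefix (addr w0) (addr w)"
        proof (cases "prefix (addr w) (addr w0)")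
          case True
          then have "(w, w0) \<in> pu\<^sup>*"
            using pu_between[OF w(2) True z0(6)] by blast
          then have "w = w0"
            by (rule rtranclE) (use no_pu in auto)
          then show ?thesis by simp
        next
          case False
          then show ?thesis using w(4) z0(6) prefix_same_cases by blast
        qed
        then have w0w: "(w0, w) \<in> pu\<^sup>*"
          using pu_between[OF z0(3) _ w(4)] by blast
        show ?thesis
        proof (cases "w = w0")
          case True
          then show ?thesis using w(1,3) prefix_pd tops by auto
        next
          case False
          then obtain v where v: "(v, w) \<in> pu"
            using w0w by (metis rtranclE)
          have "w \<notin> Domain pd"
            using v cov_asym by (auto simp: pu_def pd_def)
          then have "top z = w"
            using w(3) top_unique[OF rtrancl.rtrancl_refl, of w] by simp
          moreover have "prefix (addr (top x)) (addr w)"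
            using xw \<open>prefix (addr w0) (addr w)\<close> by (rule prefix_order.trans)
          moreover have "top x \<noteq> w"
          proof
            assume "top x = w"
            then have "addr w0 = addr w"
              using xw \<open>prefix (addr w0) (addr w)\<close> prefix_order.antisym by auto
            then show False using False addr_inj by blast
          qed
          ultimately show ?thesis by simp
        qed
      qed
      \<comment> \<open>If \<open>x\<close> is an ancestor of \<open>w0\<close>, key 3 puts the
        subtree of \<open>w0\<close> first. Otherwise the addresses diverge, and one of the two
        sibling orders does so.\<close>
      show ?thesis
      proof (cases "prefix (addr x) (addr w0)")
        case True
        then obtain a as where a: "addr w0 = addr x @ a # as"
          using np prefix_neq_decomp by (metis prefix_order.refl)
        have "forest_key 3 z < forest_key 3 x" if "(z, y) \<in> cov\<^sup>*" for z
          using main[OF that]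
        proof
          assume "top z = top x \<and> prefix (addr w0) (addr z)"
          then obtain bs where b: "addr z = addr x @ a # bs" "top z = top x"
            by (auto simp: prefix_def a)
          then show ?thesis
            unfolding forest_key_def using mirror_append_less[of "addr x" a bs "[]" "[]"] by simp
        qed (simp add: forest_key_def mirror_less)
        then show ?thesis by (intro exI[of _ 3]) auto
      next
        case False
        then obtain p a as b bs where ab: "a \<noteq> b" "addr x = p @ a # as" "addr w0 = p @ b # bs"
          using np parallel_decomp[of "addr x" "addr w0"] by (auto simp: parallel_def)
        define i :: nat where "i = (if a > b then 2 else 3)"
        have "forest_key i z < forest_key i x" if "(z, y) \<in> cov\<^sup>*" for z
          using main[OF that]
        proof
          assume "top z = top x \<and> prefix (addr w0) (addr z)"
          then obtain cs where b: "addr z = p @ b # cs" "top z = top x"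
            by (auto simp: prefix_def ab)
          show ?thesis
          proof (cases "a > b")
            case True
            then show ?thesis
              unfolding forest_key_def i_def using b ab by simp
          next
            case False
            then have "b > a" using ab by simp
            then show ?thesis
              unfolding forest_key_def i_def b ab using False mirror_diverge[of a b p cs "[]" as "[]"]
              by simp
          qed
        qed (auto simp: forest_key_def mirror_less i_def)
        then show ?thesis by (intro exI[of _ i]) (auto simp: i_def)
      qed
    qed
  qed
qed

end

section \<open>A separating family of sets\<close>

lemma exists_le_average:
  fixes f :: "'a \<Rightarrow> real" and q :: real
  assumes "finite \<Omega>" "\<Omega> \<noteq> {}" "(\<Sum>\<omega>\<in>\<Omega>. f \<omega>) \<le> q * card \<Omega>"
  shows "\<exists>\<omega>\<in>\<Omega>. f \<omega> \<le> q"
proof (rule ccontr)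
  assume "\<not> ?thesis"
  then have "(\<Sum>\<omega>\<in>\<Omega>. q) < (\<Sum>\<omega>\<in>\<Omega>. f \<omega>)"
    using assms by (intro sum_strict_mono) auto
  then show False using assms by (simp add: mult.commute)
qed

lemma sum_if_not_card:
  "finite A \<Longrightarrow> (\<Sum>x\<in>A. if Q x then 0 else 1 :: real) = card {x \<in> A. \<not> Q x}"
proof -
  assume A: "finite A"
  have "(\<Sum>x\<in>A. if Q x then 0 else 1 :: real) = (\<Sum>x\<in>A. if \<not> Q x then 1 else 0)"
    by (intro sum.cong) auto
  also have "\<dots> = (\<Sum>x\<in>{x \<in> A. \<not> Q x}. 1)"
    by (rule sum.inter_filter[OF A, symmetric])
  finally show ?thesis by simp
qed

text \<open>A random \<open>f\<close> maps \<open>a\<close> to 0 with probability 1/(2s), and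
  independently keeps all of \<open>S\<close> away from 0 with probability (1 - 1/(2s))^|S| >= 1/2,
  by Bernoulli's inequality.\<close>

lemma card_separating_functions:
  fixes s R a :: nat
  assumes s: "s \<ge> 1" and a: "a < R" and S: "S \<subseteq> {..<R}" "card S < s" "a \<notin> S"
  shows "real (card {f \<in> ({..<R} \<rightarrow>\<^sub>E {..<2 * s}). f a = 0 \<and> (\<forall>b\<in>S. f b \<noteq> 0)})
           \<ge> (1 / (4 * s)) * card ({..<R} \<rightarrow>\<^sub>E {..<2 * s})"
proof -
  define C where "C c = (if c = a then {0} else if c \<in> S then {1..<2 * s} else {..<2 * s})" for c
  have eq: "{f \<in> ({..<R} \<rightarrow>\<^sub>E {..<2 * s}). f a = 0 \<and> (\<forall>b\<in>S. f b \<noteq> 0)} = PiE {..<R} C"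
  proof (intro set_eqI iffI)
    fix f assume f: "f \<in> PiE {..<R} C"
    then have m: "f c \<in> C c" if "c < R" for c
      using that by auto
    have "f a = 0" using m[OF a] by (simp add: C_def)
    moreover have "f b \<noteq> 0" if "b \<in> S" for b
    proof -
      have "b < R" "b \<noteq> a" using that S by auto
      then show ?thesis using m[of b] that by (auto simp: C_def)
    qed
    moreover have "f c < 2 * s" if "c < R" for c
      using m[OF that] s by (auto simp: C_def split: if_splits)
    ultimately show "f \<in> {f \<in> ({..<R} \<rightarrow>\<^sub>E {..<2 * s}). f a = 0 \<and> (\<forall>b\<in>S. f b \<noteq> 0)}"
      using f by (auto simp: PiE_iff)
  qed (auto simp: PiE_iff C_def)
  let ?q = "1 / (2 * real s)"
  have card_C: "real (card (C c)) = 2 * s * ((if c = a then ?q else 1) * (if c \<in> S then 1 - ?q else 1))" for c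
    using s S by (auto simp: C_def field_simps of_nat_diff)
  have fS: "finite S" using S finite_subset by blast
  have "real (card (PiE {..<R} C)) = (\<Prod>c<R. real (card (C c)))"
    by (simp add: card_PiE)
  also have "\<dots> = (2 * s) ^ R * ((\<Prod>c<R. if c = a then ?q else 1) * (\<Prod>c<R. if c \<in> S then 1 - ?q else 1))"
    by (simp add: card_C prod.distrib del: of_nat_mult)
  also have "(\<Prod>c<R. if c = a then ?q else 1) = ?q"
    using a by (simp add: prod.delta)
  also have "(\<Prod>c<R. if c \<in> S then 1 - ?q else 1) = (1 - ?q) ^ card S"
    using S by (simp add: prod.If_cases Int_absorb1)
  finally have eq2: "real (card (PiE {..<R} C)) = (2 * s) ^ R * (?q * (1 - ?q) ^ card S)" by simp
  have "1 + real (card S) * (- ?q) \<le> (1 + (- ?q)) ^ card S"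
    using s by (intro Bernoulli_inequality) (auto simp: field_simps)
  moreover have "real (card S) * ?q \<le> 1 / 2"
    using s S(2) by (simp add: field_simps)
  ultimately have "(1 - ?q) ^ card S \<ge> 1 / 2"
    by simp
  then have "(2 * real s) ^ R * (?q * (1 - ?q) ^ card S) \<ge> (2 * real s) ^ R * (?q * (1 / 2))"
    by (intro mult_left_mono) auto
  then have "real (card (PiE {..<R} C)) \<ge> (2 * real s) ^ R * (?q * (1 / 2))"
    unfolding eq2 by simp
  then show ?thesis
    unfolding eq by (simp add: card_PiE mult_ac)
qed

text \<open>Greedy choice: by averaging, some function separates a 1/(4s) fraction of the pairs
  still open, so after \<open>t\<close> rounds fewer than one pair is left. The sets are the zero
  sets of the chosen functions.\<close>

lemma separating_family:
  fixes s R t :: nat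
  assumes s: "s \<ge> 1" and t: "real (R * (R + 1) ^ s) * (1 - 1 / (4 * s)) ^ t < 1"
  shows "\<exists>B :: nat \<Rightarrow> nat set. \<forall>a<R. \<forall>S. S \<subseteq> {..<R} \<and> card S < s \<and> a \<notin> S \<longrightarrow> (\<exists>j<t. a \<in> B j \<and> S \<inter> B j = {})"
proof -
  define V where "V = {(a, S). a < R \<and> S \<subseteq> {..<R} \<and> card S < s \<and> a \<notin> S}"
  \<comment> \<open>A set of fewer than \<open>s\<close> colours is listed by a word of length
    \<open>s\<close>, padded with the extra letter \<open>R\<close>.\<close>
  have "V \<subseteq> {..<R} \<times> ((\<lambda>xs. set xs \<inter> {..<R}) ` {xs. set xs \<subseteq> {..R} \<and> length xs = s})"
  proof (rule subrelI, rule SigmaI)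
    fix a S assume aS: "(a, S) \<in> V"
    then show "a \<in> {..<R}" by (auto simp: V_def)
    have "finite S" using aS finite_subset unfolding V_def by blast
    then obtain xs where xs: "set xs = S" "length xs = card S"
      using finite_distinct_list distinct_card by metis
    then have "S = set (xs @ replicate (s - card S) R) \<inter> {..<R}"
      using aS by (auto simp: V_def)
    moreover have "length (xs @ replicate (s - card S) R) = s" "set (xs @ replicate (s - card S) R) \<subseteq> {..R}"
      using aS xs by (auto simp: V_def)
    ultimately show "S \<in> (\<lambda>xs. set xs \<inter> {..<R}) ` {xs. set xs \<subseteq> {..R} \<and> length xs = s}"
      by (intro image_eqI[of _ _ "xs @ replicate (s - card S) R"]) auto
  qed
  moreover have fin: "finite {xs. set xs \<subseteq> {..R} \<and> length xs = s}"
    by (rule finite_lists_length_eq) auto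
  ultimately have cardV: "card V \<le> R * (R + 1) ^ s" and finV: "finite V"
  proof -
    let ?X = "(\<lambda>xs. set xs \<inter> {..<R}) ` {xs. set xs \<subseteq> {..R} \<and> length xs = s}"
    assume sub: "V \<subseteq> {..<R} \<times> ?X"
    have fX: "finite ?X" using fin by auto
    have "card ?X \<le> (R + 1) ^ s"
      using card_image_le[OF fin] card_lists_length_eq[of "{..R}" s] by simp
    then have "card ({..<R} \<times> ?X) \<le> R * (R + 1) ^ s"
      by (simp add: card_cartesian_product del: mult_Suc_right)
    then show "card V \<le> R * (R + 1) ^ s"
      using card_mono[OF _ sub] fX by (meson finite_SigmaI finite_lessThan le_trans)
    show "finite V" using finite_subset[OF sub] fX by blast
  qed
  define unc where "unc V' f = {(a, S) \<in> V'. \<not> (f a = (0::nat) \<and> (\<forall>b\<in>S. f b \<noteq> 0))}" for V' :: "(nat \<times> nat set) set" and f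
  have step: "\<exists>f. card (unc V' f) \<le> (1 - 1 / (4 * s)) * card V'" if V': "V' \<subseteq> V" for V'
  proof -
    let ?\<Omega> = "{..<R} \<rightarrow>\<^sub>E {..<2 * s}"
    have finV': "finite V'" using V' finV finite_subset by blast
    have fin\<Omega>: "finite ?\<Omega>" by (intro finite_PiE) auto
    have "real (card (unc V' f)) = (\<Sum>p\<in>V'. if f (fst p) = 0 \<and> (\<forall>b\<in>snd p. f b \<noteq> 0) then 0 else 1)" for f
      unfolding sum_if_not_card[OF finV'] unc_def
      by (intro arg_cong[where f = real] arg_cong[where f = card]) auto
    then have "(\<Sum>f\<in>?\<Omega>. real (card (unc V' f)))
        = (\<Sum>f\<in>?\<Omega>. \<Sum>p\<in>V'. if f (fst p) = 0 \<and> (\<forall>b\<in>snd p. f b \<noteq> 0) then 0 else 1)"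
      by simp
    also have "\<dots> = (\<Sum>p\<in>V'. \<Sum>f\<in>?\<Omega>. if f (fst p) = 0 \<and> (\<forall>b\<in>snd p. f b \<noteq> 0) then 0 else 1)"
      by (rule sum.swap)
    also have "\<dots> \<le> (\<Sum>p\<in>V'. (1 - 1 / (4 * s)) * card ?\<Omega>)"
    proof (intro sum_mono)
      fix p assume "p \<in> V'"
      moreover obtain a S where p: "p = (a, S)" by (cases p)
      ultimately have "(a, S) \<in> V'" by simp
      then have aS: "a < R" "S \<subseteq> {..<R}" "card S < s" "a \<notin> S" using V' by (auto simp: V_def)
      let ?G = "{f \<in> ?\<Omega>. f a = 0 \<and> (\<forall>b\<in>S. f b \<noteq> 0)}"
      have "(\<Sum>f\<in>?\<Omega>. if f a = 0 \<and> (\<forall>b\<in>S. f b \<noteq> 0) then 0 else 1 :: real) = real (card (?\<Omega> - ?G))"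
        unfolding sum_if_not_card[OF fin\<Omega>]
        by (intro arg_cong[where f = real] arg_cong[where f = card]) auto
      also have "\<dots> = card ?\<Omega> - real (card ?G)"
        using fin\<Omega> by (subst card_Diff_subset) (auto simp: of_nat_diff card_mono)
      also have "\<dots> \<le> (1 - 1 / (4 * s)) * card ?\<Omega>"
        using card_separating_functions[OF s aS] by (simp add: algebra_simps)
      finally show "(\<Sum>f\<in>?\<Omega>. if f (fst p) = 0 \<and> (\<forall>b\<in>snd p. f b \<noteq> 0) then 0 else 1) \<le> (1 - 1 / (4 * s)) * card ?\<Omega>"
        unfolding p by simp
    qed
    also have "\<dots> = ((1 - 1 / (4 * s)) * card V') * card ?\<Omega>"
      by simp
    finally have "\<exists>f\<in>?\<Omega>. real (card (unc V' f)) \<le> (1 - 1 / (4 * s)) * card V'"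
      using fin\<Omega> s by (intro exists_le_average) (auto simp: PiE_eq_empty_iff lessThan_empty_iff)
    then show ?thesis by blast
  qed
  have "\<exists>F :: nat \<Rightarrow> nat \<Rightarrow> nat. real (card {(a, S) \<in> V. \<forall>j<k. \<not> (F j a = 0 \<and> (\<forall>b\<in>S. F j b \<noteq> 0))})
          \<le> (1 - 1 / (4 * s)) ^ k * card V" for k
  proof (induction k)
    case 0
    then show ?case by simp
  next
    case (Suc k)
    then obtain F :: "nat \<Rightarrow> nat \<Rightarrow> nat" where F: "real (card {(a, S) \<in> V. \<forall>j<k. \<not> (F j a = 0 \<and> (\<forall>b\<in>S. F j b \<noteq> 0))})
          \<le> (1 - 1 / (4 * s)) ^ k * card V" by blast
    let ?V = "{(a, S) \<in> V. \<forall>j<k. \<not> (F j a = 0 \<and> (\<forall>b\<in>S. F j b \<noteq> 0))}"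
    obtain f where f: "card (unc ?V f) \<le> (1 - 1 / (4 * s)) * card ?V"
      using step[of ?V] by auto
    have "{(a, S) \<in> V. \<forall>j<Suc k. \<not> ((F(k := f)) j a = 0 \<and> (\<forall>b\<in>S. (F(k := f)) j b \<noteq> 0))} = unc ?V f"
      unfolding unc_def by (auto simp: less_Suc_eq)
    then have "real (card {(a, S) \<in> V. \<forall>j<Suc k. \<not> ((F(k := f)) j a = 0 \<and> (\<forall>b\<in>S. (F(k := f)) j b \<noteq> 0))})
                 \<le> (1 - 1 / (4 * s)) * card ?V"
      using f by simp
    also have "\<dots> \<le> (1 - 1 / (4 * s)) * ((1 - 1 / (4 * s)) ^ k * card V)"
      using F s by (intro mult_left_mono) (auto simp: field_simps)
    finally show ?case by (intro exI[of _ "F(k := f)"]) (simp add: mult_ac)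
  qed
  then obtain F :: "nat \<Rightarrow> nat \<Rightarrow> nat" where "real (card {(a, S) \<in> V. \<forall>j<t. \<not> (F j a = 0 \<and> (\<forall>b\<in>S. F j b \<noteq> 0))})
          \<le> (1 - 1 / (4 * s)) ^ t * card V" by blast
  also have "\<dots> \<le> (1 - 1 / (4 * s)) ^ t * (R * (R + 1) ^ s)"
    using cardV s by (intro mult_left_mono) (auto simp: field_simps simp flip: of_nat_mult of_nat_power of_nat_add)
  also have "\<dots> < 1" using t by (simp add: mult_ac)
  finally have c0: "card {(a, S) \<in> V. \<forall>j<t. \<not> (F j a = 0 \<and> (\<forall>b\<in>S. F j b \<noteq> 0))} = 0"
    by simp
  have "finite {(a, S) \<in> V. \<forall>j<t. \<not> (F j a = 0 \<and> (\<forall>b\<in>S. F j b \<noteq> 0))}"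
    by (rule finite_subset[OF _ finV]) auto
  then have "{(a, S) \<in> V. \<forall>j<t. \<not> (F j a = 0 \<and> (\<forall>b\<in>S. F j b \<noteq> 0))} = {}"
    using c0 by (simp only: card_0_eq)
  then show ?thesis
    unfolding V_def by (intro exI[of _ "\<lambda>j. {b. F j b = 0}"]) blast
qed

section \<open>Combining the keys\<close>

lemma poset_dim_le_coloured:
  fixes P :: "nat rel" and \<phi> \<psi> :: "nat \<Rightarrow> nat" and K :: "(nat \<Rightarrow> int list) set"
  assumes A: "finite A" and po: "partial_order_on A P" and nat: "P \<subseteq> {(x, y). x \<le> y}"
    and K: "finite K" "K \<noteq> {}"
    and KW: "\<And>x y. x \<in> A \<Longrightarrow> y \<in> W \<Longrightarrow> (x, y) \<notin> P \<Longrightarrow> \<exists>g\<in>K. key_separates P g x y"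
    and phi: "\<And>v. v \<in> A \<Longrightarrow> \<phi> v < r" and chi: "\<And>v. v \<in> A \<Longrightarrow> \<psi> v < R"
    and few: "\<And>y i. y \<in> A - W \<Longrightarrow> card {v \<in> below P y. \<phi> v = i} < s"
    and inj: "\<And>y. y \<in> A - W \<Longrightarrow> inj_on \<psi> (below P y)"
    and B: "\<And>a S. a < R \<Longrightarrow> S \<subseteq> {..<R} \<Longrightarrow> card S < s \<Longrightarrow> a \<notin> S \<Longrightarrow> \<exists>j<t. a \<in> B j \<and> S \<inter> B j = {}"
  shows "poset_dim A P \<le> card K + 2 * r * t"
proof -
  \<comment> \<open>The colour class \<open>i\<close> comes on top, inside it the colours of
    \<open>B j\<close> come last, and the natural order or its reverse decides the rest.\<close>
  define g where "g = (\<lambda>(i, j, b) v. [if \<phi> v = i then 1 else 0, if \<psi> v \<in> B j then 1 else 0,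
                           if b then int v else - int v])"
  let ?I = "{..<r} \<times> {..<t} \<times> (UNIV :: bool set)"
  have sub: "P \<subseteq> A \<times> A" 
    using po unfolding partial_order_on_def preorder_on_def by auto
  then have below_A: "below P y \<subseteq> A" for y unfolding below_def by auto
  have "poset_dim A P \<le> card (K \<union> g ` ?I)"
  proof (rule poset_dim_le_card_keys[OF A po nat])
    fix x y assume x: "x \<in> A" and y: "y \<in> A" and xy: "(x, y) \<notin> P"
    show "\<exists>h\<in>K \<union> g ` ?I. key_separates P h x y"
    proof (cases "y \<in> W")
      case True
      then show ?thesis using KW x xy by blast
    next
      case False
      define i where "i = \<phi> x"
      define T where "T = {v \<in> below P y. \<phi> v = i}"
      have finT: "finite T" "T \<subseteq> A" using below_A A unfolding T_def by (auto intro: finite_subset)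
      have "card (\<psi> ` T - {\<psi> x}) \<le> card T"
        using finT by (meson card_image_le card_mono Diff_subset finite_imageI le_trans)
      then have "card (\<psi> ` T - {\<psi> x}) < s"
        using few[of y i] y False unfolding T_def by auto
      then obtain j where j: "j < t" "\<psi> x \<in> B j" "(\<psi> ` T - {\<psi> x}) \<inter> B j = {}"
        using B[of "\<psi> x" "\<psi> ` T - {\<psi> x}"] chi x finT(2) by fastforce
      \<comment> \<open>By \<open>inj\<close> at most one vertex of \<open>T\<close> shares the
        colour \<open>\<psi> x\<close>, so one sign suffices to put it before \<open>x\<close>. This
        is the factor 2 in the bound.\<close>
      define b where "b \<longleftrightarrow> (\<forall>z\<in>T. \<psi> z = \<psi> x \<longrightarrow> z < x)"
      have "g (i, j, b) z < g (i, j, b) x" if z: "z \<in> below P y" for z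
      proof -
        have zx: "z \<noteq> x" using xy z unfolding below_def by auto
        consider "\<phi> z \<noteq> i" | "z \<in> T" "\<psi> z \<noteq> \<psi> x" | "z \<in> T" "\<psi> z = \<psi> x"
          unfolding T_def using z by blast
        then show ?thesis
        proof cases
          case 2
          then have "\<psi> z \<notin> B j" using j by blast
          then show ?thesis using 2 j by (simp add: g_def i_def)
        next
          case 3
          have "z' = z" if "z' \<in> T" "\<psi> z' = \<psi> x" for z'
            using inj[of y] y False that 3 unfolding inj_on_def T_def by auto
          then have "b \<longleftrightarrow> z < x" unfolding b_def using 3 by blast
          moreover have "\<phi> z = \<phi> x" using 3 by (simp add: T_def i_def)
          ultimately show ?thesis using 3 zx by (simp add: g_def) 
        qed (simp add: g_def i_def)
      qed
      moreover have "(i, j, b) \<in> ?I" using phi x j by (auto simp: i_def)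
      ultimately show ?thesis unfolding key_separates_def by blast
    qed
  qed (use K in auto)
  also have "\<dots> \<le> card K + card (g ` ?I)" by (rule card_Un_le)
  also have "card (g ` ?I) \<le> card ?I" by (rule card_image_le) auto
  also have "card ?I = 2 * r * t" by (simp add: card_cartesian_product)
  finally show ?thesis by simp
qed

section \<open>The region below the bad vertices\<close>

definition up :: "nat set set \<Rightarrow> nat rel" where
  "up E = {(u, v). u < v \<and> {u, v} \<in> E}"

lemma increasing_path_Cons:
  "increasing_path E (u # v # us) \<longleftrightarrow> (u, v) \<in> up E \<and> increasing_path E (v # us)"
  by (auto simp: increasing_path_def up_def)

lemma increasing_path_vertex:
  "increasing_path E q \<Longrightarrow> v \<in> set q \<Longrightarrow> (hd q, v) \<in> (up E)\<^sup>* \<and> (v, last q) \<in> (up E)\<^sup>*"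
proof (induction q arbitrary: v rule: induct_list012)
  case (3 x y zs)
  then have xy: "(x, y) \<in> up E" and p: "increasing_path E (y # zs)"
    by (auto simp: increasing_path_Cons)
  have y: "(y, w) \<in> (up E)\<^sup>* \<and> (w, last (y # zs)) \<in> (up E)\<^sup>*" if "w \<in> set (y # zs)" for w
    using 3(2)[OF p that] by simp
  show ?case
  proof (cases "v = x")
    case True
    then show ?thesis using y[of y] xy by (auto intro: converse_rtrancl_into_rtrancl)
  next
    case False
    then show ?thesis using y[of v] xy 3(4) by (auto intro: converse_rtrancl_into_rtrancl)
  qed
qed (auto simp: increasing_path_def)

lemma rtrancl_up_iff_path:
  "(i, j) \<in> (up E)\<^sup>* \<longleftrightarrow> (\<exists>q. increasing_path E q \<and> hd q = i \<and> last q = j)"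
proof
  assume "(i, j) \<in> (up E)\<^sup>*"
  then show "\<exists>q. increasing_path E q \<and> hd q = i \<and> last q = j"
  proof (induction rule: converse_rtrancl_induct)
    case base
    show ?case by (intro exI[of _ "[j]"]) (simp add: increasing_path_def)
  next
    case (step i k)
    then obtain q where q: "increasing_path E q" "hd q = k" "last q = j" by blast
    then obtain q' where "q = k # q'" by (cases q) (auto simp: increasing_path_def)
    then show ?case using q step(1)
      by (intro exI[of _ "i # q"]) (auto simp: increasing_path_Cons)
  qed
next
  assume "\<exists>q. increasing_path E q \<and> hd q = i \<and> last q = j"
  then obtain q where q: "increasing_path E q" "hd q = i" "last q = j" by blast
  then have "q \<noteq> []" by (auto simp: increasing_path_def)
  then show "(i, j) \<in> (up E)\<^sup>*"
    using increasing_path_vertex[OF q(1), of i] q by (metis hd_in_set)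
qed

lemma graph_poset_eq:
  "graph_poset n E = {(i, j). i \<in> {1..n} \<and> j \<in> {1..n} \<and> (i, j) \<in> (up E)\<^sup>*}"
  unfolding graph_poset_def rtrancl_up_iff_path by auto

lemma rtrancl_up_le: "(i, j) \<in> (up E)\<^sup>* \<Longrightarrow> i \<le> j"
  by (induction rule: rtrancl_induct) (auto simp: up_def)

locale bad_region =
  fixes n :: nat and E :: "nat set set" and Y :: "nat set"
  assumes E: "E \<subseteq> vertex_pairs n" and Y: "Y \<subseteq> {1..n}"
begin

abbreviation le (infix "\<preceq>" 50) where "u \<preceq> v \<equiv> (u, v) \<in> (up E)\<^sup>*"

lemma up_range: "(u, v) \<in> up E \<Longrightarrow> u \<in> {1..n} \<and> v \<in> {1..n} \<and> u < v"
  using E unfolding up_def vertex_pairs_def by auto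

lemma le_range: "u \<preceq> v \<Longrightarrow> v \<in> {1..n} \<Longrightarrow> u \<in> {1..n}"
  by (induction rule: converse_rtrancl_induct) (auto dest: up_range)

definition W :: "nat set" where "W = {v. \<exists>y\<in>Y. v \<preceq> y}"

lemma W_range: "W \<subseteq> {1..n}" and finite_W: "finite W"
proof -
  show "W \<subseteq> {1..n}" using Y le_range unfolding W_def by blast
  then show "finite W" by (rule finite_subset) auto
qed

lemma W_down: "v \<in> W \<Longrightarrow> u \<preceq> v \<Longrightarrow> u \<in> W"
  unfolding W_def using rtrancl_trans[of u v] by blast

lemma Y_W: "Y \<subseteq> W" unfolding W_def by auto

definition link :: "nat rel" where
  "link = {(u, v). u \<in> W \<and> v \<in> W \<and> ((u, v) \<in> up E \<or> (v, u) \<in> up E)}"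

lemma sym_link: "sym (link\<^sup>*)"
  by (rule sym_rtrancl) (auto simp: link_def sym_def)

lemma le_link: "u \<preceq> v \<Longrightarrow> v \<in> W \<Longrightarrow> (u, v) \<in> link\<^sup>*"
proof (induction rule: converse_rtrancl_induct)
  case (step u w)
  then have "w \<in> W" "u \<in> W" using W_down by (auto intro: converse_rtrancl_into_rtrancl)
  then have "(u, w) \<in> link" using step by (auto simp: link_def)
  then show ?case using step by (auto intro: converse_rtrancl_into_rtrancl)
qed simp

text \<open>The minimum makes the root depend on the component alone, so that it also serves as the
  name of the component.\<close>

definition root_of :: "nat \<Rightarrow> nat" where
  "root_of v = Min {y \<in> Y. (v, y) \<in> link\<^sup>*}"

lemma root_of: assumes "v \<in> W" shows "root_of v \<in> Y" "(v, root_of v) \<in> link\<^sup>*"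
proof -
  have "finite {y \<in> Y. (v, y) \<in> link\<^sup>*}"
    using Y by (auto intro: finite_subset)
  moreover obtain y where "y \<in> Y" "v \<preceq> y" using assms unfolding W_def by blast
  then have "{y \<in> Y. (v, y) \<in> link\<^sup>*} \<noteq> {}"
    using le_link Y_W by blast
  ultimately have "root_of v \<in> {y \<in> Y. (v, y) \<in> link\<^sup>*}"
    unfolding root_of_def by (rule Min_in)
  then show "root_of v \<in> Y" "(v, root_of v) \<in> link\<^sup>*" by auto
qed

lemma root_of_cong: "(u, v) \<in> link\<^sup>* \<Longrightarrow> root_of u = root_of v"
proof -
  assume uv: "(u, v) \<in> link\<^sup>*"
  then have "(v, u) \<in> link\<^sup>*" using sym_link by (auto dest: symD)
  then have "{y \<in> Y. (u, y) \<in> link\<^sup>*} = {y \<in> Y. (v, y) \<in> link\<^sup>*}"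
    using uv by (auto intro: rtrancl_trans)
  then show ?thesis unfolding root_of_def by simp
qed

lemma root_of_le: "u \<preceq> v \<Longrightarrow> v \<in> W \<Longrightarrow> root_of u = root_of v"
  using le_link root_of_cong by blast

text \<open>\<open>X k\<close> is reached from the roots by \<open>k\<close> alternating closures, first downwards, then upwards.
  Parents never have a larger level, so a path to the root has at most one monotone piece per
  level.\<close>

primrec X :: "nat \<Rightarrow> nat set" where
  "X 0 = root_of ` W"
| "X (Suc k) = (if even k then {v \<in> W. \<exists>u\<in>X k. v \<preceq> u} else {v \<in> W. \<exists>u\<in>X k. u \<preceq> v})"

lemma X_W: "X k \<subseteq> W"
  using root_of(1) Y_W by (cases k) auto

lemma X_Suc: "X k \<subseteq> X (Suc k)"
  using X_W[of k] by auto

lemma X_mono: "k \<le> l \<Longrightarrow> X k \<subseteq> X l"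
  using lift_Suc_mono_le[of X] X_Suc by blast

lemma X_odd_down:
  assumes "odd k" "v \<in> X k" "u \<preceq> v"
  shows "u \<in> X k"
proof -
  obtain j where k: "k = Suc j" using assms(1) by (cases k) auto
  then obtain w where "w \<in> X j" "v \<preceq> w" using assms by auto
  then show ?thesis
    using k assms W_down[OF _ assms(3)] rtrancl_trans[OF assms(3)] by auto
qed

lemma X_even_up:
  assumes "even k" "k > 0" "u \<in> X k" "u \<preceq> v" "v \<in> W"
  shows "v \<in> X k"
proof -
  obtain j where k: "k = Suc j" using assms(2) by (cases k) auto
  then obtain w where "w \<in> X j" "w \<preceq> u" using assms by auto
  then show ?thesis
    using k assms rtrancl_trans[OF _ assms(4)] by auto
qed

lemma X_Suc_down: "even k \<Longrightarrow> v \<in> X k \<Longrightarrow> u \<preceq> v \<Longrightarrow> u \<in> X (Suc k)"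
  using X_W[of k] W_down by auto

lemma X_Suc_up: "odd k \<Longrightarrow> u \<in> X k \<Longrightarrow> u \<preceq> v \<Longrightarrow> v \<in> W \<Longrightarrow> v \<in> X (Suc k)"
  by auto

lemma reach: "v \<in> W \<Longrightarrow> \<exists>k. v \<in> X k"
proof -
  assume v: "v \<in> W"
  then have "(root_of v, v) \<in> link\<^sup>*"
    using root_of(2) sym_link by (auto dest: symD)
  then show ?thesis
  proof (induction rule: rtrancl_induct)
    case base
    show ?case using v by (intro exI[of _ 0]) simp
  next
    case (step u w)
    then obtain k where "u \<in> X k" by blast
    then have u: "u \<in> X (2 * k)" "u \<in> X (2 * k + 1)" using X_mono[of k "2 * k"] X_mono[of k "2 * k + 1"] by auto
    have w: "w \<in> W" using step by (auto simp: link_def)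
    show ?case
    proof (cases "(u, w) \<in> up E")
      case True
      then have "w \<in> X (Suc (2 * k + 1))" using u(2) w X_Suc_up[of "2 * k + 1" u w] by auto
      then show ?thesis by blast
    next
      case False
      then have "(w, u) \<in> up E" using step by (auto simp: link_def)
      then have "w \<in> X (Suc (2 * k))" using u(1) X_Suc_down[of "2 * k" u w] by auto
      then show ?thesis by blast
    qed
  qed
qed

declare X.simps [simp del]

lemma X_SucD: "v \<in> X (Suc k) \<Longrightarrow> even k \<Longrightarrow> \<exists>u\<in>X k. v \<preceq> u"
  "v \<in> X (Suc k) \<Longrightarrow> odd k \<Longrightarrow> \<exists>u\<in>X k. u \<preceq> v"
  by (auto simp: X.simps)

definition level :: "nat \<Rightarrow> nat" where "level v = (LEAST k. v \<in> X k)"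

lemma X_iff_level: "v \<in> W \<Longrightarrow> v \<in> X k \<longleftrightarrow> level v \<le> k"
proof
  assume "v \<in> X k"
  then show "level v \<le> k" unfolding level_def by (rule Least_le)
next
  assume "v \<in> W" "level v \<le> k"
  then have "v \<in> X (level v)" unfolding level_def using reach LeastI_ex[of "\<lambda>k. v \<in> X k"] by blast
  then show "v \<in> X k" using X_mono[OF \<open>level v \<le> k\<close>] by blast
qed

lemma level_le_odd: "u \<preceq> v \<Longrightarrow> v \<in> W \<Longrightarrow> odd (level v) \<Longrightarrow> level u \<le> level v"
  using X_odd_down[of "level v" v u] X_iff_level W_down by blast

lemma level_le_even: "u \<preceq> v \<Longrightarrow> v \<in> W \<Longrightarrow> even (level u) \<Longrightarrow> level u > 0 \<Longrightarrow> level v \<le> level u"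
  using X_even_up[of "level u" u v] X_iff_level W_down by blast

lemma level_below:
  assumes "u \<preceq> v" "v \<in> W"
  shows "level u \<le> Suc (level v)"
proof (cases "even (level v)")
  case True
  then have "u \<in> X (Suc (level v))"
    using X_Suc_down[OF True _ assms(1)] X_iff_level[OF assms(2)] by blast
  then show ?thesis using X_iff_level W_down assms by blast
next
  case False
  then show ?thesis using level_le_odd[OF assms] by simp
qed

text \<open>Roots are excluded because the first closure goes downwards: a vertex above a root may
  have level 2.\<close>

lemma level_above:
  assumes "u \<preceq> v" "v \<in> W" "level u > 0"
  shows "level v \<le> Suc (level u)"
proof (cases "odd (level u)")
  case True
  have "u \<in> X (level u)" using X_iff_level W_down assms by blast
  then have "v \<in> X (Suc (level u))"
    using X_Suc_up[OF True _ assms(1,2)] by blast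
  then show ?thesis using X_iff_level assms by blast
next
  case False
  then show ?thesis using level_le_even[OF assms(1,2)] assms(3) by simp
qed

text \<open>The parity of the level records the direction of the last closure: an odd level is
  reached by descending, so the parent lies above, and conversely for an even level.\<close>

definition is_par :: "nat \<Rightarrow> nat \<Rightarrow> bool" where
  "is_par v u \<longleftrightarrow> u \<in> W \<and> level u \<le> level v \<and>
     (if odd (level v) then (v, u) \<in> up E else (u, v) \<in> up E)"

text \<open>The neighbour of \<open>v\<close> on a monotone path to the previous level belongs to
  the same closure as \<open>v\<close>, so its level is not larger.\<close>

lemma par_exists:
  assumes v: "v \<in> W" "level v > 0"
  shows "\<exists>u. is_par v u"
proof -
  obtain k where k: "level v = Suc k" using v by (cases "level v") auto
  have vX: "v \<in> X (Suc k)" "v \<notin> X k" using X_iff_level[OF v(1)] k by auto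
  show ?thesis
  proof (cases "even k")
    case True
    then obtain u where u: "u \<in> X k" "v \<preceq> u" using vX X_SucD(1) by blast
    then have "v \<noteq> u" using vX by auto
    then obtain w where w: "(v, w) \<in> up E" "w \<preceq> u" using u by (meson converse_rtranclE)
    have wX: "w \<in> X (Suc k)" using X_Suc_down[OF True u(1) w(2)] .
    then have "w \<in> W" using X_W by blast
    then have "w \<in> W" "level w \<le> level v" using wX X_iff_level k by auto
    then show ?thesis using w True k unfolding is_par_def by auto
  next
    case False
    then obtain u where u: "u \<in> X k" "u \<preceq> v" using vX X_SucD(2) by blast
    then have "v \<noteq> u" using vX by auto
    then obtain w where w: "(w, v) \<in> up E" "u \<preceq> w" using u by (metis rtranclE)
    then have wW: "w \<in> W" using W_down[OF v(1) r_into_rtrancl[OF w(1)]] by simp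
    then have "w \<in> X (Suc k)" using X_Suc_up[OF False u(1) w(2)] by simp
    then have "level w \<le> level v" using X_iff_level[OF wW] k by simp
    then show ?thesis using w wW False k unfolding is_par_def by auto
  qed
qed

definition par :: "nat \<Rightarrow> nat option" where
  "par v = (if v \<in> W \<and> level v > 0 then Some (SOME u. is_par v u) else None)"

lemma par_Some: "par v = Some u \<Longrightarrow> is_par v u"
  using someI_ex[OF par_exists] unfolding par_def by (auto split: if_splits)

lemma par_None: "v \<in> W \<Longrightarrow> par v = None \<longleftrightarrow> level v = 0"
  unfolding par_def by auto

text \<open>Lexicographic in the level and the position within it: the parent is the larger vertex
  at an odd level and the smaller one at an even level. The factor \<open>n + 1\<close> exceeds the
  second summand.\<close>

definition rk :: "nat \<Rightarrow> nat" where
  "rk v = level v * (n + 1) + (if odd (level v) then n - v else v)"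

lemma rk_less: "par v = Some u \<Longrightarrow> rk u < rk v"
proof -
  assume a: "par v = Some u"
  then have *: "is_par v u" by (rule par_Some)
  have r: "v \<le> n" "u \<le> n" using * up_range unfolding is_par_def by (auto split: if_splits)
  show ?thesis
  proof (cases "level u = level v")
    case True
    then show ?thesis using * r unfolding is_par_def rk_def by (auto split: if_splits dest!: up_range)
  next
    case False
    then have "Suc (level u) \<le> level v" using * unfolding is_par_def by auto
    then have "Suc (level u) * (n + 1) \<le> level v * (n + 1)" by (rule mult_le_mono1)
    moreover have "(if odd (level u) then n - u else u) < n + 1" using r by auto
    ultimately show ?thesis unfolding rk_def by (auto split: if_splits)
  qed
qed

text \<open>The edges outside the spanning forest, each closing a cycle with it. They point upwards,
  so \<open>Domain extra\<close> consists of lower ends.\<close>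

definition extra :: "nat rel" where
  "extra = {(a, b) \<in> up E. a \<in> W \<and> b \<in> W \<and> par a \<noteq> Some b \<and> par b \<noteq> Some a}"

lemma root_of_up: "(a, b) \<in> up E \<Longrightarrow> b \<in> W \<Longrightarrow> root_of a = root_of b"
  using root_of_le by blast

text \<open>With one vertex \<open>z\<close> per component meeting the extra edge, a pair not separated by the forests
  outside the up-set and outside the down-set of \<open>Z\<close> satisfies \<open>x \<preceq> z\<close> and \<open>z' \<preceq> y\<close>, so its two
  vertices lie in different components.\<close>

lemma region_keys:
  assumes ex: "\<And>a b a' b'. (a, b) \<in> extra \<Longrightarrow> (a', b') \<in> extra \<Longrightarrow> root_of a = root_of a' \<Longrightarrow> a = a'"
  shows "\<exists>K :: (nat \<Rightarrow> int list) set. finite K \<and> K \<noteq> {} \<and> card K \<le> 10 \<and>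
    (\<forall>x\<in>{1..n}. \<forall>y\<in>W. (x, y) \<notin> graph_poset n E \<longrightarrow> (\<exists>g\<in>K. key_separates (graph_poset n E) g x y))"
proof -
  \<comment> \<open>By \<open>ex\<close> all extra edges of a component share their lower end.
    \<open>W1\<close> and \<open>W2\<close> avoid it, so their edges form forests; \<open>W1\<close>
    is closed downwards, and \<open>W2\<close> upwards within \<open>W\<close>.\<close>
  define Z where "Z = Domain extra"
  define W1 where "W1 = {v \<in> W. \<not> (\<exists>z\<in>Z. z \<preceq> v)}"
  define W2 where "W2 = {v \<in> W. \<not> (\<exists>z\<in>Z. v \<preceq> z)}"
  define c1 where "c1 = up E \<inter> W1 \<times> W1"
  define c2 where "c2 = up E \<inter> W2 \<times> W2"
  have f: "rooted_forest (up E \<inter> A \<times> A) par rk" if "A \<subseteq> W - Z" for A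
  proof
    show "par u = Some v \<or> par v = Some u" if "(u, v) \<in> up E \<inter> A \<times> A" for u v
    proof (rule ccontr)
      assume "\<not> ?thesis"
      then have "(u, v) \<in> extra" using that \<open>A \<subseteq> W - Z\<close> unfolding extra_def by auto
      then show False using that \<open>A \<subseteq> W - Z\<close> unfolding Z_def by auto
    qed
    show "(v, u) \<notin> up E \<inter> A \<times> A" if "(u, v) \<in> up E \<inter> A \<times> A" for u v
      using that up_range[of u v] up_range[of v u] by auto
  qed (rule rk_less)
  interpret F1: rooted_forest c1 par rk
    unfolding c1_def by (rule f) (unfold W1_def, fast)
  interpret F2: rooted_forest c2 par rk
    unfolding c2_def by (rule f) (unfold W2_def, fast)
  \<comment> \<open>The leading entry puts \<open>W1\<close> before all else in \<open>k1\<close>;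
    in \<open>k2\<close> it puts \<open>W2\<close> after the rest of \<open>W\<close> and before the
    vertices outside. \<open>k3\<close> sorts whole components by their roots, in either
    order.\<close>
  define k1 where "k1 i v = (if v \<in> W1 then 0 # F1.forest_key i v else [1])" for i v
  define k2 where "k2 i v = (if v \<in> W2 then 1 # F2.forest_key i v else if v \<in> W then [0] else [2])" for i v
  define k3 where "k3 b v = (if v \<in> W then [if b then int (root_of v) else - int (root_of v)] else [int n + 1])" for b v
  let ?K = "k1 ` {..<4} \<union> k2 ` {..<4} \<union> k3 ` (UNIV :: bool set)"
  have "card ?K \<le> card (k1 ` {..<4}) + card (k2 ` {..<4}) + card (k3 ` (UNIV :: bool set))"
    by (meson add_le_mono card_Un_le le_refl le_trans)
  also have "\<dots> \<le> 4 + 4 + 2"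
    by (intro add_mono order_trans[OF card_image_le]) auto
  finally have card: "card ?K \<le> 10" by simp
  have c1: "z \<in> W1 \<and> (z, y) \<in> c1\<^sup>*" if "z \<preceq> y" "y \<in> W1" for z y
    using that
  proof (induction rule: converse_rtrancl_induct)
    case (step z w)
    then have w: "w \<in> W1" "(w, y) \<in> c1\<^sup>*" by auto
    moreover have "z \<in> W1" using w(1) step(1) W_down unfolding W1_def by (auto intro: rtrancl_into_rtrancl)
    ultimately show ?case using step(1) unfolding c1_def by (auto intro: converse_rtrancl_into_rtrancl)
  qed auto
  have c2: "y \<in> W2 \<and> (z, y) \<in> c2\<^sup>*" if "z \<preceq> y" "z \<in> W2" "y \<in> W" for z y
    using that
  proof (induction rule: rtrancl_induct)
    case (step y w)
    then have "y \<in> W" using W_down by blast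
    then have y: "y \<in> W2" "(z, y) \<in> c2\<^sup>*" using step by auto
    moreover have "w \<in> W2" using y(1) step unfolding W2_def by (auto intro: converse_rtrancl_into_rtrancl)
    ultimately show ?case using step(2) unfolding c2_def by (auto intro: rtrancl_into_rtrancl)
  qed auto
  have "\<exists>g\<in>?K. key_separates (graph_poset n E) g x y"
    if x: "x \<in> {1..n}" and y: "y \<in> W" and xy: "(x, y) \<notin> graph_poset n E" for x y
  proof -
    have nle: "\<not> x \<preceq> y" using x y xy W_range unfolding graph_poset_eq by auto
    have below: "z \<preceq> y \<and> z \<in> W \<and> root_of z = root_of y" if "z \<in> below (graph_poset n E) y" for z
      using that y W_down root_of_le unfolding below_def graph_poset_eq by auto
    have rn: "root_of v \<le> n" if "v \<in> W" for v
      using root_of(1)[OF that] Y by auto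
    consider "x \<notin> W" | "x \<in> W" "y \<in> W1" | "x \<in> W2" "y \<notin> W1" | "x \<in> W - W2" "y \<in> W - W1"
      using y by blast
    then show ?thesis
    proof cases
      case 1
      have "k3 True z < k3 True x" if "z \<in> below (graph_poset n E) y" for z
        using below[OF that] 1 rn[of z] unfolding k3_def by auto
      then show ?thesis unfolding key_separates_def by blast
    next
      case 2
      show ?thesis
      proof (cases "x \<in> W1")
        case True
        have "(x, y) \<notin> c1\<^sup>*" using nle rtrancl_mono[of c1 "up E"] unfolding c1_def by blast
        then obtain i where i: "i < 4" "\<And>z. (z, y) \<in> c1\<^sup>* \<Longrightarrow> F1.forest_key i z < F1.forest_key i x"
          using F1.forest_key_separates by blast
        have "k1 i z < k1 i x" if "z \<in> below (graph_poset n E) y" for z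
          using below[OF that] c1[of z y] 2 i(2)[of z] True unfolding k1_def by auto
        then show ?thesis using i(1) unfolding key_separates_def by blast
      next
        case False
        have "k1 0 z < k1 0 x" if "z \<in> below (graph_poset n E) y" for z
          using below[OF that] c1[of z y] 2 False unfolding k1_def by auto
        then show ?thesis unfolding key_separates_def by (intro bexI[of _ "k1 0"]) auto
      qed
    next
      case 3
      have "(x, y) \<notin> c2\<^sup>*" using nle rtrancl_mono[of c2 "up E"] unfolding c2_def by blast
      then obtain i where i: "i < 4" "\<And>z. (z, y) \<in> c2\<^sup>* \<Longrightarrow> F2.forest_key i z < F2.forest_key i x"
        using F2.forest_key_separates by blast
      have "k2 i z < k2 i x" if "z \<in> below (graph_poset n E) y" for z
        using below[OF that] c2[of z y] 3 y i(2)[of z] unfolding k2_def by auto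
      then show ?thesis using i(1) unfolding key_separates_def by blast
    next
      case 4
      then obtain z1 z0 where z: "z1 \<in> Z" "x \<preceq> z1" "z0 \<in> Z" "z0 \<preceq> y"
        unfolding W1_def W2_def by auto
      then have zW: "z1 \<in> W" "z0 \<in> W" unfolding Z_def extra_def by auto
      have ne: "root_of x \<noteq> root_of y"
      proof
        assume "root_of x = root_of y"
        then have "root_of z1 = root_of z0" using z zW y root_of_le by metis
        then have "z1 = z0" using ex z unfolding Z_def by blast
        then show False using z nle by (meson rtrancl_trans)
      qed
      have "k3 (root_of y < root_of x) z < k3 (root_of y < root_of x) x" if "z \<in> below (graph_poset n E) y" for z
        using below[OF that] 4 ne unfolding k3_def by auto
      then show ?thesis unfolding key_separates_def by blast
    qed
  qed
  then show ?thesis using card by (intro exI[of _ ?K]) auto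
qed

end

section \<open>Tree-like configurations of increasing paths\<close>

fun elist :: "nat list \<Rightarrow> nat set list" where
  "elist (x # y # zs) = {x, y} # elist (y # zs)"
| "elist _ = []"

lemma elist_sub: "e \<in> set (elist q) \<Longrightarrow> e \<subseteq> set q"
  by (induction q rule: elist.induct) auto

lemma elist_append: "elist (us @ w # vs) = elist (us @ [w]) @ elist (w # vs)"
  by (induction us rule: elist.induct) simp_all

lemma increasing_path_edges: "increasing_path E q \<longleftrightarrow> q \<noteq> [] \<and> sorted_wrt (<) q \<and> set (elist q) \<subseteq> E"
proof -
  have "successively (\<lambda>u v. {u, v} \<in> E) q \<longleftrightarrow> set (elist q) \<subseteq> E"
    by (induction q rule: elist.induct) auto
  then show ?thesis unfolding increasing_path_def by auto
qed

lemma elist_two: "sorted_wrt (<) q \<Longrightarrow> e \<in> set (elist q) \<Longrightarrow> \<exists>x y. x < y \<and> e = {x, y} \<and> x \<in> set q \<and> y \<in> set q"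
proof (induction q rule: elist.induct)
  case (1 x y zs)
  show ?case
  proof (cases "e = {x, y}")
    case True
    then show ?thesis using 1(2) by (intro exI[of _ x] exI[of _ y]) simp
  next
    case False
    then obtain x' y' where "x' < y'" "e = {x', y'}" "x' \<in> set (y # zs)" "y' \<in> set (y # zs)"
      using 1 by auto
    then show ?thesis by (intro exI[of _ x'] exI[of _ y']) simp
  qed
qed auto

lemma distinct_elist: "sorted_wrt (<) q \<Longrightarrow> distinct (elist q)"
proof (induction q rule: elist.induct)
  case (1 x y zs)
  have "{x, y} \<notin> set (elist (y # zs))"
    using elist_sub[of "{x, y}" "y # zs"] 1(2) by auto
  then show ?case using 1 by auto
qed auto

text \<open>A configuration is recorded as the list of the end points of its edge-disjoint increasing
  paths. A new path is attached at an inner vertex \<open>w\<close> of an old one, which is split there. The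
  code \<open>(k, d)\<close> names the old path and the direction of the new one; reducing \<open>k\<close> modulo the length
  makes every code valid. Recent paths stand in front, so that small codes suffice for them.\<close>

definition attach :: "nat \<times> bool \<Rightarrow> nat \<times> nat \<Rightarrow> (nat \<times> nat) list \<Rightarrow> (nat \<times> nat) list" where
  "attach c x ps = (let k = fst c mod length ps; p = ps ! k in
     (fst p, fst x) # (fst x, snd p) # (if snd c then (fst x, snd x) else (snd x, fst x)) #
     take k ps @ drop (Suc k) ps)"

fun build :: "(nat \<times> bool) list \<Rightarrow> (nat \<times> nat) list \<Rightarrow> (nat \<times> nat) list \<Rightarrow> (nat \<times> nat) list" where
  "build (c # cs) (x # xs) ps = build cs xs (attach c x ps)"
| "build _ _ ps = ps"

lemma build_append:
  "length cs = length xs \<Longrightarrow> build (cs @ cs') (xs @ xs') ps = build cs' xs' (build cs xs ps)"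
  by (induction cs xs ps rule: build.induct) auto

text \<open>Paths may share vertices but not edges, which is what makes their probabilities
  multiply.\<close>

definition realises :: "nat set set \<Rightarrow> (nat \<times> nat) list \<Rightarrow> nat list list \<Rightarrow> bool" where
  "realises E ps qs \<longleftrightarrow>
     list_all2 (\<lambda>p q. increasing_path E q \<and> hd q = fst p \<and> last q = snd p) ps qs \<and>
     distinct (concat (map elist qs))"

definition verts :: "nat list list \<Rightarrow> nat set" where
  "verts qs = \<Union>(set ` set qs)"

text \<open>The vertices at which a code below \<open>j\<close> can attach a path. Keeping
  \<open>j\<close> small bounds the number of codes.\<close>

definition near :: "nat list list \<Rightarrow> nat \<Rightarrow> nat set" where
  "near qs j = \<Union>(set ` set (take j qs))"

lemma near_sub: "near qs j \<subseteq> verts qs"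
  unfolding near_def verts_def using set_take_subset by fast

definition seg :: "nat set set \<Rightarrow> bool \<Rightarrow> nat \<Rightarrow> nat \<Rightarrow> nat list \<Rightarrow> bool" where
  "seg E d w v q \<longleftrightarrow> increasing_path E q \<and> (if d then hd q = w \<and> last q = v else hd q = v \<and> last q = w)"

text \<open>The new path meets the old ones at most in \<open>w\<close>, so it repeats no edge, and
  cutting a path at \<open>w\<close> keeps its edges. Three paths enter at the front, so the window
  \<open>j\<close> becomes \<open>j + 3\<close>.\<close>

lemma attach_realises:
  assumes r: "realises E ps qs" and w: "w \<in> near qs j"
    and q: "seg E d w v q" "set q \<inter> verts qs \<subseteq> {w}"
  shows "\<exists>k qs'. k < j \<and> k < length ps \<and> realises E (attach (k, d) (w, v) ps) qs' \<and>
     verts qs' = verts qs \<union> set q \<and> near qs j \<union> set q \<subseteq> near qs' (j + 3) \<and> set q \<subseteq> near qs' 3 \<and>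
     length (attach (k, d) (w, v) ps) = length ps + 2 \<and>
     set (concat (map elist qs')) = set (concat (map elist qs)) \<union> set (elist q)"
proof -
  let ?R = "\<lambda>p q. increasing_path E q \<and> hd q = fst p \<and> last q = snd p"
  have la: "list_all2 ?R ps qs" and dist: "distinct (concat (map elist qs))"
    using r unfolding realises_def by auto
  have len: "length ps = length qs" using la list_all2_lengthD by blast
  obtain p where p: "p \<in> set (take j qs)" "w \<in> set p" using w unfolding near_def by auto
  then obtain k where k: "k < j" "k < length qs" "qs ! k = p"
    by (auto simp: in_set_conv_nth)
  obtain us vs where p_split: "p = us @ w # vs" using p(2) by (meson split_list)
  have pR: "increasing_path E p" "hd p = fst (ps ! k)" "last p = snd (ps ! k)"
    using list_all2_nthD2[OF la k(2)] k(3) by auto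
  define rest where "rest = take k qs @ drop (Suc k) qs"
  define qs' where "qs' = (us @ [w]) # (w # vs) # q # rest"
  have qs_split: "qs = take k qs @ p # drop (Suc k) qs"
    using k id_take_nth_drop by metis
  have edges_p: "elist p = elist (us @ [w]) @ elist (w # vs)"
    unfolding p_split by (rule elist_append)
  have m1: "mset (concat (map elist qs)) = mset (elist p) + mset (concat (map elist rest))"
    by (subst qs_split) (simp add: rest_def)
  have m2: "mset (concat (map elist qs')) = mset (elist p) + mset (elist q) + mset (concat (map elist rest))"
    by (simp add: qs'_def edges_p)
  have qi: "increasing_path E q" using q(1) unfolding seg_def by simp
  then have qs_sorted: "sorted_wrt (<) q" by (simp add: increasing_path_def)
  have disj: "set (elist q) \<inter> set (concat (map elist qs)) = {}"
  proof (rule ccontr)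
    assume "\<not> ?thesis"
    then obtain e q0 where e: "e \<in> set (elist q)" "q0 \<in> set qs" "e \<in> set (elist q0)" by auto
    obtain x y where xy: "x < y" "e = {x, y}" "x \<in> set q" "y \<in> set q"
      using elist_two[OF qs_sorted e(1)] by blast
    have "e \<subseteq> verts qs" using elist_sub[OF e(3)] e(2) unfolding verts_def by auto
    then show False using xy q(2) by auto
  qed
  have "distinct (concat (map elist qs @ [elist q]))"
    using dist disj distinct_elist[OF qs_sorted] by auto
  moreover have "mset (concat (map elist qs')) = mset (concat (map elist qs @ [elist q]))"
    using m1 m2 by (simp add: add_ac)
  ultimately have dist': "distinct (concat (map elist qs'))"
    by (metis mset_eq_imp_distinct_iff)
  have es: "set (concat (map elist qs')) = set (concat (map elist qs)) \<union> set (elist q)"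
    using arg_cong[OF m1, of set_mset] arg_cong[OF m2, of set_mset] by (auto simp del: set_concat)
  have psplit: "increasing_path E (us @ [w])" "increasing_path E (w # vs)"
    using pR(1) unfolding p_split increasing_path_edges elist_append[of us w vs]
    by (auto simp: sorted_wrt_append)
  have "list_all2 ?R (take k ps @ drop (Suc k) ps) rest"
    unfolding rest_def using la by (intro list_all2_appendI list_all2_takeI list_all2_dropI)
  then have "list_all2 ?R (attach (k, d) (w, v) ps) qs'"
    using psplit pR q(1) k len p_split unfolding attach_def qs'_def seg_def
    by (cases us) (auto simp: Let_def)
  then have "realises E (attach (k, d) (w, v) ps) qs'"
    unfolding realises_def using dist' by simp
  moreover have "verts qs' = verts qs \<union> set q"
  proof -
    have "set qs = insert p (set rest)" by (subst qs_split) (auto simp: rest_def)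
    then show ?thesis unfolding verts_def qs'_def by (auto simp: p_split)
  qed
  moreover have "near qs j \<union> set q \<subseteq> near qs' (j + 3)"
  proof -
    have "set (take j qs) \<subseteq> insert p (set (take j rest))"
    proof
      fix x assume "x \<in> set (take j qs)"
      then obtain i where i: "i < j" "i < length qs" "x = qs ! i" by (auto simp: in_set_conv_nth)
      show "x \<in> insert p (set (take j rest))"
      proof (cases "i < k")
        case True
        then have "rest ! i = x" "i < length rest" using i k by (auto simp: rest_def nth_append)
        then show ?thesis using i by (auto simp: in_set_conv_nth intro!: exI[of _ i])
      next
        case False
        show ?thesis
        proof (cases "i = k")
          case False2: False
          then have "rest ! (i - 1) = x" "i - 1 < length rest" using False i k by (auto simp: rest_def nth_append min_def)
          then show ?thesis using i by (auto simp: in_set_conv_nth intro!: exI[of _ "i - 1"])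
        qed (use i k in simp)
      qed
    qed
    then have "near qs j \<subseteq> set p \<union> \<Union>(set ` set (take j rest))" unfolding near_def by auto
    moreover have "near qs' (j + 3) = set (us @ [w]) \<union> set (w # vs) \<union> set q \<union> \<Union>(set ` set (take j rest))"
      unfolding near_def qs'_def by (simp add: numeral_3_eq_3 Un_assoc)
    ultimately show ?thesis unfolding p_split by auto
  qed
  moreover have "set q \<subseteq> near qs' 3"
    unfolding near_def qs'_def by (auto simp: numeral_3_eq_3)
  moreover have "length (attach (k, d) (w, v) ps) = length ps + 2"
    using k len by (simp add: attach_def Let_def)
  ultimately show ?thesis using k len es by auto
qed

text \<open>Cutting a path at its first vertex in \<open>S\<close> gives a segment that meets
  \<open>S\<close> in one end only. \<open>S\<close> will be the set of vertices in use or a closure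
  \<open>X k\<close>.\<close>

lemma first_hit:
  "(v, y) \<in> (up E)\<^sup>* \<Longrightarrow> y \<in> S \<Longrightarrow> \<exists>q w. seg E False w v q \<and> set q \<inter> S = {w} \<and> (w, y) \<in> (up E)\<^sup>*"
proof (induction rule: converse_rtrancl_induct)
  case base
  then show ?case by (intro exI[of _ "[y]"] exI[of _ y]) (auto simp: seg_def increasing_path_def)
next
  case (step v v')
  show ?case
  proof (cases "v \<in> S")
    case True
    then show ?thesis using step
      by (intro exI[of _ "[v]"] exI[of _ v]) (auto simp: seg_def increasing_path_def intro: converse_rtrancl_into_rtrancl)
  next
    case False
    obtain q w where q: "seg E False w v' q" "set q \<inter> S = {w}" "(w, y) \<in> (up E)\<^sup>*" using step by blast
    then obtain q' where "q = v' # q'" by (cases q) (auto simp: seg_def increasing_path_def)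
    then show ?thesis using q False step(1)
      by (intro exI[of _ "v # q"] exI[of _ w]) (auto simp: seg_def increasing_path_Cons)
  qed
qed

lemma increasing_path_snoc:
  "increasing_path E q \<Longrightarrow> (last q, v) \<in> up E \<Longrightarrow> increasing_path E (q @ [v])"
proof (induction q rule: induct_list012)
  case (3 x y zs)
  then show ?case using increasing_path_Cons[of E x y "zs @ [v]"] by (auto simp: increasing_path_Cons)
qed (auto simp: increasing_path_def up_def)

lemma last_hit:
  "(y, v) \<in> (up E)\<^sup>* \<Longrightarrow> y \<in> S \<Longrightarrow> \<exists>q w. seg E True w v q \<and> set q \<inter> S = {w} \<and> (y, w) \<in> (up E)\<^sup>*"
proof (induction rule: rtrancl_induct)
  case base
  then show ?case by (intro exI[of _ "[y]"] exI[of _ y]) (auto simp: seg_def increasing_path_def)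
next
  case (step v' v)
  show ?case
  proof (cases "v \<in> S")
    case True
    then show ?thesis using step
      by (intro exI[of _ "[v]"] exI[of _ v]) (auto simp: seg_def increasing_path_def intro: rtrancl_into_rtrancl)
  next
    case False
    obtain q w where q: "seg E True w v' q" "set q \<inter> S = {w}" "(y, w) \<in> (up E)\<^sup>*" using step by blast
    then have "q \<noteq> []" by (auto simp: seg_def increasing_path_def)
    then show ?thesis using q False step(2) increasing_path_snoc
      by (intro exI[of _ "q @ [v]"] exI[of _ w]) (auto simp: seg_def)
  qed
qed

lemma seg_vertex:
  "seg E True w v q \<Longrightarrow> u \<in> set q \<Longrightarrow> (w, u) \<in> (up E)\<^sup>* \<and> (u, v) \<in> (up E)\<^sup>*"
  "seg E False w v q \<Longrightarrow> u \<in> set q \<Longrightarrow> (v, u) \<in> (up E)\<^sup>* \<and> (u, w) \<in> (up E)\<^sup>*"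
  unfolding seg_def using increasing_path_vertex by auto

lemma seg_ends: "seg E d w v q \<Longrightarrow> w \<in> set q \<and> v \<in> set q"
  unfolding seg_def increasing_path_def by (cases d) auto

section \<open>Long alternations and pairs of extra edges contain large configurations\<close>

lemma attach_build:
  "length cs = length xs \<Longrightarrow> build (cs @ [c]) (xs @ [x]) ps = attach c x (build cs xs ps)"
  by (simp add: build_append)

context bad_region
begin

text \<open>Cut where it meets \<open>X k\<close>, the segment has level exactly
  \<open>Suc k\<close> elsewhere, so segments of different levels overlap at most in their ends. The
  bound on \<open>k\<close> keeps away from the roots, which \<open>level_above\<close>
  excludes.\<close>

lemma zigzag_step:
  assumes v: "v \<in> W" "level v = Suc k" "k \<ge> 2"
  shows "\<exists>u q. u \<in> W \<and> level u = k \<and> seg E (odd k) u v q \<and> (\<forall>w\<in>set q - {u}. w \<in> W \<and> level w = Suc k)"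
proof -
  have vX: "v \<in> X (Suc k)" using X_iff_level v by auto
  show ?thesis
  proof (cases "even k")
    case True
    then obtain u' where u': "u' \<in> X k" "v \<preceq> u'" using X_SucD(1) vX by blast
    then obtain q u where q: "seg E False u v q" "set q \<inter> X k = {u}" "u \<preceq> u'"
      using first_hit by blast
    have u: "u \<in> W" "level u \<le> k" using q(2) X_W X_iff_level by blast+
    moreover have "v \<preceq> u" using seg_vertex(2)[OF q(1)] seg_ends[OF q(1)] by blast
    then have "level v \<le> Suc (level u)" using level_below u by blast
    moreover have "w \<in> W \<and> level w = Suc k" if "w \<in> set q - {u}" for w
    proof -
      have "w \<preceq> u" "w \<notin> X k" using seg_vertex(2)[OF q(1)] q(2) that by auto
      then have "w \<in> X (Suc k)" using X_Suc_down[OF True] q(2) by blast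
      then show ?thesis using X_W X_iff_level[of w] \<open>w \<notin> X k\<close> by (metis in_mono le_antisym not_less_eq_eq)
    qed
    ultimately show ?thesis using q(1) True v by auto
  next
    case False
    then obtain u' where u': "u' \<in> X k" "u' \<preceq> v" using X_SucD(2) vX by blast
    then obtain q u where q: "seg E True u v q" "set q \<inter> X k = {u}" "u' \<preceq> u"
      using last_hit by blast
    have u: "u \<in> W" "level u \<le> k" using q(2) X_W X_iff_level by blast+
    have uv: "u \<preceq> v" using seg_vertex(1)[OF q(1)] seg_ends[OF q(1)] by blast
    have "level u > 0"
    proof (rule ccontr)
      assume "\<not> level u > 0"
      then have "u \<in> X 1" using X_iff_level u by auto
      then have "v \<in> X (Suc 1)" using X_Suc_up[of 1 u v] uv v by simp
      then show False using v X_iff_level[of v "Suc 1"] by auto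
    qed
    then have "level v \<le> Suc (level u)" using level_above uv v by blast
    moreover have "w \<in> W \<and> level w = Suc k" if "w \<in> set q - {u}" for w
    proof -
      have w: "u \<preceq> w" "w \<preceq> v" "w \<notin> X k" using seg_vertex(1)[OF q(1)] q(2) that by auto
      then have "w \<in> W" using W_down v by blast
      then have "w \<in> X (Suc k)" using X_Suc_up[OF False] q(2) w by blast
      then show ?thesis using X_iff_level[OF \<open>w \<in> W\<close>] w(3) \<open>w \<in> W\<close> by (metis le_antisym not_less_eq_eq)
    qed
    ultimately show ?thesis using q(1) False v u by auto
  qed
qed

text \<open>Each path to \<open>y\<close> is cut where it meets the vertices in use. That point is
  below \<open>y\<close>, so its level exceeds \<open>L\<close> and it lies on a recent path. Hence
  the codes do not grow with the older part of the configuration.\<close>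

lemma attach_below:
  assumes r: "realises E ps qs" and y: "y \<in> verts qs" "y \<in> W"
    and lev: "\<And>u. u \<preceq> y \<Longrightarrow> level u > L"
    and near: "{u \<in> verts qs. level u > L} \<subseteq> near qs j"
    and vs: "\<And>v. v \<in> set vs \<Longrightarrow> v \<preceq> y" and vW: "verts qs \<subseteq> W"
  shows "\<exists>cs xs qs'. length cs = length vs \<and> length xs = length vs \<and> map snd xs = vs \<and>
     (\<forall>c\<in>set cs. fst c < j + 3 * length vs) \<and> set xs \<subseteq> W \<times> W \<and> realises E (build cs xs ps) qs' \<and>
     verts qs \<subseteq> verts qs' \<and> verts qs' \<subseteq> verts qs \<union> {u. u \<preceq> y} \<and>
     {u \<in> verts qs'. level u > L} \<subseteq> near qs' (j + 3 * length vs)"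
  using vs
proof (induction vs rule: rev_induct)
  case Nil
  then show ?case using r near by (intro exI[of _ "[]"] exI[of _ qs]) auto
next
  case (snoc v vs)
  then obtain cs xs qs' where IH: "length cs = length vs" "length xs = length vs" "map snd xs = vs"
     "\<forall>c\<in>set cs. fst c < j + 3 * length vs" "set xs \<subseteq> W \<times> W" "realises E (build cs xs ps) qs'"
     "verts qs \<subseteq> verts qs'" "verts qs' \<subseteq> verts qs \<union> {u. u \<preceq> y}"
     "{u \<in> verts qs'. level u > L} \<subseteq> near qs' (j + 3 * length vs)" by auto
  have "v \<preceq> y" using snoc by simp
  then obtain q w where q: "seg E False w v q" "set q \<inter> verts qs' = {w}" "w \<preceq> y"
    using first_hit[of v y E "verts qs'"] IH(7) y(1) by blast
  have w: "w \<in> near qs' (j + 3 * length vs)" using q IH(9) lev by blast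
  obtain k qs'' where k: "k < j + 3 * length vs"
    "realises E (attach (k, False) (w, v) (build cs xs ps)) qs''"
    "verts qs'' = verts qs' \<union> set q" "near qs' (j + 3 * length vs) \<union> set q \<subseteq> near qs'' (j + 3 * length vs + 3)"
    using attach_realises[OF IH(6) w q(1)] q(2) by auto
  have qy: "u \<preceq> y" if "u \<in> set q" for u
    using seg_vertex(2)[OF q(1) that] q(3) rtrancl_trans[of u w] by blast
  have "w \<in> W" "v \<in> W" using q(3) \<open>v \<preceq> y\<close> y(2) W_down by blast+
  moreover have "{u \<in> verts qs''. level u > L} \<subseteq> near qs'' (j + 3 * length vs + 3)"
    using k(3,4) IH(9) by auto
  moreover have "build (cs @ [(k, False)]) (xs @ [(w, v)]) ps = attach (k, False) (w, v) (build cs xs ps)"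
    using IH(1,2) by (simp add: attach_build)
  moreover have "verts qs'' \<subseteq> verts qs \<union> {u. u \<preceq> y}" using k(3) IH(8) qy by blast
  moreover have "verts qs \<subseteq> verts qs''" using k(3) IH(7) by blast
  moreover have "\<forall>c\<in>set (cs @ [(k, False)]). fst c < j + 3 * length (vs @ [v])"
    using IH(4) k(1) by auto
  moreover have "j + 3 * length (vs @ [v]) = j + 3 * length vs + 3" by simp
  ultimately show ?case using IH(1-3,5) k(2)
    by (intro exI[of _ "cs @ [(k, False)]"] exI[of _ "xs @ [(w, v)]"] exI[of _ qs'']) (simp add: add_ac)
qed

text \<open>A group spans four levels, with the bad vertex \<open>y\<close> in the middle. Its
  down-set stays strictly between the levels \<open>L\<close> and \<open>L + 4\<close>, so different
  groups use disjoint down-sets. The attachments are the four sides of the zigzag and one path per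
  witness; the window grows by 3 each time, whence the bound on the codes.\<close>

lemma group_exists:
  assumes L: "even L" "L \<ge> 2" and r: "realises E ps qs"
    and old: "\<And>u. u \<in> verts qs \<Longrightarrow> u \<in> W \<and> level u \<le> L" and t0: "t0 \<in> near qs 3"
    and q1: "seg E False t0 t1 q1" "\<And>u. u \<in> set q1 - {t0} \<Longrightarrow> u \<in> W \<and> level u = L + 1"
    and q2: "seg E True t1 t2 q2" "\<And>u. u \<in> set q2 - {t1} \<Longrightarrow> u \<in> W \<and> level u = L + 2"
    and q3: "seg E False t2 t3 q3" "\<And>u. u \<in> set q3 - {t2} \<Longrightarrow> u \<in> W \<and> level u = L + 3"
    and q4: "seg E True t3 t4 q4" "\<And>u. u \<in> set q4 - {t3} \<Longrightarrow> u \<in> W \<and> level u = L + 4"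
    and lev: "t1 \<in> W" "level t1 = L + 1" "t2 \<in> W" "level t2 = L + 2" "t3 \<in> W" "level t3 = L + 3"
      "t4 \<in> W" "level t4 = L + 4"
    and T: "\<And>y v. y \<in> Y \<Longrightarrow> v \<in> set (T y) \<Longrightarrow> v \<preceq> y"
  shows "\<exists>y\<in>Y. \<exists>cs xs qs'. length cs = length (T y) + 4 \<and> length xs = length (T y) + 4 \<and>
    (\<forall>c\<in>set cs. fst c < 3 * (length (T y) + 5)) \<and> set xs \<subseteq> W \<times> W \<and>
    map snd (take (length (T y)) (drop 3 xs)) = T y \<and>
    realises E (build cs xs ps) qs' \<and> (\<forall>u\<in>verts qs'. u \<in> W \<and> level u \<le> L + 4) \<and> t4 \<in> near qs' 3 \<and>
    (\<forall>v\<in>set (T y). L < level v \<and> level v < L + 4)"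
proof -
  obtain y where y: "y \<in> Y" "t2 \<preceq> y" using lev(3) unfolding W_def by auto
  have yW: "y \<in> W" using y Y_W by auto
  have t2y: "level u = L + 2 \<and> u \<in> W" if "t2 \<preceq> u" "u \<preceq> y" for u
  proof -
    have uW: "u \<in> W" using that W_down yW by blast
    have "level u \<le> L + 2" using level_le_even[OF that(1) uW] lev L by auto
    moreover have "\<not> level u \<le> L + 1"
    proof
      assume "level u \<le> L + 1"
      then have "u \<in> X (L + 1)" using X_iff_level[OF uW] by simp
      then have "t2 \<in> X (L + 1)" using X_odd_down[OF _ _ that(1)] L by auto
      then show False using X_iff_level[OF lev(3)] lev by auto
    qed
    ultimately show ?thesis using uW by auto
  qed
  have ylev: "level y = L + 2" using t2y[of y] y by auto
  have below_y: "L < level u \<and> level u < L + 4" if "u \<preceq> y" for u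
  proof -
    have "level u \<le> L + 3" using level_below[OF that yW] ylev by auto
    moreover have "\<not> level u \<le> L"
    proof
      assume "level u \<le> L"
      then have "u \<in> X L" using X_iff_level W_down[OF yW that] by blast
      then have "y \<in> X L" using X_even_up[OF L(1) _ _ that yW] L by auto
      then show False using X_iff_level[OF yW] ylev by auto
    qed
    ultimately show ?thesis by auto
  qed
  obtain p where p: "increasing_path E p" "hd p = t2" "last p = y"
    using y(2) rtrancl_up_iff_path by blast
  \<comment> \<open>The second side is prolonged from \<open>t2\<close> to \<open>y\<close>, so that
    the witness paths can be attached below \<open>y\<close>.\<close>
  define q2' where "q2' = q2 @ tl p"
  have q2p: "seg E True t1 y q2'"
  proof -
    have "increasing_path E q2'"
      unfolding q2'_def using q2(1) p by (intro increasing_path_join) (auto simp: seg_def)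
    moreover have "last q2' = y" "hd q2' = t1"
      using q2(1) p by (cases p; auto simp: q2'_def seg_def increasing_path_def)+
    ultimately show ?thesis unfolding seg_def by simp
  qed
  have set2: "set q2' = set q2 \<union> set p"
    using q2(1) p by (cases p) (auto simp: q2'_def seg_def increasing_path_def)
  have q2l: "u \<in> W \<and> level u = L + 2" if "u \<in> set q2' - {t1}" for u
    using that q2(2) increasing_path_vertex[OF p(1)] p t2y unfolding set2 by auto
  have t2q: "t2 \<in> set q2'" using seg_ends[OF q2(1)] set2 by auto
  text \<open>Each new path leaves the old vertices at its starting point because it lies in a new level.\<close>
  let ?a1 = "\<lambda>k1. attach (k1, False) (t0, t1) ps"
  have I0: "{u \<in> verts qs. level u > L} \<union> {t0} \<subseteq> near qs 3" using old t0 by force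
  have "set q1 \<inter> verts qs \<subseteq> {t0}" using q1(2) old by fastforce
  then obtain k1 qs1 where k1: "k1 < 3" "realises E (?a1 k1) qs1"
    "verts qs1 = verts qs \<union> set q1" "near qs 3 \<union> set q1 \<subseteq> near qs1 6"
    using attach_realises[OF r t0 q1(1)] by auto
  have l1: "u \<in> W \<and> level u \<le> L + 1" if "u \<in> verts qs1" for u
    using that k1(3) q1(2)[of u] old[of u] near_sub[of qs 3] t0 by (cases "u = t0") auto
  have I1: "{u \<in> verts qs1. level u > L} \<subseteq> near qs1 6" using k1 I0 by auto
  have t1n: "t1 \<in> near qs1 6" using k1 seg_ends[OF q1(1)] by auto
  have "set q2' \<inter> verts qs1 \<subseteq> {t1}" using q2l l1 by fastforce
  then obtain k2 qs2 where k2: "k2 < 6" "realises E (attach (k2, True) (t1, y) (?a1 k1)) qs2"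
    "verts qs2 = verts qs1 \<union> set q2'" "near qs1 6 \<union> set q2' \<subseteq> near qs2 9"
    using attach_realises[OF k1(2) t1n q2p] by auto
  have l2: "u \<in> W \<and> level u \<le> L + 2" if "u \<in> verts qs2" for u
    using that k2(3) q2l[of u] l1[of u] lev by (cases "u = t1") force+
  have I2: "{u \<in> verts qs2. level u > L} \<subseteq> near qs2 9" using k2 I1 by auto
  have t2n: "t2 \<in> near qs2 9" using k2 t2q by auto
  have "set q3 \<inter> verts qs2 \<subseteq> {t2}" using q3(2) l2 by fastforce
  then obtain k3 qs3 where k3: "k3 < 9"
    "realises E (attach (k3, False) (t2, t3) (attach (k2, True) (t1, y) (?a1 k1))) qs3"
    "verts qs3 = verts qs2 \<union> set q3" "near qs2 9 \<union> set q3 \<subseteq> near qs3 12"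
    using attach_realises[OF k2(2) t2n q3(1)] by auto
  have l3: "u \<in> W \<and> level u \<le> L + 3" if "u \<in> verts qs3" for u
    using that k3(3) q3(2)[of u] l2[of u] lev by (cases "u = t2") force+
  have I3: "{u \<in> verts qs3. level u > L} \<subseteq> near qs3 12" using k3 I2 by auto
  let ?c3 = "[(k1, False), (k2, True), (k3, False)]"
  let ?x3 = "[(t0, t1), (t1, y), (t2, t3)]"
  have r3: "realises E (build ?c3 ?x3 ps) qs3" using k3(2) by simp
  have yv: "y \<in> verts qs3" using k3(3) k2(3) seg_ends[OF q2p] by auto
  obtain cs xs qs4 where c: "length cs = length (T y)" "length xs = length (T y)" "map snd xs = T y"
     "\<forall>c\<in>set cs. fst c < 12 + 3 * length (T y)" "set xs \<subseteq> W \<times> W" "realises E (build cs xs (build ?c3 ?x3 ps)) qs4"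
     "verts qs3 \<subseteq> verts qs4" "verts qs4 \<subseteq> verts qs3 \<union> {u. u \<preceq> y}"
     "{u \<in> verts qs4. level u > L} \<subseteq> near qs4 (12 + 3 * length (T y))"
    using attach_below[OF r3 yv yW, of L 12 "T y"] below_y I3 T[OF y(1)] l3 by blast
  have l4: "u \<in> W \<and> level u \<le> L + 3" if "u \<in> verts qs4" for u
    using that c(8) l3[of u] below_y[of u] W_down[OF yW, of u] by auto
  have "t3 \<in> verts qs4" using c(7) k3(3) seg_ends[OF q3(1)] by auto
  then have t3n: "t3 \<in> near qs4 (12 + 3 * length (T y))" using c(9) lev by auto
  have "set q4 \<inter> verts qs4 \<subseteq> {t3}" using q4(2) l4 by fastforce
  then obtain k4 qs5 where k4: "k4 < 12 + 3 * length (T y)"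
    "realises E (attach (k4, True) (t3, t4) (build cs xs (build ?c3 ?x3 ps))) qs5"
    "verts qs5 = verts qs4 \<union> set q4" "set q4 \<subseteq> near qs5 3"
    using attach_realises[OF c(6) t3n q4(1)] by auto
  have l5: "u \<in> W \<and> level u \<le> L + 4" if "u \<in> verts qs5" for u
    using that k4(3) q4(2)[of u] l4[of u] lev by (cases "u = t3") force+
  let ?cs = "?c3 @ cs @ [(k4, True)]" and ?xs = "?x3 @ xs @ [(t3, t4)]"
  have "build ?cs ?xs ps = attach (k4, True) (t3, t4) (build cs xs (build ?c3 ?x3 ps))"
    using c(1,2) by (simp add: attach_build)
  then have "realises E (build ?cs ?xs ps) qs5" using k4(2) by simp
  moreover have "t0 \<in> W" using old t0 near_sub by blast
  moreover have "t4 \<in> near qs5 3" using k4(4) seg_ends[OF q4(1)] by auto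
  moreover have "\<forall>c\<in>set ?cs. fst c < 3 * (length (T y) + 5)" using c(4) k1(1) k2(1) k3(1) k4(1) by auto
  ultimately show ?thesis using c(1-3,5) l5 lev yW below_y T[OF y(1)]
    by (intro bexI[OF _ y(1)] exI[of _ ?cs] exI[of _ ?xs] exI[of _ qs5]) auto
qed

text \<open>The witnesses of successive groups lie strictly between the levels 4i + 2 and 4i + 6, so
  their lists are disjoint. The chain starts at level 2, where \<open>zigzag_step\<close> becomes
  available.\<close>

lemma long_alternation:
  assumes T: "\<And>y v. y \<in> Y \<Longrightarrow> v \<in> set (T y) \<Longrightarrow> v \<preceq> y" and dT: "\<And>y. y \<in> Y \<Longrightarrow> distinct (T y)"
  shows "t \<in> W \<Longrightarrow> level t = 4 * m + 2 \<Longrightarrow> \<exists>p0\<in>W. \<exists>gs qs. length gs = m \<and>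
     (\<forall>(y, cs, xs)\<in>set gs. y \<in> Y \<and> length cs = length (T y) + 4 \<and> length xs = length (T y) + 4 \<and>
        (\<forall>c\<in>set cs. fst c < 3 * (length (T y) + 5)) \<and> set xs \<subseteq> W \<times> W \<and>
        map snd (take (length (T y)) (drop 3 xs)) = T y) \<and>
     realises E (build (concat (map (fst \<circ> snd) gs)) (concat (map (snd \<circ> snd) gs)) [(p0, p0)]) qs \<and>
     (\<forall>u\<in>verts qs. u \<in> W \<and> level u \<le> 4 * m + 2) \<and> t \<in> near qs 3 \<and>
     distinct (concat (map (T \<circ> fst) gs)) \<and> (\<forall>v\<in>set (concat (map (T \<circ> fst) gs)). level v < 4 * m + 2)"
proof (induction m arbitrary: t)
  case 0
  have "realises E [(t, t)] [[t]]"
    by (simp add: realises_def increasing_path_def)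
  then show ?case using 0
    by (intro bexI[of _ t] exI[of _ "[]"] exI[of _ "[[t]]"]) (auto simp: verts_def near_def)
next
  case (Suc m)
  define L where "L = 4 * m + 2"
  have L: "even L" "L \<ge> 2" by (auto simp: L_def)
  have t4: "t \<in> W" "level t = L + 4" using Suc.prems by (auto simp: L_def)
  obtain t3 q4 where 4: "t3 \<in> W" "level t3 = L + 3" "seg E True t3 t q4" "\<And>w. w \<in> set q4 - {t3} \<Longrightarrow> w \<in> W \<and> level w = L + 4"
    using zigzag_step[of t "L + 3"] t4 L by auto
  obtain t2 q3 where 3: "t2 \<in> W" "level t2 = L + 2" "seg E False t2 t3 q3" "\<And>w. w \<in> set q3 - {t2} \<Longrightarrow> w \<in> W \<and> level w = L + 3"
    using zigzag_step[of t3 "L + 2"] 4 L by auto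
  obtain t1 q2 where 2: "t1 \<in> W" "level t1 = L + 1" "seg E True t1 t2 q2" "\<And>w. w \<in> set q2 - {t1} \<Longrightarrow> w \<in> W \<and> level w = L + 2"
    using zigzag_step[of t2 "L + 1"] 3 L by auto
  obtain t0 q1 where 1: "t0 \<in> W" "level t0 = 4 * m + 2" "seg E False t0 t1 q1" "\<And>w. w \<in> set q1 - {t0} \<Longrightarrow> w \<in> W \<and> level w = L + 1"
    using zigzag_step[of t1 L] 2 L unfolding L_def by auto
  obtain p0 gs qs where IH: "p0 \<in> W" "length gs = m"
     "\<forall>(y, cs, xs)\<in>set gs. y \<in> Y \<and> length cs = length (T y) + 4 \<and> length xs = length (T y) + 4 \<and>
        (\<forall>c\<in>set cs. fst c < 3 * (length (T y) + 5)) \<and> set xs \<subseteq> W \<times> W \<and>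
        map snd (take (length (T y)) (drop 3 xs)) = T y"
     "realises E (build (concat (map (fst \<circ> snd) gs)) (concat (map (snd \<circ> snd) gs)) [(p0, p0)]) qs"
     "\<forall>u\<in>verts qs. u \<in> W \<and> level u \<le> 4 * m + 2" "t0 \<in> near qs 3"
     "distinct (concat (map (T \<circ> fst) gs))" "\<forall>v\<in>set (concat (map (T \<circ> fst) gs)). level v < 4 * m + 2"
    using Suc.IH[OF 1(1,2)] by blast
  have old: "u \<in> W \<and> level u \<le> L" if "u \<in> verts qs" for u
    using IH(5) that by (simp add: L_def)
  obtain y cs xs qs' where g: "y \<in> Y" "length cs = length (T y) + 4" "length xs = length (T y) + 4"
    "\<forall>c\<in>set cs. fst c < 3 * (length (T y) + 5)" "set xs \<subseteq> W \<times> W"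
    "map snd (take (length (T y)) (drop 3 xs)) = T y"
    "realises E (build cs xs (build (concat (map (fst \<circ> snd) gs)) (concat (map (snd \<circ> snd) gs)) [(p0, p0)])) qs'"
    "\<forall>u\<in>verts qs'. u \<in> W \<and> level u \<le> L + 4" "t \<in> near qs' 3"
    "\<forall>v\<in>set (T y). L < level v \<and> level v < L + 4"
    using group_exists[OF L IH(4) old IH(6) 1(3,4) 2(3,4) 3(3,4) 4(3,4) 2(1,2) 3(1,2) 4(1,2) t4 T]
    by blast
  note g = g(1-7) g(8-10)[unfolded L_def]
  have "length (concat (map (fst \<circ> snd) gs)) = length (concat (map (snd \<circ> snd) gs))"
    using IH(3) by (induction gs) auto
  then have "build (concat (map (fst \<circ> snd) (gs @ [(y, cs, xs)]))) (concat (map (snd \<circ> snd) (gs @ [(y, cs, xs)]))) [(p0, p0)]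
     = build cs xs (build (concat (map (fst \<circ> snd) gs)) (concat (map (snd \<circ> snd) gs)) [(p0, p0)])"
    by (simp add: build_append)
  moreover have "distinct (concat (map (T \<circ> fst) (gs @ [(y, cs, xs)])))"
    using IH(7,8) g(1,10) dT by fastforce
  moreover have "\<forall>v\<in>set (concat (map (T \<circ> fst) (gs @ [(y, cs, xs)]))). level v < 4 * Suc m + 2"
    using IH(8) g(10) by fastforce
  ultimately show ?case using IH(1-3) g
    by (intro bexI[of _ p0] exI[of _ "gs @ [(y, cs, xs)]"] exI[of _ qs']) (auto simp: comp_def)
qed

end

section \<open>Branches of the spanning forest that lead to extra edges\<close>

definition block :: "nat \<Rightarrow> nat \<Rightarrow> (nat \<times> bool) list set" where
  "block J l = {c # cs | c cs. fst c < J \<and> length cs = l \<and> (\<forall>c'\<in>set cs. fst c' < 3)}"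

context bad_region
begin

definition par_edges :: "nat set set" where
  "par_edges = {e. \<exists>v u. par v = Some u \<and> e = {v, u}}"

lemma root_of_level_0: "a \<in> W \<Longrightarrow> level a = 0 \<Longrightarrow> root_of a = a"
proof -
  assume "a \<in> W" "level a = 0"
  then have "a \<in> X 0" using X_iff_level by simp
  then obtain v where "v \<in> W" "a = root_of v" by (auto simp: X.simps)
  then show ?thesis using root_of_cong[OF root_of(2)[of v]] by simp
qed

lemma par_root_of: "par v = Some u \<Longrightarrow> root_of u = root_of v"
proof -
  assume p: "par v = Some u"
  then have "v \<in> W" by (auto simp: par_def split: if_splits)
  then show ?thesis using par_Some[OF p] root_of_up[of v u] root_of_up[of u v]
    unfolding is_par_def by (auto split: if_splits)
qed

text \<open>Parents within one level all lie in the same direction, so following them until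
  \<open>S\<close> or a lower level is reached traces a monotone path. A vertex of level 0 is a root
  and lies in \<open>S\<close>.\<close>

lemma par_run:
  "a \<in> W \<Longrightarrow> a \<notin> S \<Longrightarrow> root_of a \<in> S \<Longrightarrow>
     \<exists>w q. seg E (even (level a)) w a q \<and> w \<in> W \<and> root_of w = root_of a \<and> (w \<in> S \<or> level w < level a) \<and>
       (\<forall>u\<in>set q - {w}. u \<notin> S \<and> u \<in> W \<and> level u = level a \<and> (\<exists>t\<in>set q. par u = Some t)) \<and>
       set (elist q) \<subseteq> par_edges"
proof (induction "rk a" arbitrary: a rule: less_induct)
  case less
  have "level a \<noteq> 0" using less.prems root_of_level_0 by metis
  then obtain u where u: "par a = Some u" using par_None[OF less.prems(1)] by fastforce
  then have pu: "u \<in> W" "level u \<le> level a" "if odd (level a) then (a, u) \<in> up E else (u, a) \<in> up E"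
    using par_Some unfolding is_par_def by blast+
  have ru: "root_of u = root_of a" using par_root_of[OF u] .
  have e: "{a, u} \<in> par_edges" using u unfolding par_edges_def by blast
  have ne: "a \<noteq> u" using rk_less[OF u] by auto
  show ?case
  proof (cases "u \<in> S \<or> level u < level a")
    case True
    let ?q = "if odd (level a) then [a, u] else [u, a]"
    have "seg E (even (level a)) u a ?q"
      using pu(3) by (auto simp: seg_def increasing_path_Cons) (auto simp: increasing_path_def)
    moreover have "set (elist ?q) \<subseteq> par_edges" using e by (auto simp: insert_commute)
    moreover have "set ?q = {a, u}" by auto
    ultimately show ?thesis using True pu ru less.prems u ne
      by (intro exI[of _ u] exI[of _ ?q]) auto
  next
    case False
    then have lu: "level u = level a" using pu by simp
    obtain w q where q: "seg E (even (level u)) w u q" "w \<in> W" "root_of w = root_of u" "w \<in> S \<or> level w < level u"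
       "\<forall>x\<in>set q - {w}. x \<notin> S \<and> x \<in> W \<and> level x = level u \<and> (\<exists>t\<in>set q. par x = Some t)" "set (elist q) \<subseteq> par_edges"
      using less.hyps[OF rk_less[OF u] pu(1)] False ru less.prems by auto
    let ?q = "if odd (level a) then a # q else q @ [a]"
    have qne: "q \<noteq> []" using q(1) by (auto simp: seg_def increasing_path_def)
    have uq: "u \<in> set q" using seg_ends[OF q(1)] by simp
    have s: "seg E (even (level a)) w a ?q \<and> set (elist ?q) \<subseteq> par_edges"
    proof (cases "odd (level a)")
      case True
      then obtain q' where q': "q = u # q'" using q(1) lu qne by (cases q) (auto simp: seg_def)
      then show ?thesis using q(1,6) lu True pu(3) e
        by (auto simp: seg_def increasing_path_Cons)
    next
      case even: False
      then have lq: "last q = u" using q(1) lu by (simp add: seg_def)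
      then obtain q' where q': "q = q' @ [u]" using qne by (metis append_butlast_last_id)
      have "increasing_path E (q @ [a])"
        using q(1) lu even pu(3) lq increasing_path_snoc[of E q a] by (auto simp: seg_def)
      moreover have "elist (q @ [a]) = elist q @ [{u, a}]"
        unfolding q' using elist_append[of q' u "[a]"] by simp
      ultimately show ?thesis using q(1,6) lu even e qne by (auto simp: seg_def insert_commute)
    qed
    have set: "set ?q = insert a (set q)" by auto
    show ?thesis
      using s q(2-5) ru lu less.prems u uq unfolding set[symmetric]
      by (intro exI[of _ w] exI[of _ ?q]) (auto simp: set)
  qed
qed

text \<open>All edges belong to the spanning forest, so extra edges can be added later without
  repetition.\<close>

definition tree_config :: "(nat \<times> nat) list \<Rightarrow> nat list list \<Rightarrow> bool" where
  "tree_config ps qs \<longleftrightarrow> realises E ps qs \<and> verts qs \<subseteq> W \<and>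
     (\<forall>v\<in>verts qs. \<forall>u. par v = Some u \<longrightarrow> u \<in> verts qs) \<and> set (concat (map elist qs)) \<subseteq> par_edges"

lemma near_length: "realises E ps qs \<Longrightarrow> near qs (length ps) = verts qs"
proof -
  assume "realises E ps qs"
  then have "length ps = length qs" unfolding realises_def using list_all2_lengthD by blast
  then show ?thesis unfolding near_def verts_def by simp
qed

lemma attach_tree:
  assumes t: "tree_config ps qs" and w: "w \<in> near qs j"
    and q: "seg E d w v q" "\<And>u. u \<in> set q - {w} \<Longrightarrow> u \<notin> verts qs \<and> u \<in> W \<and> (\<exists>t\<in>set q. par u = Some t)"
      "set (elist q) \<subseteq> par_edges"
  shows "\<exists>k qs'. k < j \<and> k < length ps \<and> tree_config (attach (k, d) (w, v) ps) qs' \<and>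
     verts qs' = verts qs \<union> set q \<and> v \<in> near qs' 3 \<and> length (attach (k, d) (w, v) ps) = length ps + 2"
proof -
  have "set q \<inter> verts qs \<subseteq> {w}" using q(2) by blast
  then obtain k qs' where k: "k < j" "k < length ps" "realises E (attach (k, d) (w, v) ps) qs'"
     "verts qs' = verts qs \<union> set q" "set q \<subseteq> near qs' 3" "length (attach (k, d) (w, v) ps) = length ps + 2"
     "set (concat (map elist qs')) = set (concat (map elist qs)) \<union> set (elist q)"
    using attach_realises[OF _ w q(1), of ps] t unfolding tree_config_def by auto
  have wv: "w \<in> verts qs" using w near_sub by blast
  have "tree_config (attach (k, d) (w, v) ps) qs'"
    unfolding tree_config_def
  proof (intro conjI ballI allI impI)
    show "verts qs' \<subseteq> W" using k(4) q(2) t wv unfolding tree_config_def by blast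
    show "set (concat (map elist qs')) \<subseteq> par_edges" using k(7) q(3) t unfolding tree_config_def by auto
    fix x u assume x: "x \<in> verts qs'" "par x = Some u"
    show "u \<in> verts qs'"
    proof (cases "x \<in> verts qs")
      case True
      then show ?thesis using x t k(4) unfolding tree_config_def by auto
    next
      case False
      then have "x \<in> set q - {w}" using x k(4) wv by auto
      then show ?thesis using q(2) x k(4) by fastforce
    qed
  qed (rule k(3))
  then show ?thesis using k seg_ends[OF q(1)] by auto
qed

lemma trivial_seg: "seg E d v v [v]"
  by (simp add: seg_def increasing_path_def)

text \<open>Branches differ in their number of monotone pieces. One-vertex paths bring each to
  exactly \<open>Suc l\<close> attachments and keep \<open>v\<close> as the last free end.\<close>

lemma pad:
  assumes t: "tree_config ps qs" and v: "v \<in> near qs j" "v \<in> W"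
  shows "\<exists>cs xs qs'. cs \<in> block j l \<and> length xs = Suc l \<and> last xs = (v, v) \<and> set xs \<subseteq> W \<times> W \<and>
      tree_config (build cs xs ps) qs' \<and> verts qs' = verts qs \<and> v \<in> near qs' 3 \<and>
      length (build cs xs ps) = length ps + 2 * Suc l"
proof (induction l)
  case 0
  obtain k qs' where "k < j" "tree_config (attach (k, True) (v, v) ps) qs'" "verts qs' = verts qs \<union> {v}"
    "v \<in> near qs' 3" "length (attach (k, True) (v, v) ps) = length ps + 2"
    using attach_tree[OF t v(1) trivial_seg[of True v]] by auto
  then show ?case using v near_sub[of qs j]
    by (intro exI[of _ "[(k, True)]"] exI[of _ "[(v, v)]"] exI[of _ qs']) (auto simp: block_def)
next
  case (Suc l)
  then obtain cs xs qs' where IH: "cs \<in> block j l" "length xs = Suc l" "last xs = (v, v)" "set xs \<subseteq> W \<times> W"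
      "tree_config (build cs xs ps) qs'" "verts qs' = verts qs" "v \<in> near qs' 3"
      "length (build cs xs ps) = length ps + 2 * Suc l" by blast
  obtain k qs'' where k: "k < 3" "tree_config (attach (k, True) (v, v) (build cs xs ps)) qs''" "verts qs'' = verts qs' \<union> {v}"
    "v \<in> near qs'' 3" "length (attach (k, True) (v, v) (build cs xs ps)) = length (build cs xs ps) + 2"
    using attach_tree[OF IH(5,7) trivial_seg[of True v]] by auto
  have "length cs = length xs" using IH(1,2) by (auto simp: block_def)
  moreover have "cs @ [(k, True)] \<in> block j (Suc l)" using IH(1) k(1) by (auto simp: block_def)
  ultimately show ?case using IH k v near_sub[of qs' 3]
    by (intro exI[of _ "cs @ [(k, True)]"] exI[of _ "xs @ [(v, v)]"] exI[of _ qs'']) (auto simp: attach_build)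
qed

text \<open>The tree path from \<open>a\<close> to the vertices in use has one monotone piece per
  level. The first piece may attach anywhere, each later one attaches to a piece just added; this is
  the shape of the codes in \<open>block\<close>. A later piece has a higher level than the earlier
  ones, so its vertices are new.\<close>

lemma branch:
  "tree_config ps qs \<Longrightarrow> a \<in> W \<Longrightarrow> root_of a \<in> verts qs \<Longrightarrow> level a \<le> l \<Longrightarrow>
    \<exists>cs xs qs'. cs \<in> block (length ps) l \<and> length xs = Suc l \<and> snd (last xs) = a \<and> set xs \<subseteq> W \<times> W \<and>
      tree_config (build cs xs ps) qs' \<and> verts qs \<subseteq> verts qs' \<and> a \<in> near qs' 3 \<and>
      (\<forall>u\<in>verts qs' - verts qs. level u \<le> level a) \<and>
      length (build cs xs ps) = length ps + 2 * Suc l"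
proof (induction l arbitrary: a)
  case 0
  then have "a \<in> verts qs" using root_of_level_0[of a] by simp
  then have "a \<in> near qs (length ps)" using near_length 0 unfolding tree_config_def by blast
  from pad[OF 0(1) this 0(2), of 0] show ?case by fastforce
next
  case (Suc l)
  have full: "near qs (length ps) = verts qs" using near_length Suc.prems unfolding tree_config_def by blast
  show ?case
  proof (cases "a \<in> verts qs")
    case True
    then have "a \<in> near qs (length ps)" using full by blast
    from pad[OF Suc.prems(1) this Suc.prems(2), of "Suc l"] show ?thesis by fastforce
  next
    case False
    obtain w q where q: "seg E (even (level a)) w a q" "w \<in> W" "root_of w = root_of a" "w \<in> verts qs \<or> level w < level a"
       "\<forall>u\<in>set q - {w}. u \<notin> verts qs \<and> u \<in> W \<and> level u = level a \<and> (\<exists>t\<in>set q. par u = Some t)"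
       "set (elist q) \<subseteq> par_edges"
      using par_run[OF Suc.prems(2) False Suc.prems(3)] by blast
    let ?at = "\<lambda>k. attach (k, even (level a)) (w, a)"
    show ?thesis
    proof (cases "w \<in> verts qs")
      case True
      then have wn: "w \<in> near qs (length ps)" using full by blast
      obtain k qs1 where k: "k < length ps" "tree_config (?at k ps) qs1"
        "verts qs1 = verts qs \<union> set q" "a \<in> near qs1 3" "length (?at k ps) = length ps + 2"
        using attach_tree[OF Suc.prems(1) wn q(1)] q(5,6) by blast
      obtain cs xs qs' where p: "cs \<in> block 3 l" "length xs = Suc l" "last xs = (a, a)" "set xs \<subseteq> W \<times> W"
        "tree_config (build cs xs (?at k ps)) qs'" "verts qs' = verts qs1" "a \<in> near qs' 3"
        "length (build cs xs (?at k ps)) = length (?at k ps) + 2 * Suc l"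
        using pad[OF k(2,4) Suc.prems(2), of l] by blast
      have "(k, even (level a)) # cs \<in> block (length ps) (Suc l)" using p(1) k(1) by (auto simp: block_def)
      moreover have "level u \<le> level a" if "u \<in> verts qs' - verts qs" for u
      proof -
        have "u \<in> set q - {w}" using that p(6) k(3) True by auto
        then show ?thesis using q(5) by auto
      qed
      moreover have "xs \<noteq> []" "verts qs \<subseteq> verts qs'" using p(2,6) k(3) by auto
      ultimately show ?thesis using p(2-5,7,8) k(5) q(2) Suc.prems(2)
        by (intro exI[of _ "(k, even (level a)) # cs"] exI[of _ "(w, a) # xs"] exI[of _ qs']) simp
    next
      case wn: False
      then have lw: "level w < level a" "level w \<le> l" using q(4) Suc.prems(4) by auto
      obtain cs xs qs1 where IH: "cs \<in> block (length ps) l" "length xs = Suc l" "set xs \<subseteq> W \<times> W"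
        "tree_config (build cs xs ps) qs1" "verts qs \<subseteq> verts qs1" "w \<in> near qs1 3"
        "\<forall>u\<in>verts qs1 - verts qs. level u \<le> level w" "length (build cs xs ps) = length ps + 2 * Suc l"
        using Suc.IH[OF Suc.prems(1) q(2)] q(3) Suc.prems(3) lw by auto
      have new: "u \<notin> verts qs1 \<and> u \<in> W \<and> (\<exists>t\<in>set q. par u = Some t)" if "u \<in> set q - {w}" for u
      proof -
        have u: "u \<notin> verts qs" "u \<in> W" "level u = level a" "\<exists>t\<in>set q. par u = Some t"
          using q(5) that by auto
        then have "\<not> level u \<le> level w" using lw by simp
        then have "u \<notin> verts qs1" using u(1) IH(7) by blast
        then show ?thesis using u by blast
      qed
      obtain k qs' where k: "k < 3" "tree_config (?at k (build cs xs ps)) qs'"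
        "verts qs' = verts qs1 \<union> set q" "a \<in> near qs' 3"
        "length (?at k (build cs xs ps)) = length (build cs xs ps) + 2"
        using attach_tree[OF IH(4,6) q(1) _ q(6)] new by blast
      have "length cs = length xs" using IH(1,2) by (auto simp: block_def)
      moreover have "cs @ [(k, even (level a))] \<in> block (length ps) (Suc l)" using IH(1) k(1) by (auto simp: block_def)
      moreover have "level u \<le> level a" if u: "u \<in> verts qs' - verts qs" for u
      proof (cases "u \<in> verts qs1")
        case True
        then have "level u \<le> level w" using u IH(7) by blast
        then show ?thesis using lw by simp
      next
        case False
        then have "u \<in> set q - {w}" using u k(3) IH(6) near_sub[of qs1 3] by auto
        then show ?thesis using q(5) by auto
      qed
      moreover have "verts qs \<subseteq> verts qs'" using k(3) IH(5) by auto
      ultimately show ?thesis using IH(2,3,8) k(2,4,5) q(2) Suc.prems(2)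
        by (intro exI[of _ "cs @ [(k, even (level a))]"] exI[of _ "xs @ [(w, a)]"] exI[of _ qs']) (simp add: attach_build)
    qed
  qed
qed

text \<open>Four branches lead from the common root to the ends of the two edges, which are then
  added as paths of one edge. The edges differ because \<open>a\<close> and \<open>a'\<close> are
  their lower ends.\<close>

lemma two_extra_edges:
  assumes lev: "\<And>v. v \<in> W \<Longrightarrow> level v \<le> l"
    and ex: "(a, b) \<in> extra" "(a', b') \<in> extra" "root_of a = root_of a'" "a \<noteq> a'"
  shows "\<exists>r\<in>W. \<exists>c1 c2 c3 c4 x1 x2 x3 x4 qs.
     {c1, c2, c3, c4} \<subseteq> block (8 * Suc l) l \<and>
     length x1 = Suc l \<and> length x2 = Suc l \<and> length x3 = Suc l \<and> length x4 = Suc l \<and>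
     set (x1 @ x2 @ x3 @ x4) \<subseteq> W \<times> W \<and>
     snd (last x1) < snd (last x2) \<and> snd (last x3) < snd (last x4) \<and>
     realises E (build (c1 @ c2 @ c3 @ c4) (x1 @ x2 @ x3 @ x4) [(r, r)] @
        [(snd (last x1), snd (last x2)), (snd (last x3), snd (last x4))]) qs"
proof -
  have W: "a \<in> W" "b \<in> W" "a' \<in> W" "b' \<in> W" and e: "(a, b) \<in> up E" "(a', b') \<in> up E"
    using ex unfolding extra_def by auto
  define r where "r = root_of a"
  have rts: "root_of a = r" "root_of b = r" "root_of a' = r" "root_of b' = r"
    using ex(3) root_of_up[OF e(1) W(2)] root_of_up[OF e(2) W(4)] by (auto simp: r_def)
  have rW: "r \<in> W" using root_of(1)[OF W(1)] Y_W rts by auto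
  have "r \<in> X 0" using W(1) rts by (auto simp: X.simps)
  then have "level r = 0" using X_iff_level[OF rW] by simp
  then have "par r = None" using par_None[OF rW] by simp
  then have t0: "tree_config [(r, r)] [[r]]"
    using rW by (auto simp: tree_config_def realises_def increasing_path_def verts_def)
  have r0: "r \<in> verts [[r]]" by (simp add: verts_def)
  obtain c1 x1 q1 where 1: "c1 \<in> block 1 l" "length x1 = Suc l" "snd (last x1) = a" "set x1 \<subseteq> W \<times> W"
      "tree_config (build c1 x1 [(r, r)]) q1" "verts [[r]] \<subseteq> verts q1"
      "length (build c1 x1 [(r, r)]) = 1 + 2 * Suc l"
    using branch[OF t0 W(1) _ lev[OF W(1)]] rts r0 by auto
  let ?p1 = "build c1 x1 [(r, r)]"
  have "root_of b \<in> verts q1" using r0 1(6) rts by auto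
  then obtain c2 x2 q2 where 2: "c2 \<in> block (length ?p1) l" "length x2 = Suc l" "snd (last x2) = b" "set x2 \<subseteq> W \<times> W"
      "tree_config (build c2 x2 ?p1) q2" "verts q1 \<subseteq> verts q2"
      "length (build c2 x2 ?p1) = length ?p1 + 2 * Suc l"
    using branch[OF 1(5) W(2) _ lev[OF W(2)]] by blast
  let ?p2 = "build c2 x2 ?p1"
  have "root_of a' \<in> verts q2" using r0 1(6) 2(6) rts by auto
  then obtain c3 x3 q3 where 3: "c3 \<in> block (length ?p2) l" "length x3 = Suc l" "snd (last x3) = a'" "set x3 \<subseteq> W \<times> W"
      "tree_config (build c3 x3 ?p2) q3" "verts q2 \<subseteq> verts q3"
      "length (build c3 x3 ?p2) = length ?p2 + 2 * Suc l"
    using branch[OF 2(5) W(3) _ lev[OF W(3)]] by blast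
  let ?p3 = "build c3 x3 ?p2"
  have "root_of b' \<in> verts q3" using r0 1(6) 2(6) 3(6) rts by auto
  then obtain c4 x4 q4 where 4: "c4 \<in> block (length ?p3) l" "length x4 = Suc l" "snd (last x4) = b'" "set x4 \<subseteq> W \<times> W"
      "tree_config (build c4 x4 ?p3) q4"
    using branch[OF 3(5) W(4) _ lev[OF W(4)]] by blast
  have lens: "length c1 = length x1" "length c2 = length x2" "length c3 = length x3"
    using 1(1,2) 2(1,2) 3(1,2) by (auto simp: block_def)
  have b: "build (c1 @ c2 @ c3 @ c4) (x1 @ x2 @ x3 @ x4) [(r, r)] = build c4 x4 ?p3"
    using lens by (simp add: build_append)
  \<comment> \<open>Before the fourth branch there are \<open>1 + 6 * Suc l\<close> paths, so
    \<open>8 * Suc l\<close> bounds every first code.\<close>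
  have blk: "c \<in> block j l \<Longrightarrow> j \<le> 8 * Suc l \<Longrightarrow> c \<in> block (8 * Suc l) l" for c j
    by (auto simp: block_def)
  have R: "realises E (build c4 x4 ?p3) q4" "set (concat (map elist q4)) \<subseteq> par_edges"
    using 4(5) unfolding tree_config_def by auto
  have n: "{a, b} \<notin> par_edges" "{a', b'} \<notin> par_edges" "{a, b} \<noteq> {a', b'}"
    using ex e unfolding extra_def par_edges_def by (auto simp: doubleton_eq_iff up_def)
  have "{a, b} \<notin> set (concat (map elist q4))" "{a', b'} \<notin> set (concat (map elist q4))"
    using n R(2) by blast+
  then have "distinct (concat (map elist (q4 @ [[a, b], [a', b']])))"
    using R(1) n(3) unfolding realises_def by auto
  moreover have "increasing_path E [a, b]" "increasing_path E [a', b']"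
    using e by (auto simp: increasing_path_def up_def)
  ultimately have "realises E (build c4 x4 ?p3 @ [(a, b), (a', b')]) (q4 @ [[a, b], [a', b']])"
    using R(1) unfolding realises_def by (auto intro!: list_all2_appendI)
  then have "realises E (build (c1 @ c2 @ c3 @ c4) (x1 @ x2 @ x3 @ x4) [(r, r)] @
      [(snd (last x1), snd (last x2)), (snd (last x3), snd (last x4))]) (q4 @ [[a, b], [a', b']])"
    unfolding b 1(3) 2(3) 3(3) 4(3) .
  moreover have "{c1, c2, c3, c4} \<subseteq> block (8 * Suc l) l"
    using blk[OF 1(1)] blk[OF 2(1)] blk[OF 3(1)] blk[OF 4(1)] 1(7) 2(7) 3(7) by simp
  moreover have "set (x1 @ x2 @ x3 @ x4) \<subseteq> W \<times> W"
    using 1(4) 2(4) 3(4) 4(4) by simp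
  moreover have "snd (last x1) < snd (last x2) \<and> snd (last x3) < snd (last x4)"
    unfolding 1(3) 2(3) 3(3) 4(3) using e by (simp add: up_def)
  ultimately show ?thesis
    using 1(2) 2(2) 3(2) 4(2) rW by blast
qed

end

section \<open>First moments of configurations\<close>

definition lists_of :: "'a set \<Rightarrow> nat \<Rightarrow> 'a list set" where
  "lists_of A k = {xs. length xs = k \<and> set xs \<subseteq> A}"

lemma lists_of_0 [simp]: "lists_of A 0 = {[]}"
  by (auto simp: lists_of_def)

lemma lists_of_Suc: "lists_of A (Suc k) = (\<lambda>(x, xs). x # xs) ` (A \<times> lists_of A k)"
  by (auto simp: lists_of_def length_Suc_conv image_iff)

lemma finite_lists_of: "finite A \<Longrightarrow> finite (lists_of A k)"
  by (induction k) (auto simp: lists_of_Suc)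

lemma card_lists_of: "finite A \<Longrightarrow> card (lists_of A k) = card A ^ k"
  using card_lists_length_eq[of A k] by (simp add: lists_of_def conj_commute)

lemma sum_lists_of_Suc:
  "(\<Sum>xs\<in>lists_of A (Suc k). f xs) = (\<Sum>x\<in>A. \<Sum>xs\<in>lists_of A k. f (x # xs))"
proof -
  have "inj_on (\<lambda>(x, xs). x # xs) (A \<times> lists_of A k)" by (auto simp: inj_on_def)
  then show ?thesis
    unfolding lists_of_Suc by (simp add: sum.reindex sum.cartesian_product case_prod_unfold o_def)
qed

lemma sum_lists_of_prod_list:
  fixes f :: "'a \<Rightarrow> real"
  shows "(\<Sum>xs\<in>lists_of A k. prod_list (map f xs)) = (\<Sum>x\<in>A. f x) ^ k"
  by (induction k) (simp_all add: sum_lists_of_Suc sum_distrib_left[symmetric] sum_distrib_right[symmetric])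

lemma sum_list_all2_prod_list:
  fixes f :: "'b \<Rightarrow> real"
  assumes "\<And>p. p \<in> set ps \<Longrightarrow> finite {q. R p q}"
  shows "finite {qs. list_all2 R ps qs} \<and>
    (\<Sum>qs | list_all2 R ps qs. prod_list (map f qs)) = prod_list (map (\<lambda>p. \<Sum>q | R p q. f q) ps)"
  using assms
proof (induction ps)
  case (Cons p ps)
  have eq: "{qs. list_all2 R (p # ps) qs} = (\<lambda>(q, qs). q # qs) ` ({q. R p q} \<times> {qs. list_all2 R ps qs})"
    by (auto simp: list_all2_Cons1 image_iff)
  have inj: "inj_on (\<lambda>(q, qs). q # qs) ({q. R p q} \<times> {qs. list_all2 R ps qs})" by (auto simp: inj_on_def)
  have "finite {q. R p q}" "finite {qs. list_all2 R ps qs}" using Cons by auto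
  moreover have "(\<Sum>qs | list_all2 R (p # ps) qs. prod_list (map f qs))
      = (\<Sum>q | R p q. \<Sum>qs | list_all2 R ps qs. f q * prod_list (map f qs))"
    unfolding eq by (subst sum.reindex[OF inj]) (simp add: sum.cartesian_product case_prod_unfold o_def)
  ultimately show ?case using Cons unfolding eq
    by (simp add: sum_distrib_left[symmetric] sum_distrib_right[symmetric])
next
  case Nil
  have "{qs. list_all2 R [] qs} = {[]}" by auto
  then show ?case by simp
qed

text \<open>\<open>path_weight p a b\<close> is the expected number of increasing paths from \<open>a\<close> to \<open>b\<close>.\<close>

definition path_weight :: "real \<Rightarrow> nat \<Rightarrow> nat \<Rightarrow> real" where
  "path_weight p a b = (if a = b then 1 else if a < b then p * (1 + p) ^ (b - a - 1) else 0)"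

definition weight :: "real \<Rightarrow> (nat \<times> nat) list \<Rightarrow> real" where
  "weight p ps = prod_list (map (\<lambda>(a, b). path_weight p a b) ps)"

lemma path_weight_nonneg: "p \<ge> 0 \<Longrightarrow> path_weight p a b \<ge> 0"
  by (simp add: path_weight_def)

lemma weight_nonneg: "p \<ge> 0 \<Longrightarrow> weight p ps \<ge> 0"
  unfolding weight_def by (induction ps) (auto simp: path_weight_nonneg)

lemma weight_Cons [simp]: "weight p (x # ps) = path_weight p (fst x) (snd x) * weight p ps"
  by (simp add: weight_def case_prod_unfold)

lemma weight_append [simp]: "weight p (ps @ qs) = weight p ps * weight p qs"
  by (simp add: weight_def)

lemma weight_Nil [simp]: "weight p [] = 1"
  by (simp add: weight_def)

definition paths :: "nat \<Rightarrow> nat \<Rightarrow> nat list set" where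
  "paths a b = {q. q \<noteq> [] \<and> sorted_wrt (<) q \<and> hd q = a \<and> last q = b}"

lemma path_le: "sorted_wrt (<) q \<Longrightarrow> q \<noteq> [] \<Longrightarrow> x \<in> set q \<Longrightarrow> hd q \<le> x \<and> x \<le> (last q :: nat)"
proof (induction q rule: rev_induct)
  case (snoc y q)
  then show ?case by (cases q) (auto simp: sorted_wrt_append less_imp_le)
qed simp

lemma finite_paths: "finite (paths a b)"
proof -
  have "paths a b \<subseteq> {q. set q \<subseteq> {..b} \<and> distinct q}"
    using path_le by (fastforce simp: paths_def strict_sorted_iff)
  then show ?thesis using finite_subset_distinct[of "{..b}"] finite_subset by auto
qed

lemma paths_self: "paths a a = {[a]}"
proof -
  have "q = [a]" if "q \<in> paths a a" for q
  proof (cases q)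
    case (Cons x xs)
    then show ?thesis using that by (cases xs rule: rev_cases) (auto simp: paths_def)
  qed (use that in \<open>simp add: paths_def\<close>)
  then show ?thesis by (auto simp: paths_def)
qed

lemma paths_snoc: "a < b \<Longrightarrow> paths a b = (\<lambda>(u, q). q @ [b]) ` (SIGMA u:{a..<b}. paths a u)"
proof (intro set_eqI iffI)
  fix q assume ab: "a < b" and q: "q \<in> paths a b"
  then obtain q' where q': "q = q' @ [b]" by (cases q rule: rev_cases) (auto simp: paths_def)
  then have "q' \<noteq> []" using q ab by (auto simp: paths_def)
  then have "q' \<in> paths a (last q')" "last q' < b" "a \<le> last q'"
    using q q' path_le[of q' "last q'"] by (auto simp: paths_def sorted_wrt_append hd_append)
  then show "q \<in> (\<lambda>(u, q). q @ [b]) ` (SIGMA u:{a..<b}. paths a u)"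
    using q' by (intro image_eqI[of _ _ "(last q', q')"]) auto
next
  fix q assume "q \<in> (\<lambda>(u, q). q @ [b]) ` (SIGMA u:{a..<b}. paths a u)"
  then obtain u q' where q: "u \<in> {a..<b}" "q' \<in> paths a u" "q = q' @ [b]" by auto
  then show "q \<in> paths a b"
    using path_le[of q'] by (auto simp: paths_def sorted_wrt_append hd_append intro: le_less_trans)
qed

lemma path_weight_sum:
  assumes "a < b"
  shows "(\<Sum>u\<in>{a..<b}. p * path_weight p a u) = path_weight p a b"
proof -
  have "(\<Sum>u\<in>{a..<a + Suc d}. path_weight p a u) = (1 + p) ^ d" for d
    by (induction d) (auto simp: path_weight_def algebra_simps)
  moreover obtain d where "b = a + Suc d" using assms less_natE by auto
  ultimately show ?thesis using sum_distrib_left[of p "path_weight p a" "{a..<b}"]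
    by (simp add: path_weight_def)
qed

text \<open>A path from \<open>a\<close> to \<open>b\<close> is a choice of inner vertices, each
  with weight \<open>p\<close>, whence a factor \<open>1 + p\<close> for each vertex in between. The
  induction removes the last edge.\<close>

lemma sum_paths: "(\<Sum>q\<in>paths a b. p ^ (length q - 1)) = path_weight p a b"
proof (induction b rule: less_induct)
  case (less b)
  consider "a = b" | "a < b" | "b < a" by linarith
  then show ?case
  proof cases
    case 1
    then show ?thesis by (simp add: paths_self path_weight_def)
  next
    case 2
    have inj: "inj_on (\<lambda>(u, q). q @ [b]) (SIGMA u:{a..<b}. paths a u)"
      by (auto simp: inj_on_def paths_def)
    have "(\<Sum>q\<in>paths a b. p ^ (length q - 1)) = (\<Sum>(u, q)\<in>(SIGMA u:{a..<b}. paths a u). p ^ length q)"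
      unfolding paths_snoc[OF 2] by (subst sum.reindex[OF inj]) (simp add: case_prod_unfold o_def)
    also have "\<dots> = (\<Sum>u\<in>{a..<b}. \<Sum>q\<in>paths a u. p ^ length q)"
      by (subst sum.Sigma) (auto simp: finite_paths)
    also have "\<dots> = (\<Sum>u\<in>{a..<b}. p * (\<Sum>q\<in>paths a u. p ^ (length q - 1)))"
    proof (intro sum.cong refl)
      fix u
      have "p ^ length q = p * p ^ (length q - 1)" if "q \<in> paths a u" for q
        using that by (cases q) (auto simp: paths_def)
      then show "(\<Sum>q\<in>paths a u. p ^ length q) = p * (\<Sum>q\<in>paths a u. p ^ (length q - 1))"
        by (simp add: sum_distrib_left)
    qed
    also have "\<dots> = (\<Sum>u\<in>{a..<b}. p * path_weight p a u)" using less by simp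
    also have "\<dots> = path_weight p a b" by (rule path_weight_sum[OF 2])
    finally show ?thesis .
  next
    case 3
    have "paths a b = {}"
    proof -
      have False if "q \<in> paths a b" for q
        using path_le[of q "hd q"] that 3 by (auto simp: paths_def)
      then show ?thesis by blast
    qed
    then show ?thesis using 3 by (simp add: path_weight_def)
  qed
qed

section \<open>Union bound for a single configuration\<close>

abbreviation (input) pr :: "'a pmf \<Rightarrow> 'a set \<Rightarrow> real" where
  "pr M A \<equiv> measure_pmf.prob M A"

lemma prob_contains:
  assumes p: "0 \<le> p" "p \<le> 1" and F: "finite F"
  shows "pr (erdos_renyi n p) {E. F \<subseteq> E} \<le> p ^ card F"
proof (cases "F \<subseteq> vertex_pairs n")
  case True
  have fin: "finite (vertex_pairs n)" unfolding vertex_pairs_def by simp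
  let ?B = "\<lambda>e. if e \<in> F then {True} else UNIV"
  have "pr (erdos_renyi n p) {E. F \<subseteq> E}
      = pr (Pi_pmf (vertex_pairs n) False (\<lambda>_. bernoulli_pmf p)) (Pi (vertex_pairs n) ?B)"
    unfolding erdos_renyi_def measure_map_pmf
    using True by (intro arg_cong[where f = "measure_pmf.prob _"]) (fastforce simp: Pi_iff split: if_splits)
  also have "\<dots> = (\<Prod>e\<in>vertex_pairs n. pr (bernoulli_pmf p) (?B e))"
    by (rule measure_Pi_pmf_Pi[OF fin])
  also have "\<dots> = (\<Prod>e\<in>vertex_pairs n. if e \<in> F then p else 1)"
    using p by (intro prod.cong) (auto simp: measure_pmf_single)
  also have "\<dots> = p ^ card F"
    using True fin by (simp add: prod.If_cases Int_absorb1)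
  finally show ?thesis by simp
next
  case False
  have "{E. F \<subseteq> E} \<inter> set_pmf (erdos_renyi n p) = {}"
    using False unfolding erdos_renyi_def by auto
  then have "pr (erdos_renyi n p) {E. F \<subseteq> E} = 0"
    by (simp add: measure_pmf_zero_iff Int_commute)
  then show ?thesis using p by simp
qed

lemma prob_UN_le:
  assumes "finite I"
  shows "pr M (\<Union>i\<in>I. A i) \<le> (\<Sum>i\<in>I. pr M (A i))"
  by (rule measure_pmf.finite_measure_subadditive_finite) (use assms in auto)

lemma length_elist: "length (elist q) = length q - 1"
  by (induction q rule: elist.induct) auto

text \<open>Union bound over the paths: edge-disjoint ones are present with probability at most
  \<open>p\<close> to the number of edges. Dropping disjointness from the sum makes it factor over
  the pairs of end points.\<close>

lemma prob_realises:
  assumes p: "0 \<le> p" "p \<le> 1"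
  shows "pr (erdos_renyi n p) {E. \<exists>qs. realises E ps qs} \<le> weight p ps"
proof -
  let ?R = "\<lambda>x q. q \<in> paths (fst x) (snd x)"
  let ?Q = "{qs. list_all2 ?R ps qs}"
  let ?D = "{qs \<in> ?Q. distinct (concat (map elist qs))}"
  have "prod_list (map (\<lambda>x. \<Sum>q\<in>paths (fst x) (snd x). p ^ (length q - 1)) ps) = weight p ps"
    unfolding sum_paths weight_def by (simp add: case_prod_unfold)
  then have fin: "finite ?Q" "(\<Sum>qs\<in>?Q. prod_list (map (\<lambda>q. p ^ (length q - 1)) qs)) = weight p ps"
    using sum_list_all2_prod_list[of ps ?R "\<lambda>q. p ^ (length q - 1)"] by (simp_all add: finite_paths)
  have "{E. \<exists>qs. realises E ps qs} \<subseteq> (\<Union>qs\<in>?D. {E. set (concat (map elist qs)) \<subseteq> E})"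
  proof (clarify)
    fix E qs assume r: "realises E ps qs"
    have la: "list_all2 (\<lambda>p q. increasing_path E q \<and> hd q = fst p \<and> last q = snd p) ps qs"
      and d: "distinct (concat (map elist qs))" using r unfolding realises_def by auto
    have "list_all2 ?R ps qs"
      using la by (rule list_all2_mono) (auto simp: paths_def increasing_path_edges)
    moreover have "set (elist q) \<subseteq> E" if "q \<in> set qs" for q
      using la that by (auto simp: list_all2_conv_all_nth in_set_conv_nth increasing_path_edges)
    ultimately show "E \<in> (\<Union>qs\<in>?D. {E. set (concat (map elist qs)) \<subseteq> E})"
      using d by auto
  qed
  then have "pr (erdos_renyi n p) {E. \<exists>qs. realises E ps qs}
      \<le> pr (erdos_renyi n p) (\<Union>qs\<in>?D. {E. set (concat (map elist qs)) \<subseteq> E})"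
    by (intro measure_pmf.finite_measure_mono) auto
  also have "\<dots> \<le> (\<Sum>qs\<in>?D. pr (erdos_renyi n p) {E. set (concat (map elist qs)) \<subseteq> E})"
    using fin by (intro prob_UN_le) auto
  also have "\<dots> \<le> (\<Sum>qs\<in>?D. prod_list (map (\<lambda>q. p ^ (length q - 1)) qs))"
  proof (intro sum_mono)
    fix qs assume qs: "qs \<in> ?D"
    have "prod_list (map (\<lambda>q. p ^ (length q - 1)) qs) = p ^ length (concat (map elist qs))"
      by (induction qs) (auto simp: length_elist power_add)
    then show "pr (erdos_renyi n p) {E. set (concat (map elist qs)) \<subseteq> E}
        \<le> prod_list (map (\<lambda>q. p ^ (length q - 1)) qs)"
      using prob_contains[OF p, of "set (concat (map elist qs))" n] qs
      by (simp add: distinct_card del: set_concat length_concat)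
  qed
  also have "\<dots> \<le> (\<Sum>qs\<in>?Q. prod_list (map (\<lambda>q. p ^ (length q - 1)) qs))"
    using fin p by (intro sum_mono2) (auto intro!: prod_list_nonneg)
  finally show ?thesis using fin(2) by simp
qed

section \<open>Sums over all positions of the attached paths\<close>

context
  fixes p :: real and n :: nat
  assumes p: "0 \<le> p"
begin

text \<open>The sum is the expected number of increasing paths ending in \<open>w\<close> on a large
  enough vertex set: each smaller vertex is used or not.\<close>

lemma sum_path_weight_down: "w \<in> {1..n} \<Longrightarrow> (\<Sum>v\<in>{1..n}. path_weight p v w) \<le> (1 + p) ^ (w - 1)"
proof -
  assume w: "w \<in> {1..n}"
  have *: "(\<Sum>v\<in>{1..Suc d}. path_weight p v (Suc d)) = (1 + p) ^ d" for d
  proof (induction d)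
    case (Suc d)
    have "(\<Sum>v\<in>{1..Suc (Suc d)}. path_weight p v (Suc (Suc d))) =
       1 + (\<Sum>v\<in>{1..Suc d}. path_weight p v (Suc (Suc d)))" by (simp add: path_weight_def)
    also have "(\<Sum>v\<in>{1..Suc d}. path_weight p v (Suc (Suc d))) =
        (\<Sum>v\<in>{1..d}. (1 + p) * path_weight p v (Suc d)) + p"
      by (auto simp: path_weight_def Suc_diff_le intro!: sum.cong)
    also have "(\<Sum>v\<in>{1..d}. (1 + p) * path_weight p v (Suc d)) = (1 + p) * ((1 + p) ^ d - 1)"
      using Suc by (simp add: sum_distrib_left[symmetric] path_weight_def)
    finally show ?case by (simp add: algebra_simps)
  qed (simp add: path_weight_def)
  have "(\<Sum>v\<in>{1..n}. path_weight p v w) = (\<Sum>v\<in>{1..w}. path_weight p v w)"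
    using w by (intro sum.mono_neutral_right) (auto simp: path_weight_def)
  moreover obtain d where "w = Suc d" using w by (cases w) auto
  ultimately show ?thesis using *[of d] by simp
qed

lemma sum_path_weight_up: "w \<in> {1..n} \<Longrightarrow> (\<Sum>v\<in>{1..n}. path_weight p w v) \<le> (1 + p) ^ (n - w)"
proof -
  assume w: "w \<in> {1..n}"
  have *: "(\<Sum>v\<in>{w..w + d}. path_weight p w v) = (1 + p) ^ d" for d
    by (induction d) (auto simp: path_weight_def algebra_simps)
  have "(\<Sum>v\<in>{1..n}. path_weight p w v) = (\<Sum>v\<in>{w..n}. path_weight p w v)"
    using w by (intro sum.mono_neutral_right) (auto simp: path_weight_def)
  then show ?thesis using *[of "n - w"] w by simp
qed

text \<open>Summing over the free end of the new path before summing over \<open>w\<close> avoids a factor for the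
  length of the split path: the sum over \<open>w\<close> is geometric.\<close>

lemma sum_split_weight:
  assumes f: "\<And>w. w \<in> {1..n} \<Longrightarrow> 0 \<le> f w \<and> f w \<le> (1 + p) ^ n" and sf: "(\<Sum>w\<in>{1..n}. p * f w) \<le> (1 + p) ^ n"
  shows "(\<Sum>w\<in>{1..n}. path_weight p a w * path_weight p w b * f w) \<le> 3 * (1 + p) ^ n * path_weight p a b"
proof -
  \<comment> \<open>For \<open>w\<close> at an end the product is the unsplit weight, since a
    trivial path has weight 1; an inner \<open>w\<close> costs at most a further factor
    \<open>p\<close>. The three summands yield the constant 3.\<close>
  have key: "path_weight p a w * path_weight p w b \<le> path_weight p a b * ((if w = a then 1 else 0) + (if w = b then 1 else 0) + p)" for w
  proof (cases "a < w \<and> w < b")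
    case True
    then obtain d1 d2 where d: "w = a + Suc d1" "b = w + Suc d2" by (metis less_iff_Suc_add add_Suc_right)
    have "path_weight p a w * path_weight p w b = p * p * (1 + p) ^ (d1 + d2)"
      by (simp add: path_weight_def power_add d)
    also have "\<dots> \<le> p * p * ((1 + p) * (1 + p) ^ (d1 + d2))"
      using p by (intro mult_left_mono) (auto simp: algebra_simps)
    also have "\<dots> = path_weight p a b * p" by (simp add: path_weight_def d power_add)
    finally show ?thesis using True by simp
  next
    case False
    then have "path_weight p a w * path_weight p w b \<le> path_weight p a b * (if w = a \<or> w = b then 1 else 0)"
      by (auto simp: path_weight_def)
    also have "\<dots> \<le> path_weight p a b * ((if w = a then 1 else 0) + (if w = b then 1 else 0) + p)"
      using p path_weight_nonneg[OF p] by (intro mult_left_mono) auto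
    finally show ?thesis .
  qed
  have "(\<Sum>w\<in>{1..n}. path_weight p a w * path_weight p w b * f w)
     \<le> (\<Sum>w\<in>{1..n}. path_weight p a b * ((if w = a then 1 else 0) + (if w = b then 1 else 0) + p) * f w)"
    using key f by (intro sum_mono mult_right_mono) auto
  also have "\<dots> = (\<Sum>w\<in>{1..n}. path_weight p a b * ((if w = a then f w else 0) + (if w = b then f w else 0) + p * f w))"
    by (intro sum.cong) (auto simp: algebra_simps)
  also have "\<dots> = path_weight p a b * ((\<Sum>w\<in>{1..n}. if w = a then f w else 0) + (\<Sum>w\<in>{1..n}. if w = b then f w else 0) + (\<Sum>w\<in>{1..n}. p * f w))"
    by (simp only: sum_distrib_left[symmetric] sum.distrib)
  also have "\<dots> \<le> path_weight p a b * ((1 + p) ^ n + (1 + p) ^ n + (1 + p) ^ n)"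
  proof (intro mult_left_mono add_mono sf path_weight_nonneg[OF p])
    have "(\<Sum>w\<in>{1..n}. if w = c then f w else 0) = (if c \<in> {1..n} then f c else 0)" for c
      by (simp add: sum.delta)
    then have *: "(\<Sum>w\<in>{1..n}. if w = c then f w else 0) \<le> (1 + p) ^ n" for c
      using f[of c] p by (cases "c \<in> {1..n}") simp_all
    show "(\<Sum>w\<in>{1..n}. if w = a then f w else 0) \<le> (1 + p) ^ n"
      "(\<Sum>w\<in>{1..n}. if w = b then f w else 0) \<le> (1 + p) ^ n" by (rule *)+
  qed
  finally show ?thesis by (simp add: mult_ac)
qed

lemma geometric_weights:
  "(\<Sum>w\<in>{1..n}. p * (1 + p) ^ (w - 1)) \<le> (1 + p) ^ n" "(\<Sum>w\<in>{1..n}. p * (1 + p) ^ (n - w)) \<le> (1 + p) ^ n"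
proof -
  have *: "(\<Sum>w\<in>{1..m}. p * (1 + p) ^ (w - 1)) = (1 + p) ^ m - 1" for m
    by (induction m) (auto simp: algebra_simps)
  then show "(\<Sum>w\<in>{1..n}. p * (1 + p) ^ (w - 1)) \<le> (1 + p) ^ n" by simp
  have "(\<Sum>w\<in>{1..n}. p * (1 + p) ^ (n - w)) = (\<Sum>w\<in>{1..n}. p * (1 + p) ^ (w - 1))"
    by (rule sum.reindex_bij_witness[of _ "\<lambda>w. n + 1 - w" "\<lambda>w. n + 1 - w"]) auto
  then show "(\<Sum>w\<in>{1..n}. p * (1 + p) ^ (n - w)) \<le> (1 + p) ^ n" using * by simp
qed

text \<open>An attachment costs the same factor for every code and every configuration, so
  configurations can be summed one attachment at a time.\<close>

lemma sum_attach:
  assumes "ps \<noteq> []"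
  shows "(\<Sum>x\<in>{1..n} \<times> {1..n}. weight p (attach c x ps)) \<le> 3 * (1 + p) ^ n * weight p ps"
proof -
  define k where "k = fst c mod length ps"
  have k: "k < length ps" using assms by (simp add: k_def)
  obtain a b where ab: "ps ! k = (a, b)" by (cases "ps ! k")
  define rest where "rest = take k ps @ drop (Suc k) ps"
  have ps: "weight p ps = path_weight p a b * weight p rest"
    by (subst id_take_nth_drop[OF k]) (simp add: rest_def ab)
  define g where "g w v = (if snd c then path_weight p w v else path_weight p v w)" for w v
  have at: "weight p (attach c (w, v) ps) = path_weight p a w * path_weight p w b * g w v * weight p rest" for w v
    by (simp add: attach_def Let_def k_def[symmetric] ab rest_def g_def)
  define f where "f w = (\<Sum>v\<in>{1..n}. g w v)" for w
  define h where "h w = (if snd c then (1 + p) ^ (n - w) else (1 + p) ^ (w - 1))" for w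
  have fh: "f w \<le> h w" if "w \<in> {1..n}" for w
    using sum_path_weight_down[OF that] sum_path_weight_up[OF that] by (simp add: f_def g_def h_def)
  have f0: "0 \<le> f w" for w
    unfolding f_def g_def by (intro sum_nonneg) (auto simp: path_weight_nonneg p)
  have "(\<Sum>x\<in>{1..n} \<times> {1..n}. weight p (attach c x ps))
      = (\<Sum>w\<in>{1..n}. \<Sum>v\<in>{1..n}. weight p (attach c (w, v) ps))"
    by (simp add: sum.cartesian_product case_prod_unfold)
  also have "\<dots> = (\<Sum>w\<in>{1..n}. path_weight p a w * path_weight p w b * f w) * weight p rest"
    by (simp add: at f_def sum_distrib_left sum_distrib_right mult_ac)
  also have "\<dots> \<le> (3 * (1 + p) ^ n * path_weight p a b) * weight p rest"
  proof (intro mult_right_mono sum_split_weight weight_nonneg[OF p])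
    fix w assume w: "w \<in> {1..n}"
    have "h w \<le> (1 + p) ^ n" unfolding h_def using p w by (auto intro!: power_increasing)
    then show "0 \<le> f w \<and> f w \<le> (1 + p) ^ n" using f0 fh[OF w] by auto
  next
    have "(\<Sum>w\<in>{1..n}. p * f w) \<le> (\<Sum>w\<in>{1..n}. p * h w)"
      using fh p by (intro sum_mono mult_left_mono) auto
    also have "\<dots> \<le> (1 + p) ^ n" using geometric_weights unfolding h_def by (cases "snd c") simp_all
    finally show "(\<Sum>w\<in>{1..n}. p * f w) \<le> (1 + p) ^ n" .
  qed
  finally show ?thesis by (simp add: ps mult_ac)
qed

lemma attach_nonempty [simp]: "attach c x ps \<noteq> []"
  by (simp add: attach_def Let_def)

lemma sum_build:
  "ps \<noteq> [] \<Longrightarrow> (\<Sum>xs\<in>lists_of ({1..n} \<times> {1..n}) (length cs). weight p (build cs xs ps))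
     \<le> (3 * (1 + p) ^ n) ^ length cs * weight p ps"
proof (induction cs arbitrary: ps)
  case (Cons c cs)
  have "(\<Sum>xs\<in>lists_of ({1..n} \<times> {1..n}) (length (c # cs)). weight p (build (c # cs) xs ps))
     = (\<Sum>x\<in>{1..n} \<times> {1..n}. \<Sum>xs\<in>lists_of ({1..n} \<times> {1..n}) (length cs). weight p (build cs xs (attach c x ps)))"
    by (simp add: sum_lists_of_Suc)
  also have "\<dots> \<le> (\<Sum>x\<in>{1..n} \<times> {1..n}. (3 * (1 + p) ^ n) ^ length cs * weight p (attach c x ps))"
    using Cons.IH by (intro sum_mono) simp
  also have "\<dots> = (3 * (1 + p) ^ n) ^ length cs * (\<Sum>x\<in>{1..n} \<times> {1..n}. weight p (attach c x ps))"
    by (simp add: sum_distrib_left)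
  also have "\<dots> \<le> (3 * (1 + p) ^ n) ^ length cs * (3 * (1 + p) ^ n * weight p ps)"
    using sum_attach[OF Cons.prems] p by (intro mult_left_mono) auto
  finally show ?case by (simp add: mult_ac)
qed simp

end

text \<open>The positions \<open>l\<close>, \<open>2 * l + 1\<close>, \<open>3 * l + 2\<close> and
  \<open>4 * l + 3\<close> are the last ones of four consecutive branches of length
  \<open>Suc l\<close>. Their free ends are the ends of the extra edges.\<close>

definition two_cycles :: "nat \<Rightarrow> nat \<Rightarrow> nat set set \<Rightarrow> bool" where
  "two_cycles n l E \<longleftrightarrow> (\<exists>r\<in>{1..n}. \<exists>c1\<in>block (8 * Suc l) l. \<exists>c2\<in>block (8 * Suc l) l.
     \<exists>c3\<in>block (8 * Suc l) l. \<exists>c4\<in>block (8 * Suc l) l. \<exists>xs\<in>lists_of ({1..n} \<times> {1..n}) (4 * Suc l).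
     snd (xs ! l) < snd (xs ! (2 * l + 1)) \<and> snd (xs ! (3 * l + 2)) < snd (xs ! (4 * l + 3)) \<and>
     (\<exists>qs. realises E (build (c1 @ c2 @ c3 @ c4) xs [(r, r)] @
        [(snd (xs ! l), snd (xs ! (2 * l + 1))), (snd (xs ! (3 * l + 2)), snd (xs ! (4 * l + 3)))]) qs))"

lemma block_image:
  "block J l = (\<lambda>(c, cs). c # cs) ` (({..<J} \<times> UNIV) \<times> lists_of ({..<3} \<times> UNIV) l)"
  by (force simp: block_def lists_of_def)

lemma finite_block: "finite (block J l)"
  and card_block: "card (block J l) \<le> 2 * J * 6 ^ l"
proof -
  have f: "finite (lists_of ({..<3::nat} \<times> (UNIV :: bool set)) l)" by (rule finite_lists_of) simp
  then show "finite (block J l)" unfolding block_image by auto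
  have "card (block J l) \<le> card ((({..<J} \<times> (UNIV :: bool set))) \<times> lists_of ({..<3::nat} \<times> (UNIV :: bool set)) l)"
    unfolding block_image using f by (intro card_image_le) auto
  also have "\<dots> = 2 * J * 6 ^ l"
    by (simp add: card_cartesian_product card_lists_of)
  finally show "card (block J l) \<le> 2 * J * 6 ^ l" .
qed

lemma path_weight_le: "0 \<le> p \<Longrightarrow> a \<noteq> b \<Longrightarrow> b \<le> n \<Longrightarrow> path_weight p a b \<le> p * (1 + p) ^ n"
  unfolding path_weight_def by (auto intro!: mult_left_mono power_increasing)

text \<open>The ends of an extra edge are already fixed by the branches, so it brings no further
  sum. Bounded as an increasing path between distinct ends, it contributes
  \<open>p * (1 + p) ^ n\<close>.\<close>

lemma prob_two_cycles:
  assumes p: "0 \<le> p" "p \<le> 1"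
  shows "pr (erdos_renyi n p) {E. two_cycles n l E}
    \<le> real n * (16 * Suc l * 6 ^ l) ^ 4 * (3 * (1 + p) ^ n) ^ (4 * Suc l) * (p * (1 + p) ^ n)\<^sup>2"
proof -
  let ?B = "block (8 * Suc l) l" and ?X = "lists_of ({1..n} \<times> {1..n}) (4 * Suc l)"
  define ext where "ext xs = [(snd (xs ! l), snd (xs ! (2 * l + 1))), (snd (xs ! (3 * l + 2)), snd (xs ! (4 * l + 3)))]"
    for xs :: "(nat \<times> nat) list"
  define ok where "ok xs \<longleftrightarrow> snd (xs ! l) < snd (xs ! (2 * l + 1)) \<and> snd (xs ! (3 * l + 2)) < snd (xs ! (4 * l + 3))"
    for xs :: "(nat \<times> nat) list"
  define I where "I = {1..n} \<times> ?B \<times> ?B \<times> ?B \<times> ?B"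
  define A where "A = (\<lambda>((r, c1, c2, c3, c4), xs). {E. \<exists>qs. realises E (build (c1 @ c2 @ c3 @ c4) xs [(r, r)] @ ext xs) qs})"
  let ?P = "pr (erdos_renyi n p)"
  let ?D = "3 * (1 + p) ^ n" and ?e = "p * (1 + p) ^ n"
  have fX: "finite ?X" by (rule finite_lists_of) simp
  have fI: "finite I" unfolding I_def using finite_block by blast
  have "{E. two_cycles n l E} \<subseteq> (\<Union>z\<in>I \<times> {xs \<in> ?X. ok xs}. A z)"
    unfolding two_cycles_def I_def A_def ok_def ext_def by fast
  then have "?P {E. two_cycles n l E} \<le> ?P (\<Union>z\<in>I \<times> {xs \<in> ?X. ok xs}. A z)"
    by (intro measure_pmf.finite_measure_mono) auto
  also have "\<dots> \<le> (\<Sum>z\<in>I \<times> {xs \<in> ?X. ok xs}. ?P (A z))"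
    using fX fI by (intro prob_UN_le) auto
  also have "\<dots> = (\<Sum>i\<in>I. \<Sum>xs\<in>{xs \<in> ?X. ok xs}. ?P (A (i, xs)))"
    by (simp add: sum.cartesian_product case_prod_unfold)
  also have "\<dots> \<le> (\<Sum>i\<in>I. ?D ^ (4 * Suc l) * ?e\<^sup>2)"
  proof (intro sum_mono)
    fix i assume "i \<in> I"
    then obtain r c1 c2 c3 c4 where i: "i = (r, c1, c2, c3, c4)" and c: "c1 \<in> ?B" "c2 \<in> ?B" "c3 \<in> ?B" "c4 \<in> ?B"
      unfolding I_def by auto
    have len: "length (c1 @ c2 @ c3 @ c4) = 4 * Suc l" using c by (auto simp: block_def)
    have "(\<Sum>xs\<in>{xs \<in> ?X. ok xs}. ?P (A (i, xs))) \<le> (\<Sum>xs\<in>{xs \<in> ?X. ok xs}. weight p (build (c1 @ c2 @ c3 @ c4) xs [(r, r)]) * ?e\<^sup>2)"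
    proof (intro sum_mono)
      fix xs assume xs: "xs \<in> {xs \<in> ?X. ok xs}"
      have xn: "snd (xs ! k) \<le> n" if "k < 4 * Suc l" for k
      proof -
        have "xs ! k \<in> {1..n} \<times> {1..n}" using xs that nth_mem[of k xs] by (auto simp: lists_of_def)
        then show ?thesis by auto
      qed
      have e1: "path_weight p (snd (xs ! l)) (snd (xs ! (2 * l + 1))) \<le> ?e"
        "path_weight p (snd (xs ! (3 * l + 2))) (snd (xs ! (4 * l + 3))) \<le> ?e"
        using xs xn by (auto simp: ok_def intro!: path_weight_le p)
      have "?P (A (i, xs)) \<le> weight p (build (c1 @ c2 @ c3 @ c4) xs [(r, r)] @ ext xs)"
        unfolding A_def i prod.case by (rule prob_realises[OF p])
      also have "\<dots> = weight p (build (c1 @ c2 @ c3 @ c4) xs [(r, r)]) *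
          (path_weight p (snd (xs ! l)) (snd (xs ! (2 * l + 1))) * path_weight p (snd (xs ! (3 * l + 2))) (snd (xs ! (4 * l + 3))))"
        by (simp add: ext_def)
      also have "\<dots> \<le> weight p (build (c1 @ c2 @ c3 @ c4) xs [(r, r)]) * (?e * ?e)"
        using e1 p by (intro mult_left_mono mult_mono weight_nonneg) (auto simp: path_weight_nonneg)
      finally show "?P (A (i, xs)) \<le> weight p (build (c1 @ c2 @ c3 @ c4) xs [(r, r)]) * ?e\<^sup>2"
        by (simp add: power2_eq_square)
    qed
    also have "\<dots> \<le> (\<Sum>xs\<in>?X. weight p (build (c1 @ c2 @ c3 @ c4) xs [(r, r)]) * ?e\<^sup>2)"
      using fX p by (intro sum_mono2) (auto simp: weight_nonneg)
    also have "\<dots> = (\<Sum>xs\<in>?X. weight p (build (c1 @ c2 @ c3 @ c4) xs [(r, r)])) * ?e\<^sup>2"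
      by (simp add: sum_distrib_right)
    also have "\<dots> \<le> ?D ^ (4 * Suc l) * ?e\<^sup>2"
      using sum_build[OF p(1), where n = n and ps = "[(r, r)]" and cs = "c1 @ c2 @ c3 @ c4"] unfolding len
      by (intro mult_right_mono) (auto simp: path_weight_def)
    finally show "(\<Sum>xs\<in>{xs \<in> ?X. ok xs}. ?P (A (i, xs))) \<le> ?D ^ (4 * Suc l) * ?e\<^sup>2" .
  qed
  also have "\<dots> = real (card I) * (?D ^ (4 * Suc l) * ?e\<^sup>2)" by simp
  also have "\<dots> \<le> (real n * (16 * Suc l * 6 ^ l) ^ 4) * (?D ^ (4 * Suc l) * ?e\<^sup>2)"
  proof (intro mult_right_mono)
    have "card I = n * card ?B ^ 4" unfolding I_def by (simp add: card_cartesian_product power4_eq_xxxx)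
    also have "\<dots> \<le> n * (16 * Suc l * 6 ^ l) ^ 4"
      using card_block[of "8 * Suc l" l] by (intro mult_left_mono power_mono) (auto simp del: mult_Suc_right)
    finally have "real (card I) \<le> real (n * (16 * Suc l * 6 ^ l) ^ 4)" by (simp only: of_nat_le_iff)
    then show "real (card I) \<le> real n * (16 * Suc l * 6 ^ l) ^ 4" by simp
  qed (use p in auto)
  finally show ?thesis by (simp add: mult_ac)
qed

text \<open>In each group of a long chain, the first three paths lead to a bad vertex \<open>y\<close> and beyond, the last
  one leads to the next group, and the paths between them start at the vertices below \<open>y\<close> that
  witness its badness.\<close>

fun marks :: "(bool \<times> nat \<times> (nat \<times> bool) list) list \<Rightarrow> (nat \<times> nat) list \<Rightarrow> (nat \<times> bool \<times> nat) list" where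
  "marks [] xs = []"
| "marks ((b, k, cs) # gs) xs =
     map (\<lambda>x. (snd x, b, k)) (take (length cs - 4) (drop 3 xs)) @ marks gs (drop (length cs) xs)"

definition has_colour :: "bool \<times> nat \<Rightarrow> (nat \<times> nat) set" where
  "has_colour bk = {z. (if fst bk then fst z else snd z) = snd bk}"

text \<open>\<open>True\<close> stands for \<open>s\<close> witnesses that agree in the first
  colour, \<open>False\<close> for two that agree in the second; the number is the common colour.
  Lengths and code bounds are those of \<open>group_exists\<close>.\<close>

definition group_codes :: "nat \<Rightarrow> nat \<Rightarrow> nat \<Rightarrow> (bool \<times> nat \<times> (nat \<times> bool) list) set" where
  "group_codes r R s =
     {True} \<times> {..<r} \<times> lists_of ({..<3 * (s + 5)} \<times> UNIV) (s + 4) \<union>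
     {False} \<times> {..<R} \<times> lists_of ({..<3 * (2 + 5)} \<times> UNIV) (2 + 4)"

definition codes :: "(bool \<times> nat \<times> (nat \<times> bool) list) list \<Rightarrow> (nat \<times> bool) list" where
  "codes gs = concat (map (snd \<circ> snd) gs)"

text \<open>All data are codes and positions, over which a union bound can run. Distinct marks make
  the colour conditions independent.\<close>

definition long_chain :: "nat \<Rightarrow> nat \<Rightarrow> nat \<Rightarrow> nat \<Rightarrow> nat \<Rightarrow> nat set set \<Rightarrow> (nat \<Rightarrow> nat \<times> nat) \<Rightarrow> bool" where
  "long_chain n r R s m E col \<longleftrightarrow> (\<exists>p0\<in>{1..n}. \<exists>gs\<in>lists_of (group_codes r R s) m.
     \<exists>xs\<in>lists_of ({1..n} \<times> {1..n}) (length (codes gs)). distinct (map fst (marks gs xs)) \<and>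
     (\<exists>qs. realises E (build (codes gs) xs [(p0, p0)]) qs) \<and>
     (\<forall>(v, bk)\<in>set (marks gs xs). col v \<in> has_colour bk))"

definition random_colouring :: "nat \<Rightarrow> nat \<Rightarrow> nat \<Rightarrow> (nat \<Rightarrow> nat \<times> nat) pmf" where
  "random_colouring n r R = Pi_pmf {1..n} (0, 0) (\<lambda>_. pmf_of_set ({..<r} \<times> {..<R}))"

abbreviation (input) marked :: "(nat \<times> bool \<times> nat) list \<Rightarrow> (nat \<Rightarrow> nat \<times> nat) set" where
  "marked L \<equiv> {col. \<forall>(v, bk)\<in>set L. col v \<in> has_colour bk}"

abbreviation (input) colour_prob :: "nat \<Rightarrow> nat \<Rightarrow> nat \<times> bool \<times> nat \<Rightarrow> real" where
  "colour_prob r R \<equiv> \<lambda>x. if fst (snd x) then 1 / r else 1 / R"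

lemma prob_has_colour:
  assumes "r > 0" "R > 0"
  shows "pr (pmf_of_set ({..<r} \<times> {..<R})) (has_colour bk) \<le> (if fst bk then 1 / r else 1 / R)"
proof -
  let ?A = "{..<r} \<times> {..<R}"
  have ne: "?A \<noteq> {}" "finite ?A" using assms by auto
  obtain b k where bk: "bk = (b, k)" by (cases bk)
  have "card (?A \<inter> has_colour bk) \<le> (if b then R else r)"
  proof (cases b)
    case True
    then have "?A \<inter> has_colour bk \<subseteq> {k} \<times> {..<R}" by (auto simp: has_colour_def bk)
    then have "card (?A \<inter> has_colour bk) \<le> card ({k} \<times> {..<R})" by (intro card_mono) auto
    then show ?thesis using True by (simp add: card_cartesian_product)
  next
    case False
    then have "?A \<inter> has_colour bk \<subseteq> {..<r} \<times> {k}" by (auto simp: has_colour_def bk)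
    then have "card (?A \<inter> has_colour bk) \<le> card ({..<r} \<times> {k})" by (intro card_mono) auto
    then show ?thesis using False by (simp add: card_cartesian_product)
  qed
  then show ?thesis using assms
    by (auto simp: measure_pmf_of_set[OF ne] card_cartesian_product bk field_simps split: if_splits
        simp flip: of_nat_mult)
qed

lemma prod_list_map_mono:
  fixes f g :: "'a \<Rightarrow> real"
  shows "(\<And>x. x \<in> set xs \<Longrightarrow> 0 \<le> f x \<and> f x \<le> g x) \<Longrightarrow> prod_list (map f xs) \<le> prod_list (map g xs)"
proof (induction xs)
  case (Cons x xs)
  have "f x * prod_list (map f xs) \<le> g x * prod_list (map g xs)"
    using Cons.prems[of x] Cons.IH Cons.prems order_trans[of 0 "f x" "g x"]
    by (intro mult_mono prod_list_nonneg) auto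
  then show ?case by simp
qed simp

lemma prob_marks:
  assumes r: "r > 0" "R > 0" and L: "distinct (map fst L)" "fst ` set L \<subseteq> {1..n}"
  shows "pr (random_colouring n r R) (marked L)
     \<le> prod_list (map (colour_prob r R) L)"
proof -
  let ?q = "pmf_of_set ({..<r} \<times> {..<R})"
  define B where "B v = (case map_of L v of None \<Rightarrow> UNIV | Some bk \<Rightarrow> has_colour bk)" for v
  have "(marked L) \<subseteq> Pi {1..n} B"
    unfolding B_def by (auto split: option.splits dest!: map_of_SomeD)
  then have "pr (random_colouring n r R) (marked L)
      \<le> pr (random_colouring n r R) (Pi {1..n} B)"
    by (intro measure_pmf.finite_measure_mono) auto
  also have "\<dots> = (\<Prod>v\<in>{1..n}. pr ?q (B v))"
    unfolding random_colouring_def by (rule measure_Pi_pmf_Pi) simp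
  also have "\<dots> = (\<Prod>v\<in>fst ` set L. pr ?q (B v))"
  proof (intro prod.mono_neutral_right ballI)
    fix v assume "v \<in> {1..n} - fst ` set L"
    then have "map_of L v = None" by (simp add: map_of_eq_None_iff)
    then show "pr ?q (B v) = 1" by (simp add: B_def)
  qed (use L in auto)
  also have "\<dots> = prod_list (map (\<lambda>v. pr ?q (B v)) (map fst L))"
    using L(1) prod.distinct_set_conv_list[of "map fst L"] by simp
  also have "\<dots> \<le> prod_list (map (colour_prob r R) L)"
  proof -
    have "pr ?q (B (fst x)) \<le> (if fst (snd x) then 1 / r else 1 / R)" if "x \<in> set L" for x
    proof -
      have "map_of L (fst x) = Some (snd x)" using L(1) that by simp
      then show ?thesis using prob_has_colour[OF r] by (simp add: B_def)
    qed
    then show ?thesis unfolding map_map o_def by (intro prod_list_map_mono) auto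
  qed
  finally show ?thesis .
qed

definition group_prob :: "nat \<Rightarrow> nat \<Rightarrow> bool \<times> nat \<times> (nat \<times> bool) list \<Rightarrow> real" where
  "group_prob r R g = (if fst g then 1 / r else 1 / R) ^ (length (snd (snd g)) - 4)"

lemma marks_prod:
  "length xs = length (codes gs) \<Longrightarrow> (\<forall>g\<in>set gs. length (snd (snd g)) \<ge> 4) \<Longrightarrow>
    prod_list (map (colour_prob r R) (marks gs xs)) = prod_list (map (group_prob r R) gs)"
proof (induction gs xs rule: marks.induct)
  case (2 b k cs gs xs)
  have "length (take (length cs - 4) (drop 3 xs)) = length cs - 4"
    using 2(2,3) by (auto simp: codes_def min_def)
  then have "prod_list (map (colour_prob r R) (map (\<lambda>x. (snd x, b, k)) (take (length cs - 4) (drop 3 xs))))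
      = group_prob r R (b, k, cs)"
    by (simp add: o_def group_prob_def map_replicate_const prod_list_replicate)
  moreover have "prod_list (map (colour_prob r R) (marks gs (drop (length cs) xs))) = prod_list (map (group_prob r R) gs)"
    using 2 by (intro 2(1)) (auto simp: codes_def)
  ultimately show ?case by simp
qed simp

lemma marks_range: "set xs \<subseteq> A \<times> A \<Longrightarrow> fst ` set (marks gs xs) \<subseteq> A"
proof (induction gs xs rule: marks.induct)
  case (2 b k cs gs xs)
  have "set (drop (length cs) xs) \<subseteq> A \<times> A" using 2(2) set_drop_subset by fastforce
  moreover have "set (take (length cs - 4) (drop 3 xs)) \<subseteq> A \<times> A"
    using 2(2) set_drop_subset set_take_subset by fastforce
  ultimately show ?case using 2(1) by (auto simp: image_Un)
qed simp

lemma prob_pair_product: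
  "pr (pair_pmf M N) (A \<times> B) = pr M A * pr N B"
proof -
  have "pr (pair_pmf M N) (A \<times> B) = pr (pair_pmf M N) ((A \<inter> set_pmf M) \<times> (B \<inter> set_pmf N))"
    by (subst measure_Int_set_pmf[symmetric], intro arg_cong[where f = "measure_pmf.prob _"]) auto
  also have "\<dots> = pr M (A \<inter> set_pmf M) * pr N (B \<inter> set_pmf N)"
    by (rule measure_pmf_prob_product) auto
  finally show ?thesis by (simp add: measure_Int_set_pmf)
qed

text \<open>Graph and colouring are independent, so a chain costs its path weight times its colour
  probability. The bounds for both factor over the groups, whence the \<open>m\<close>-th power;
  \<open>n\<close> counts the starting vertices. A code is a number and a direction, which gives 6
  (s + 5) and 42 = 6 (2 + 5).\<close>

lemma prob_long_chain:
  assumes p: "0 \<le> p" "p \<le> 1" and r: "r > 0" "R > 0"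
  shows "pr (pair_pmf (erdos_renyi n p) (random_colouring n r R)) {(E, col). long_chain n r R s m E col}
    \<le> real n * (r * (6 * (s + 5) * (3 * (1 + p) ^ n)) ^ (s + 4) * (1 / r) ^ s + R * (42 * (3 * (1 + p) ^ n)) ^ 6 * (1 / R)\<^sup>2) ^ m"
proof -
  let ?D = "3 * (1 + p) ^ n"
  let ?P = "pr (pair_pmf (erdos_renyi n p) (random_colouring n r R))"
  let ?L = "\<lambda>k. lists_of ({1..n} \<times> {1..n}) k"
  define \<Gamma> where "\<Gamma> = group_codes r R s"
  define A where "A p0 gs xs = {(E, col). (\<exists>qs. realises E (build (codes gs) xs [(p0, p0)]) qs) \<and>
     (\<forall>(v, bk)\<in>set (marks gs xs). col v \<in> has_colour bk)}" for p0 gs xs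
  define X where "X gs = {xs \<in> ?L (length (codes gs)). distinct (map fst (marks gs xs))}" for gs
  define I where "I = (SIGMA gs:lists_of \<Gamma> m. (X gs))"
  have f\<Gamma>: "finite \<Gamma>" unfolding \<Gamma>_def group_codes_def by (intro finite_UnI finite_cartesian_product finite_lists_of) auto
  have fL: "finite (?L k)" for k by (rule finite_lists_of) simp
  have fI: "finite I" unfolding I_def X_def using finite_lists_of[OF f\<Gamma>] fL by (intro finite_SigmaI) auto
  have "{(E, col). long_chain n r R s m E col} \<subseteq> (\<Union>z\<in>{1..n} \<times> I. A (fst z) (fst (snd z)) (snd (snd z)))"
    unfolding long_chain_def A_def I_def X_def \<Gamma>_def by fastforce
  then have "?P {(E, col). long_chain n r R s m E col} \<le> ?P (\<Union>z\<in>{1..n} \<times> I. A (fst z) (fst (snd z)) (snd (snd z)))"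
    by (intro measure_pmf.finite_measure_mono) auto
  also have "\<dots> \<le> (\<Sum>z\<in>{1..n} \<times> I. ?P (A (fst z) (fst (snd z)) (snd (snd z))))"
    using fI by (intro prob_UN_le) auto
  also have "\<dots> = (\<Sum>p0\<in>{1..n}. \<Sum>gs\<in>lists_of \<Gamma> m. \<Sum>xs\<in>X gs. ?P (A p0 gs xs))"
    unfolding I_def X_def using finite_lists_of[OF f\<Gamma>] fL
    by (subst sum.Sigma) (auto simp: sum.cartesian_product case_prod_unfold)
  also have "\<dots> \<le> (\<Sum>p0\<in>{1..n}. \<Sum>gs\<in>lists_of \<Gamma> m. prod_list (map (\<lambda>g. group_prob r R g * ?D ^ length (snd (snd g))) gs))"
  proof (intro sum_mono)
    fix p0 gs assume gs: "gs \<in> lists_of \<Gamma> m"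
    have len4: "\<forall>g\<in>set gs. length (snd (snd g)) \<ge> 4"
      using gs by (auto simp: lists_of_def \<Gamma>_def group_codes_def)
    let ?g = "prod_list (map (group_prob r R) gs)"
    have g0: "?g \<ge> 0" by (intro prod_list_nonneg) (auto simp: group_prob_def)
    have "(\<Sum>xs\<in>X gs. ?P (A p0 gs xs))
        \<le> (\<Sum>xs\<in>X gs. weight p (build (codes gs) xs [(p0, p0)]) * ?g)"
    proof (intro sum_mono)
      fix xs assume "xs \<in> X gs"
      then have xs: "xs \<in> ?L (length (codes gs))" "distinct (map fst (marks gs xs))"
        by (auto simp: X_def)
      have "A p0 gs xs = {E. \<exists>qs. realises E (build (codes gs) xs [(p0, p0)]) qs} \<times> (marked (marks gs xs))"
        unfolding A_def by auto
      then have "?P (A p0 gs xs) = pr (erdos_renyi n p) {E. \<exists>qs. realises E (build (codes gs) xs [(p0, p0)]) qs} *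
          pr (random_colouring n r R) (marked (marks gs xs))"
        by (simp only: prob_pair_product)
      also have "\<dots> \<le> weight p (build (codes gs) xs [(p0, p0)]) * ?g"
      proof (intro mult_mono prob_realises[OF p])
        show "pr (random_colouring n r R) (marked (marks gs xs)) \<le> ?g"
          using prob_marks[OF r, of "marks gs xs" n] xs marks_range[of xs "{1..n}" gs] marks_prod[of xs gs r R] len4
          by (auto simp: lists_of_def)
      qed (auto simp: weight_nonneg p)
      finally show "?P (A p0 gs xs) \<le> weight p (build (codes gs) xs [(p0, p0)]) * ?g" .
    qed
    also have "\<dots> \<le> (\<Sum>xs\<in>?L (length (codes gs)). weight p (build (codes gs) xs [(p0, p0)]) * ?g)"
      using fL p g0 unfolding X_def by (intro sum_mono2) (auto simp: weight_nonneg)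
    also have "\<dots> = (\<Sum>xs\<in>?L (length (codes gs)). weight p (build (codes gs) xs [(p0, p0)])) * ?g"
      by (simp add: sum_distrib_right)
    also have "\<dots> \<le> ?D ^ length (codes gs) * ?g"
      using sum_build[OF p(1), where n = n and ps = "[(p0, p0)]" and cs = "codes gs"] g0
      by (intro mult_right_mono) (auto simp: path_weight_def)
    also have "\<dots> = prod_list (map (\<lambda>g. group_prob r R g * ?D ^ length (snd (snd g))) gs)"
      by (induction gs) (auto simp: codes_def power_add mult_ac)
    finally show "(\<Sum>xs\<in>X gs. ?P (A p0 gs xs))
        \<le> prod_list (map (\<lambda>g. group_prob r R g * ?D ^ length (snd (snd g))) gs)" .
  qed
  also have "\<dots> = real n * (\<Sum>g\<in>\<Gamma>. group_prob r R g * ?D ^ length (snd (snd g))) ^ m"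
    by (simp add: sum_lists_of_prod_list)
  also have "(\<Sum>g\<in>\<Gamma>. group_prob r R g * ?D ^ length (snd (snd g))) =
     r * (6 * (s + 5) * ?D) ^ (s + 4) * (1 / r) ^ s + R * (42 * ?D) ^ 6 * (1 / R)\<^sup>2"
  proof -
    let ?A = "{True} \<times> {..<r} \<times> lists_of ({..<3 * (s + 5)} \<times> (UNIV :: bool set)) (s + 4)"
    let ?B = "{False} \<times> {..<R} \<times> lists_of ({..<3 * (2 + 5) :: nat} \<times> (UNIV :: bool set)) (2 + 4 :: nat)"
    have fin: "finite ?A" "finite ?B" by (intro finite_cartesian_product finite_lists_of, auto)+
    have A: "length (snd (snd g)) = s + 4" "fst g" if "g \<in> ?A" for g
      using that by (auto simp: lists_of_def)
    have B: "length (snd (snd g)) = 6" "\<not> fst g" if "g \<in> ?B" for g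
      using that by (auto simp: lists_of_def)
    have cA: "card ?A = r * (6 * (s + 5)) ^ (s + 4)"
      by (simp add: card_cartesian_product card_lists_of mult_ac)
    have cB: "card ?B = R * 42 ^ 6"
      by (simp add: card_cartesian_product card_lists_of)
    have "(\<Sum>g\<in>?A. group_prob r R g * ?D ^ length (snd (snd g))) = (\<Sum>g\<in>?A. (1 / r) ^ s * ?D ^ (s + 4))"
      by (intro sum.cong refl) (simp only: A group_prob_def, simp)
    also have "\<dots> = real (card ?A) * ((1 / r) ^ s * ?D ^ (s + 4))"
      by (rule sum_constant)
    also have "\<dots> = r * (6 * (s + 5) * ?D) ^ (s + 4) * (1 / r) ^ s"
      unfolding cA power_mult_distrib[of "real (6 * (s + 5))" ?D] by simp
    finally have 1: "(\<Sum>g\<in>?A. group_prob r R g * ?D ^ length (snd (snd g))) = r * (6 * (s + 5) * ?D) ^ (s + 4) * (1 / r) ^ s" .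
    have "(\<Sum>g\<in>?B. group_prob r R g * ?D ^ length (snd (snd g))) = (\<Sum>g\<in>?B. (1 / R)\<^sup>2 * ?D ^ 6)"
      by (intro sum.cong refl) (simp only: B group_prob_def, simp)
    also have "\<dots> = real (card ?B) * ((1 / R)\<^sup>2 * ?D ^ 6)"
      by (rule sum_constant)
    also have "\<dots> = R * (42 * ?D) ^ 6 * (1 / R)\<^sup>2"
      unfolding cB power_mult_distrib[of 42 ?D] by simp
    finally have 2: "(\<Sum>g\<in>?B. group_prob r R g * ?D ^ length (snd (snd g))) = R * (42 * ?D) ^ 6 * (1 / R)\<^sup>2" .
    show ?thesis unfolding \<Gamma>_def group_codes_def
      by (subst sum.union_disjoint) (use fin 1 2 in auto)
  qed
  finally show ?thesis by (simp only: of_nat_mult of_nat_add of_nat_numeral)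
qed

section \<open>The dimension in the absence of both configurations\<close>

definition bad_witness ::
  "nat set set \<Rightarrow> (nat \<Rightarrow> nat \<times> nat) \<Rightarrow> nat \<Rightarrow> nat \<Rightarrow> nat \<Rightarrow> nat \<Rightarrow> bool \<times> nat \<Rightarrow> nat list \<Rightarrow> bool" where
  "bad_witness E col r R s y bk vs \<longleftrightarrow> distinct vs \<and> length vs = (if fst bk then s else 2) \<and>
     (\<forall>v\<in>set vs. (v, y) \<in> (up E)\<^sup>* \<and> col v \<in> has_colour bk) \<and> snd bk < (if fst bk then r else R)"

lemma (in bad_region) level_exists:
  "v \<in> W \<Longrightarrow> level v \<ge> k \<Longrightarrow> k \<ge> 2 \<Longrightarrow> \<exists>t\<in>W. level t = k"
proof (induction "level v - k" arbitrary: v)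
  case 0
  then show ?case by (intro bexI[of _ v]) auto
next
  case (Suc d)
  then obtain j where j: "level v = Suc j" "j \<ge> k" by (cases "level v") auto
  then obtain u where u: "u \<in> W" "level u = j" using zigzag_step[OF Suc.prems(1) j(1)] Suc.prems by auto
  then have "d = level u - k" using Suc.hyps(2) j by simp
  then show ?case using Suc.hyps(1) u j(2) Suc.prems(3) by blast
qed

lemma marks_concat:
  "(\<forall>(y, cs, xs)\<in>set gs. length cs = length (T y) + 4 \<and> length xs = length (T y) + 4 \<and>
       map snd (take (length (T y)) (drop 3 xs)) = T y) \<Longrightarrow>
   marks (map (\<lambda>(y, cs, xs). (fst (bk y), snd (bk y), cs)) gs) (concat (map (snd \<circ> snd) gs)) =
     concat (map (\<lambda>g. map (\<lambda>v. (v, bk (fst g))) (T (fst g))) gs)"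
proof (induction gs)
  case (Cons g gs)
  obtain y cs xs where g: "g = (y, cs, xs)" by (cases g)
  have len: "length cs = length (T y) + 4" "length xs = length (T y) + 4"
    and T: "map snd (take (length (T y)) (drop 3 xs)) = T y"
    using Cons.prems by (auto simp: g)
  have "map (\<lambda>x. (snd x, bk y)) (take (length (T y)) (drop 3 xs)) =
      map (\<lambda>v. (v, bk y)) (map snd (take (length (T y)) (drop 3 xs)))" by simp
  then have "map (\<lambda>x. (snd x, bk y)) (take (length (T y)) (drop 3 xs)) = map (\<lambda>v. (v, bk y)) (T y)"
    unfolding T .
  then show ?case using Cons len by (simp add: g)
qed simp

text \<open>Without a long chain, \<open>long_alternation\<close> bounds the levels by
  \<open>4 * m + 1\<close>; then \<open>two_extra_edges\<close> leaves one lower end of extra edges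
  per component, as \<open>region_keys\<close> demands. Vertices outside \<open>W\<close> are not
  bad, which provides \<open>few\<close> and \<open>inj\<close> for the colour keys.\<close>

lemma poset_dim_le_good:
  assumes E: "E \<subseteq> vertex_pairs n"
    and col: "\<And>v. v \<in> {1..n} \<Longrightarrow> col v \<in> {..<r} \<times> {..<R}"
    and E1: "\<not> long_chain n r R s m E col" and E2: "\<not> two_cycles n (4 * m + 1) E"
    and s: "s \<ge> 1"
    and B: "\<And>a S. a < R \<Longrightarrow> S \<subseteq> {..<R} \<Longrightarrow> card S < s \<Longrightarrow> a \<notin> S \<Longrightarrow> \<exists>j<t. a \<in> B j \<and> S \<inter> B j = {}"
  shows "poset_dim {1..n} (graph_poset n E) \<le> 10 + 2 * r * t"
proof -
  define Y where "Y = {y \<in> {1..n}. \<exists>bk vs. bad_witness E col r R s y bk vs}"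
  interpret bad_region n E Y
    by unfold_locales (use E in \<open>auto simp: Y_def\<close>)
  have "\<forall>y\<in>Y. \<exists>w. bad_witness E col r R s y (fst w) (snd w)" by (auto simp: Y_def)
  then obtain w where w: "\<And>y. y \<in> Y \<Longrightarrow> bad_witness E col r R s y (fst (w y)) (snd (w y))"
    by metis
  define bk where "bk y = fst (w y)" for y
  define T where "T y = snd (w y)" for y
  have bw: "bad_witness E col r R s y (bk y) (T y)" if "y \<in> Y" for y
    using w[OF that] by (simp add: bk_def T_def)
  have lev: "level v \<le> 4 * m + 1" if v: "v \<in> W" for v
  proof (rule ccontr)
    assume "\<not> ?thesis"
    then obtain t where t: "t \<in> W" "level t = 4 * m + 2" using level_exists[OF v, of "4 * m + 2"] by auto
    have T1: "v \<preceq> y" if "y \<in> Y" "v \<in> set (T y)" for y v using bw that by (auto simp: bad_witness_def)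
    have T2: "distinct (T y)" if "y \<in> Y" for y using bw that by (auto simp: bad_witness_def)
    obtain p0 gs qs where g: "p0 \<in> W" "length gs = m"
     "\<forall>(y, cs, xs)\<in>set gs. y \<in> Y \<and> length cs = length (T y) + 4 \<and> length xs = length (T y) + 4 \<and>
        (\<forall>c\<in>set cs. fst c < 3 * (length (T y) + 5)) \<and> set xs \<subseteq> W \<times> W \<and>
        map snd (take (length (T y)) (drop 3 xs)) = T y"
     "realises E (build (concat (map (fst \<circ> snd) gs)) (concat (map (snd \<circ> snd) gs)) [(p0, p0)]) qs"
     "distinct (concat (map (T \<circ> fst) gs))"
      using long_alternation[where T = T, OF T1 T2 t] by blast
    have g3: "y \<in> Y" "length cs = length (T y) + 4" "set cs \<subseteq> {..<3 * (length (T y) + 5)} \<times> UNIV"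
      "set xs \<subseteq> W \<times> W" if "(y, cs, xs) \<in> set gs" for y cs xs
      using bspec[OF g(3) that] by auto
    let ?gs = "map (\<lambda>(y, cs, xs). (fst (bk y), snd (bk y), cs)) gs" and ?xs = "concat (map (snd \<circ> snd) gs)"
    have mk: "marks ?gs ?xs = concat (map (\<lambda>g. map (\<lambda>v. (v, bk (fst g))) (T (fst g))) gs)"
      using g(3) by (intro marks_concat) auto
    have cod: "codes ?gs = concat (map (fst \<circ> snd) gs)"
      unfolding codes_def by (intro arg_cong[where f = concat]) auto
    have "?gs \<in> lists_of (group_codes r R s) m"
    proof -
      have "(fst (bk y), snd (bk y), cs) \<in> group_codes r R s" if "(y, cs, xs) \<in> set gs" for y cs xs
      proof (cases "fst (bk y)")
        case True
        then show ?thesis using g3(1-3)[OF that] bw[of y]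
          by (simp add: group_codes_def lists_of_def bad_witness_def)
      next
        case False
        then show ?thesis using g3(1-3)[OF that] bw[of y]
          by (simp add: group_codes_def lists_of_def bad_witness_def)
      qed
      then show ?thesis using g(2) by (auto simp: lists_of_def)
    qed
    moreover have "?xs \<in> lists_of ({1..n} \<times> {1..n}) (length (codes ?gs))"
    proof -
      have "length (concat (map (snd \<circ> snd) gs)) = length (concat (map (fst \<circ> snd) gs))"
        using g(3) by (induction gs) auto
      moreover have "set ?xs \<subseteq> W \<times> W"
      proof
        fix z assume "z \<in> set ?xs"
        then obtain y cs xs where "(y, cs, xs) \<in> set gs" "z \<in> set xs" by auto
        then show "z \<in> W \<times> W" using g3(4) by blast
      qed
      ultimately show ?thesis using W_range unfolding cod lists_of_def by auto
    qed
    moreover have "distinct (map fst (marks ?gs ?xs))"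
    proof -
      have "map fst (concat (map (\<lambda>g. map (\<lambda>v. (v, bk (fst g))) (T (fst g))) gs)) = concat (map (T \<circ> fst) gs)"
        by (simp add: map_concat o_def)
      then show ?thesis unfolding mk using g(5) by simp
    qed
    moreover have "\<forall>(v, bk)\<in>set (marks ?gs ?xs). col v \<in> has_colour bk"
    proof -
      have "col v \<in> has_colour (bk y)" if "(y, cs, xs) \<in> set gs" "v \<in> set (T y)" for y cs xs v
        using bw[OF g3(1)[OF that(1)]] that(2) by (simp add: bad_witness_def)
      then show ?thesis unfolding mk by auto
    qed
    ultimately have "long_chain n r R s m E col"
      unfolding long_chain_def using g(1,4) W_range cod
      by (intro bexI[of _ p0] bexI[of _ ?gs] bexI[of _ ?xs] conjI exI[of _ qs]) auto
    then show False using E1 by simp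
  qed
  have "a = a'" if ex: "(a, b) \<in> extra" "(a', b') \<in> extra" "root_of a = root_of a'" for a b a' b'
  proof (rule ccontr)
    assume "a \<noteq> a'"
    let ?l = "4 * m + 1"
    have "two_cycles n ?l E"
    proof (rule bexE[OF two_extra_edges[OF lev ex \<open>a \<noteq> a'\<close>]], assumption, elim exE conjE, goal_cases)
      case q: (1 q c1 c2 c3 c4 x1 x2 x3 x4 qs)
      let ?xs = "x1 @ x2 @ x3 @ x4"
      have "?xs ! ?l = last x1" "?xs ! (2 * ?l + 1) = last x2" "?xs ! (3 * ?l + 2) = last x3" "?xs ! (4 * ?l + 3) = last x4"
        using q(3-6) by (auto simp: nth_append last_conv_nth simp flip: length_greater_0_conv)
      moreover have "?xs \<in> lists_of ({1..n} \<times> {1..n}) (4 * Suc ?l)"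
        using q(3-7) W_range by (auto simp: lists_of_def)
      moreover have "q \<in> {1..n}" using q(1) W_range by blast
      moreover have "c1 \<in> block (8 * Suc ?l) ?l" "c2 \<in> block (8 * Suc ?l) ?l" "c3 \<in> block (8 * Suc ?l) ?l" "c4 \<in> block (8 * Suc ?l) ?l"
        using q(2) by auto
      ultimately show ?case
        unfolding two_cycles_def using q(8-10) by (intro bexI[of _ q] bexI[of _ c1] bexI[of _ c2] bexI[of _ c3]
            bexI[of _ c4] bexI[of _ ?xs] conjI exI[of _ qs]) (simp_all only:)
    qed
    then show False using E2 by simp
  qed
  then obtain K :: "(nat \<Rightarrow> int list) set" where K: "finite K" "K \<noteq> {}" "card K \<le> 10"
    "\<forall>x\<in>{1..n}. \<forall>y\<in>W. (x, y) \<notin> graph_poset n E \<longrightarrow> (\<exists>g\<in>K. key_separates (graph_poset n E) g x y)"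
    using region_keys by blast
  have nonbad: "\<not> bad_witness E col r R s y b vs" if "y \<in> {1..n} - W" for y b vs
    using that Y_W unfolding Y_def by blast
  have "poset_dim {1..n} (graph_poset n E) \<le> card K + 2 * r * t"
  proof (rule poset_dim_le_coloured[where W = W and \<phi> = "fst \<circ> col" and \<psi> = "snd \<circ> col" and R = R and s = s and B = B])
    show "graph_poset n E \<subseteq> {(x, y). x \<le> y}"
      using rtrancl_up_le unfolding graph_poset_eq by auto
    show "\<exists>g\<in>K. key_separates (graph_poset n E) g x y"
      if "x \<in> {1..n}" "y \<in> W" "(x, y) \<notin> graph_poset n E" for x y using K(4) that by blast
    show "(fst \<circ> col) v < r" "(snd \<circ> col) v < R" if "v \<in> {1..n}" for v using col[OF that] by auto
    show "card {v \<in> below (graph_poset n E) y. (fst \<circ> col) v = i} < s" if y: "y \<in> {1..n} - W" for y i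
    proof (rule ccontr)
      let ?S = "{v \<in> below (graph_poset n E) y. (fst \<circ> col) v = i}"
      assume "\<not> card ?S < s"
      then have c: "s \<le> card ?S" by simp
      then obtain S where S: "S \<subseteq> ?S" "card S = s" "finite S" by (meson obtain_subset_with_card_n)
      then obtain vs where vs: "distinct vs" "set vs = S" using finite_distinct_list by blast
      have "S \<noteq> {}" using S s by auto
      then obtain v where "v \<in> ?S" using S by blast
      then have "i < r" using col[of v] by (auto simp: below_def graph_poset_eq)
      then have "bad_witness E col r R s y (True, i) vs"
        using vs S distinct_card[OF vs(1)]
        by (auto simp: bad_witness_def has_colour_def below_def graph_poset_eq subset_iff)
      then show False using nonbad[OF y] by blast
    qed
    show "inj_on (snd \<circ> col) (below (graph_poset n E) y)" if y: "y \<in> {1..n} - W" for y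
    proof (rule inj_onI, rule ccontr)
      fix u v assume uv: "u \<in> below (graph_poset n E) y" "v \<in> below (graph_poset n E) y"
        "(snd \<circ> col) u = (snd \<circ> col) v" "u \<noteq> v"
      then have "bad_witness E col r R s y (False, snd (col u)) [u, v]"
        using col[of u] by (auto simp: bad_witness_def has_colour_def below_def graph_poset_eq)
      then show False using nonbad[OF y] by blast
    qed
  qed (use K partial_order_on_graph_poset B in auto)
  then show ?thesis using K(3) by simp
qed

section \<open>Choice of the parameters\<close>

lemma exp_mult_ge_two_power:
  fixes c :: real
  assumes "c \<ge> 1"
  shows "2 ^ N \<le> exp (real N * c)"
proof -
  have "(2 :: real) ^ N \<le> exp 1 ^ N"
    using exp_ge_add_one_self[of 1] by (intro power_mono) auto
  also have "\<dots> = exp (real N * 1)" using exp_of_nat_mult[of N "1 :: real"] by simp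
  also have "\<dots> \<le> exp (real N * c)" using assms by (subst exp_le_cancel_iff, intro mult_left_mono) auto
  finally show ?thesis .
qed

text \<open>Up to c e^c, an attachment costs at most 10908 = 6 * 606 * 3, and 32724 is three times
  that, so each witness contributes at most 1/3 <= 1/e. The other four attachments, the choice of
  the colour and the constants cost at most e^(88 c), and 600 - 88 = 512.\<close>

lemma group_bound:
  fixes c D :: real and s r R :: nat
  assumes c: "c \<ge> 1" and D: "0 \<le> D" "D \<le> 3 * exp c"
    and s: "600 * c \<le> s" "s \<le> 601 * c"
    and r: "32724 * c * exp c \<le> r" "r \<le> 32725 * c * exp c"
    and R: "exp (600 * c) \<le> R"
  shows "r * (6 * (s + 5) * D) ^ (s + 4) * (1 / r) ^ s + R * (42 * D) ^ 6 * (1 / R)\<^sup>2 \<le> exp (- 512 * c)"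
proof -
  have cexp: "c \<le> exp c" using exp_ge_add_one_self[of c] by linarith
  have r0: "real r > 0" using r(1) c by (smt (verit) exp_gt_zero mult_pos_pos)
  have R0: "real R > 0" using R exp_gt_zero[of "600 * c"] by linarith
  define z where "z = c * exp c"
  define U where "U = 6 * (s + 5) * D"
  have z0: "z > 0" using c by (simp add: z_def)
  have rz: "32724 * z \<le> r" "r \<le> 32725 * z" using r by (simp_all add: z_def)
  have "6 * (real s + 5) \<le> 6 * (601 * c + 5 * c)" using s c by (intro mult_left_mono add_mono) auto
  then have "6 * (s + 5) * D \<le> (3636 * c) * (3 * exp c)"
    using D c by (intro mult_mono) auto
  then have q: "U \<le> 10908 * z" by (simp add: U_def z_def mult_ac)
  have q0: "0 \<le> U" using D by (simp add: U_def)
  have "U / r \<le> 10908 * z / (32724 * z)"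
    using q rz z0 by (intro frac_le) auto
  also have "\<dots> = 1 / 3" using z0 by simp
  also have "\<dots> \<le> exp (- 1)"
    using exp_le by (simp add: exp_minus field_simps)
  finally have "(U / r) ^ s \<le> exp (- 1) ^ s"
    using q0 r0 by (intro power_mono) auto
  also have "\<dots> = exp (- real s)" by (simp add: exp_of_nat_mult[symmetric])
  also have "\<dots> \<le> exp (- 600 * c)" using s by simp
  finally have ratio: "(U / r) ^ s \<le> exp (- 600 * c)" .
  have "r * U ^ (s + 4) * (1 / r) ^ s = r * U ^ 4 * (U / r) ^ s"
    by (simp add: power_add power_divide)
  also have "\<dots> \<le> (32725 * z) * (10908 * z) ^ 4 * exp (- 600 * c)"
    using rz q q0 ratio r0 z0 by (intro mult_mono power_mono) auto
  also have "\<dots> = (32725 * 10908 ^ 4) * z ^ 5 * exp (- 600 * c)"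
    using power_Suc[of z 4] by (simp add: power_mult_distrib)
  also have "\<dots> \<le> 2 ^ 77 * exp (10 * c) * exp (- 600 * c)"
  proof -
    have "z \<le> exp c * exp c" unfolding z_def using cexp by (intro mult_right_mono) auto
    then have "z ^ 5 \<le> exp (2 * c) ^ 5"
      using z0 by (intro power_mono) (auto simp: exp_add[symmetric])
    then have "z ^ 5 \<le> exp (10 * c)" by (simp add: exp_of_nat_mult[symmetric])
    then show ?thesis by (intro mult_right_mono mult_mono) (use z0 in auto)
  qed
  also have "\<dots> = 2 ^ 77 * exp (- 590 * c)"
    by (simp add: mult.assoc exp_add[symmetric])
  finally have A: "r * (6 * (s + 5) * D) ^ (s + 4) * (1 / r) ^ s \<le> 2 ^ 77 * exp (- 590 * c)"
    unfolding U_def .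
  have "R * (42 * D) ^ 6 * (1 / R)\<^sup>2 = (42 * D) ^ 6 * (1 / R)"
    using R0 by (simp add: power2_eq_square field_simps)
  also have "\<dots> \<le> (126 * exp c) ^ 6 * (1 / exp (600 * c))"
  proof (rule mult_mono)
    show "(42 * D) ^ 6 \<le> (126 * exp c) ^ 6" using D by (intro power_mono) auto
    show "1 / real R \<le> 1 / exp (600 * c)" using R R0 by (intro frac_le) auto
  qed (use D R0 in auto)
  also have "\<dots> = 126 ^ 6 * (exp c ^ 6 * exp (- 600 * c))"
    by (simp add: power_mult_distrib exp_minus field_simps)
  also have "exp c ^ 6 * exp (- 600 * c) = exp (- 594 * c)"
    by (simp add: exp_add[symmetric] exp_of_nat_mult[symmetric])
  also have "126 ^ 6 * exp (- 594 * c) \<le> 2 ^ 77 * exp (- 590 * c)"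
    using c by (intro mult_mono) auto
  finally have Bd: "R * (42 * D) ^ 6 * (1 / R)\<^sup>2 \<le> 2 ^ 77 * exp (- 590 * c)" .
  have "r * (6 * (s + 5) * D) ^ (s + 4) * (1 / r) ^ s + R * (42 * D) ^ 6 * (1 / R)\<^sup>2 \<le> 2 ^ 78 * exp (- 590 * c)"
    using A Bd by simp
  also have "\<dots> \<le> exp (78 * c) * exp (- 590 * c)"
    using exp_mult_ge_two_power[OF c, of 78] by (intro mult_right_mono) auto
  also have "\<dots> = exp (- 512 * c)" by (simp add: exp_add[symmetric])
  finally show ?thesis .
qed

text \<open>The exponent 602 comes from 2R <= 4 e^(600 c) <= e^(602 c). The failure probability
  decays like e^(-t / (4s)), so a \<open>t\<close> of order s^2 c suffices.\<close>

lemma separating_parameter: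
  fixes c :: real and s R t :: nat
  assumes c: "c \<ge> 1" and s: "s \<ge> 1" and R: "R \<ge> 1" "R \<le> 2 * exp (600 * c)"
    and t: "4 * real s * (602 * c * (s + 1)) < t"
  shows "real (R * (R + 1) ^ s) * (1 - 1 / (4 * s)) ^ t < 1"
proof -
  have s0: "real s > 0" using s by simp
  have "real (R * (R + 1) ^ s) \<le> (2 * real R) ^ (s + 1)"
  proof -
    have "real R * (real R + 1) ^ s \<le> (2 * real R) * (2 * real R) ^ s"
      using R by (intro mult_mono power_mono) auto
    then show ?thesis by (simp add: add.commute power_mult_distrib)
  qed
  also have "\<dots> \<le> exp (602 * c) ^ (s + 1)"
  proof (intro power_mono)
    have "2 * real R \<le> 2 ^ 2 * exp (600 * c)" using R by simp
    also have "\<dots> \<le> exp (2 * c) * exp (600 * c)"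
      using exp_mult_ge_two_power[OF c, of 2] by (intro mult_right_mono) auto
    finally show "2 * real R \<le> exp (602 * c)" by (simp add: exp_add[symmetric])
  qed simp
  also have "\<dots> = exp (602 * c * (s + 1))" using exp_of_nat_mult[of "s + 1" "602 * c"] by (simp add: mult_ac)
  finally have 1: "real (R * (R + 1) ^ s) \<le> exp (602 * c * (s + 1))" .
  have "(1 - 1 / (4 * s)) ^ t \<le> exp (- (1 / (4 * s))) ^ t"
    using s exp_ge_add_one_self[of "- (1 / (4 * real s))"] by (intro power_mono) (auto simp: field_simps)
  also have "\<dots> = exp (- (t / (4 * s)))" by (simp add: exp_of_nat_mult[symmetric])
  finally have 2: "(1 - 1 / (4 * s)) ^ t \<le> exp (- (t / (4 * s)))" .
  have "real (R * (R + 1) ^ s) * (1 - 1 / (4 * s)) ^ t \<le> exp (602 * c * (s + 1)) * exp (- (t / (4 * s)))"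
    using 1 2 s by (intro mult_mono) (auto simp: field_simps)
  also have "\<dots> = exp (602 * c * (s + 1) - t / (4 * s))" by (simp add: exp_add[symmetric])
  also have "\<dots> < 1"
    using t s0 by (simp add: field_simps)
  finally show ?thesis .
qed

text \<open>With x = c m, the codes contribute e^(112 x) and the attachments e^(72 x), together
  n^(184/256) up to e^(184 c). The root and the two extra edges contribute e^(4 c) / n. As 1600 c <=
  ln n, the total exponent of n is below -1/8.\<close>

lemma two_cycles_bound:
  fixes c D p :: real and n m :: nat
  assumes n: "n \<ge> 2" and c: "c \<ge> 1" "1600 * c \<le> ln n" and D: "0 \<le> D" "D \<le> exp c" and p: "p = c / n"
    and m: "m \<ge> 1" "c * m \<le> ln n / 256 + c"
  shows "real n * (16 * Suc (4 * m + 1) * 6 ^ (4 * m + 1)) ^ 4 * (3 * D) ^ (4 * Suc (4 * m + 1)) * (p * D)\<^sup>2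
    \<le> n powr (- 1 / 8)"
proof -
  define x where "x = c * m"
  have x: "1 \<le> x" "c \<le> x" "real m \<le> x" using c m by (auto simp: x_def mult_le_cancel_left1 mult_le_cancel_right1 intro: mult_ge1_I)
  have xl: "x \<le> ln n / 256 + c" using m by (simp add: x_def)
  have cexp: "c \<le> exp c" using exp_ge_add_one_self[of c] by linarith
  let ?l = "real (Suc (4 * m + 1))"
  have l: "?l \<le> 6 * x" using x m by simp
  have lexp: "?l \<le> exp ?l" using exp_ge_add_one_self[of ?l] by linarith
  have e3: "(16 :: real) \<le> exp (4 * 1)" "(6 :: real) \<le> exp (3 * 1)" "(3 :: real) \<le> exp (real 2 * c)"
    using exp_mult_ge_two_power[of 1 4] exp_mult_ge_two_power[of 1 3] exp_mult_ge_two_power[OF c(1), of 2] by simp_all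
  have "16 * ?l * 6 ^ (4 * m + 1) \<le> exp 4 * exp ?l * exp 3 ^ Suc (4 * m + 1)"
    using lexp e3 by (intro mult_mono order_trans[OF power_mono power_increasing]) auto
  also have "\<dots> = exp (4 + 4 * ?l)" by (simp add: exp_add[symmetric] exp_of_nat_mult[symmetric] flip: power_Suc)
  also have "\<dots> \<le> exp (28 * x)" using l x by simp
  finally have "(16 * ?l * 6 ^ (4 * m + 1)) ^ 4 \<le> exp (28 * x) ^ 4" by (intro power_mono) auto
  then have 1: "(16 * ?l * 6 ^ (4 * m + 1)) ^ 4 \<le> exp (112 * x)" by (simp add: exp_of_nat_mult[symmetric])
  have "3 * D \<le> exp (2 * c) * exp c" using D e3 by (intro mult_mono) auto
  then have "3 * D \<le> exp (3 * c)" by (simp add: exp_add[symmetric])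
  then have "(3 * D) ^ (4 * Suc (4 * m + 1)) \<le> exp (3 * c) ^ (4 * Suc (4 * m + 1))"
    using D by (intro power_mono) auto
  also have "\<dots> = exp (12 * c * ?l)" by (simp only: exp_of_nat_mult[symmetric]) (simp add: algebra_simps)
  also have "12 * c * ?l = 48 * x + 24 * c" by (simp add: x_def algebra_simps)
  also have "exp (48 * x + 24 * c) \<le> exp (72 * x)" using x by simp
  finally have 2: "(3 * D) ^ (4 * Suc (4 * m + 1)) \<le> exp (72 * x)" .
  have "(p * D)\<^sup>2 \<le> (exp c / n * exp c)\<^sup>2"
    unfolding p using cexp c D n by (intro power_mono mult_mono divide_right_mono) auto
  also have "\<dots> = exp (4 * c) / n\<^sup>2"
    by (simp add: power2_eq_square exp_add[symmetric])
  finally have 3: "(p * D)\<^sup>2 \<le> exp (4 * c) / n\<^sup>2" .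
  have "real n * (16 * Suc (4 * m + 1) * 6 ^ (4 * m + 1)) ^ 4 * (3 * D) ^ (4 * Suc (4 * m + 1)) * (p * D)\<^sup>2
     \<le> real n * exp (112 * x) * exp (72 * x) * (exp (4 * c) / n\<^sup>2)"
    using 1 2 3 D by (intro mult_mono) auto
  also have "\<dots> = exp (184 * x + 4 * c) / n"
    using n by (simp add: exp_add[symmetric] power2_eq_square field_simps)
  also have "\<dots> = exp (184 * x + 4 * c - ln n)"
    using n by (simp add: exp_diff)
  also have "\<dots> \<le> exp (- 1 / 8 * ln n)"
    using xl c by (subst exp_le_cancel_iff) linarith
  also have "\<dots> = n powr (- 1 / 8)" using n by (simp add: powr_def)
  finally show ?thesis by simp
qed

lemma ex_nat_above: "(x :: real) \<ge> 0 \<Longrightarrow> \<exists>k :: nat. x \<le> k \<and> k \<le> x + 1"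
  by (intro exI[of _ "nat \<lceil>x\<rceil>"]) linarith

lemma prob_eq_1_minus_compl: "pr M A = 1 - pr M (- A)"
  using measure_pmf.prob_compl[of A M] by (simp add: Compl_eq_Diff_UNIV)

text \<open>The dimension depends on the graph alone, so its event can be measured jointly with the
  colouring, where on the support it fails only if one of the two configurations occurs.\<close>

lemma prob_small_dim:
  fixes n :: nat and c :: real
  assumes n: "n \<ge> 2" and c: "c \<ge> 1" "1600 * c \<le> ln n"
  shows "pr (erdos_renyi n (c / n))
      {E. real (poset_dim {1..n} (graph_poset n E)) \<le> 10 ^ 14 * (c ^ 4 * exp c)}
    \<ge> 1 - 1 / n - n powr (- 1 / 8)"
proof -
  define p where "p = c / n"
  define D where "D = (1 + p) ^ n"
  have "ln n \<le> real n" using ln_le_minus_one[of "real n"] n by simp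
  then have p: "0 \<le> p" "p \<le> 1" using c n by (auto simp: p_def field_simps)
  have D: "0 \<le> D" "D \<le> exp c"
  proof -
    show "0 \<le> D" using p by (simp add: D_def)
    have "D \<le> exp p ^ n" unfolding D_def using p exp_ge_add_one_self by (intro power_mono) auto
    also have "\<dots> = exp c" using n by (simp add: exp_of_nat_mult[symmetric] p_def)
    finally show "D \<le> exp c" .
  qed
  have ec: "exp c \<ge> 1" "1 \<le> c * exp c" using c by (auto intro: mult_ge1_I)
  have c0: "c > 0" using c by simp
  obtain s :: nat where "600 * c \<le> s" "s \<le> 600 * c + 1"
    using ex_nat_above[of "600 * c"] c0 by force
  then have s: "600 * c \<le> s" "s \<le> 601 * c" "s \<ge> 1" using c by linarith+
  obtain r :: nat where r': "32724 * c * exp c \<le> r" "r \<le> 32724 * c * exp c + 1"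
    using ex_nat_above[of "32724 * c * exp c"] c0 by force
  then have r: "32724 * c * exp c \<le> r" "r \<le> 32725 * c * exp c" "r > 0"
    using ec(2) by (simp_all add: mult.assoc)
  obtain R :: nat where "exp (600 * c) \<le> R" "R \<le> exp (600 * c) + 1"
    using ex_nat_above[OF exp_ge_zero, of "600 * c"] by blast
  moreover have "1 \<le> exp (600 * c)" using c by simp
  ultimately have R: "exp (600 * c) \<le> R" "R \<le> 2 * exp (600 * c)" "R > 0" by linarith+
  have "0 \<le> 4 * real s * (602 * c * (s + 1))" using c0 by simp
  then obtain t' :: nat where t': "4 * real s * (602 * c * (s + 1)) \<le> t'" "t' \<le> 4 * real s * (602 * c * (s + 1)) + 1"
    using ex_nat_above by blast
  \<comment> \<open>The successor makes the inequality required by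
    \<open>separating_parameter\<close> strict.\<close>
  define t where "t = Suc t'"
  have t: "4 * real s * (602 * c * (s + 1)) < t" "t \<le> 4 * real s * (602 * c * (s + 1)) + 2"
    using t' unfolding t_def by simp_all
  have lnn: "ln n / (256 * c) \<ge> 1" using c by (simp add: field_simps)
  then have "0 \<le> ln n / (256 * c)" by linarith
  \<comment> \<open>The chain is long enough for 512 c m >= 2 ln n, which beats the \<open>n\<close>
    starting vertices, and short enough for \<open>two_cycles_bound\<close>.\<close>
  then obtain m :: nat where m: "ln n / (256 * c) \<le> m" "m \<le> ln n / (256 * c) + 1"
    using ex_nat_above by blast
  then have m1: "m \<ge> 1" using lnn by linarith
  have cm: "ln n / 256 \<le> c * m" "c * m \<le> ln n / 256 + c"
  proof -
    have e: "c * (ln n / (256 * c)) = ln n / 256" using c0 by simp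
    show "ln n / 256 \<le> c * m"
      using mult_left_mono[OF m(1), of c] c0 unfolding e by simp
    show "c * m \<le> ln n / 256 + c"
      using mult_left_mono[OF m(2), of c] c0 unfolding distrib_left e by simp
  qed
  let ?J = "pair_pmf (erdos_renyi n p) (random_colouring n r R)"
  let ?E1 = "{(E, col). long_chain n r R s m E col}" and ?E2 = "{(E, col). two_cycles n (4 * m + 1) E}"
  have "pr ?J ?E1 \<le> real n * exp (- 512 * c) ^ m"
  proof -
    let ?b = "real r * (6 * (real s + 5) * (3 * (1 + p) ^ n)) ^ (s + 4) * (1 / r) ^ s + R * (42 * (3 * (1 + p) ^ n)) ^ 6 * (1 / R)\<^sup>2"
    have "0 \<le> 3 * (1 + p) ^ n" "3 * (1 + p) ^ n \<le> 3 * exp c" using D by (simp_all add: D_def)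
    from group_bound[OF c(1) this s(1,2) r(1,2) R(1)]
    have "?b \<le> exp (- 512 * c)" by (simp only: of_nat_mult of_nat_add of_nat_numeral)
    moreover have "0 \<le> ?b" using p by simp
    ultimately have "?b ^ m \<le> exp (- 512 * c) ^ m" by (intro power_mono)
    then have "real n * ?b ^ m \<le> real n * exp (- 512 * c) ^ m" by (intro mult_left_mono) auto
    then show ?thesis using prob_long_chain[OF p r(3) R(3), of n s m] by linarith
  qed
  also have "exp (- 512 * c) ^ m = exp (- 512 * (c * m))" by (simp add: exp_of_nat_mult[symmetric] mult_ac)
  also have "\<dots> \<le> exp (- (2 * ln n))" using cm by simp
  also have "exp (- (2 * ln n)) = 1 / n\<^sup>2"
    using n by (simp add: exp_minus exp_double power2_eq_square field_simps)
  finally have P1: "pr ?J ?E1 \<le> 1 / n"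
    using n by (simp add: power2_eq_square)
  have "pr ?J ?E2 = pr (erdos_renyi n p) {E. two_cycles n (4 * m + 1) E}"
  proof -
    have "pr (erdos_renyi n p) {E. two_cycles n (4 * m + 1) E}
      = pr (map_pmf fst ?J) {E. two_cycles n (4 * m + 1) E}" by (simp add: map_fst_pair_pmf)
    also have "\<dots> = pr ?J ?E2" unfolding measure_map_pmf
      by (intro arg_cong[where f = "measure_pmf.prob _"]) auto
    finally show ?thesis by simp
  qed
  also have "\<dots> \<le> n powr (- 1 / 8)"
    using prob_two_cycles[OF p, of n "4 * m + 1"] two_cycles_bound[OF n c D p_def m1 cm(2)]
    unfolding D_def by linarith
  finally have P2: "pr ?J ?E2 \<le> n powr (- 1 / 8)" .
  obtain B :: "nat \<Rightarrow> nat set" where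
    B: "\<forall>a<R. \<forall>S. S \<subseteq> {..<R} \<and> card S < s \<and> a \<notin> S \<longrightarrow> (\<exists>j<t. a \<in> B j \<and> S \<inter> B j = {})"
    using separating_family[OF s(3) separating_parameter[OF c(1) s(3) _ R(2) t(1)]] R(3) by auto
  \<comment> \<open>2 * 32725 * 871219218 is less than 6 * 10^13, and the additive 10 is absorbed
    since c^4 e^c >= 1.\<close>
  have num: "real (10 + 2 * r * t) \<le> 10 ^ 14 * (c ^ 4 * exp c)"
  proof -
    have c3: "1 \<le> c ^ 3" using c by simp
    have "4 * real s * (602 * c * (s + 1)) \<le> 4 * (601 * c) * (602 * c * (602 * c))"
      using s c by (intro mult_mono) auto
    also have "\<dots> = 871219216 * c ^ 3" by (simp add: power3_eq_cube)
    finally have "t \<le> 871219218 * c ^ 3" using t(2) c3 by linarith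
    then have "real r * t \<le> (32725 * c * exp c) * (871219218 * c ^ 3)"
      using r c by (intro mult_mono) auto
    also have "\<dots> = (32725 * 871219218) * (c ^ 4 * exp c)" using power_Suc[of c 3] by simp
    finally have rt: "real r * t \<le> (32725 * 871219218) * (c ^ 4 * exp c)" .
    have "1 \<le> c ^ 4 * exp c" using c by (intro mult_ge1_I) auto
    then show ?thesis using rt by simp
  qed
  let ?G = "{E. real (poset_dim {1..n} (graph_poset n E)) \<le> 10 ^ 14 * (c ^ 4 * exp c)}"
  have sub: "- (?G \<times> UNIV) \<inter> set_pmf ?J \<subseteq> ?E1 \<union> ?E2"
  proof (rule ccontr)
    assume "\<not> ?thesis"
    then obtain E col where x: "E \<notin> ?G" "(E, col) \<in> set_pmf ?J" "\<not> long_chain n r R s m E col" "\<not> two_cycles n (4 * m + 1) E"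
      by auto
    have "E \<subseteq> vertex_pairs n" using x(2) unfolding erdos_renyi_def by auto
    moreover have "col v \<in> {..<r} \<times> {..<R}" if "v \<in> {1..n}" for v
    proof -
      have "col \<in> set_pmf (random_colouring n r R)" using x(2) by simp
      then have "col v \<in> set_pmf (pmf_of_set ({..<r} \<times> {..<R}))"
        using that unfolding random_colouring_def by (subst (asm) set_Pi_pmf) (auto simp: PiE_dflt_def)
      then show ?thesis using r(3) R(3) by (subst (asm) set_pmf_of_set) auto
    qed
    ultimately have "poset_dim {1..n} (graph_poset n E) \<le> 10 + 2 * r * t"
      using x(3,4) s(3) B by (intro poset_dim_le_good[where m = m and s = s and R = R and B = B and col = col]) auto
    then have "real (poset_dim {1..n} (graph_poset n E)) \<le> real (10 + 2 * r * t)" by (simp only: of_nat_le_iff)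
    then show False using x(1) num by simp
  qed
  have "pr ?J (- (?G \<times> UNIV)) = pr ?J (- (?G \<times> UNIV) \<inter> set_pmf ?J)"
    by (rule measure_Int_set_pmf[symmetric])
  also have "\<dots> \<le> pr ?J (?E1 \<union> ?E2)"
    by (rule measure_pmf.finite_measure_mono[OF sub]) simp
  also have "\<dots> \<le> pr ?J ?E1 + pr ?J ?E2"
    by (rule measure_Un_le) auto
  also have "\<dots> \<le> 1 / n + n powr (- 1 / 8)" using P1 P2 by linarith
  finally have "pr ?J (- (?G \<times> UNIV)) \<le> 1 / n + n powr (- 1 / 8)" .
  moreover have "pr ?J (?G \<times> UNIV) = 1 - pr ?J (- (?G \<times> UNIV))"
    by (rule prob_eq_1_minus_compl)
  moreover have "pr ?J (?G \<times> UNIV) = pr (erdos_renyi n p) ?G"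
    by (simp add: prob_pair_product)
  ultimately show ?thesis unfolding p_def by linarith
qed

theorem theorem1p12:
  fixes c :: "nat \<Rightarrow> real"
  assumes "\<And>n. n \<ge> 1 \<Longrightarrow> c n \<ge> 1"
    and "c \<in> o(\<lambda>n. ln (real n))"
  shows "\<exists>C>0. (\<lambda>n. measure_pmf.prob (erdos_renyi n (c n / real n))
            {E. real (poset_dim {1..n} (graph_poset n E)) \<le> C * (c n ^ 4 * exp (c n))})
          \<longlonglongrightarrow> 1"
proof (intro exI[of _ "10 ^ 14"] conjI)
  let ?P = "\<lambda>n. pr (erdos_renyi n (c n / real n))
            {E. real (poset_dim {1..n} (graph_poset n E)) \<le> 10 ^ 14 * (c n ^ 4 * exp (c n))}"
  have "eventually (\<lambda>n. norm (c n) \<le> 1 / 1600 * norm (ln (real n))) at_top"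
    using landau_o.smallD[OF assms(2), of "1 / 1600"] by simp
  then have small: "eventually (\<lambda>n. 1600 * c n \<le> ln (real n)) at_top"
    using eventually_ge_at_top[of 2]
  proof eventually_elim
    case (elim n)
    then show ?case using assms(1)[of n] by (auto simp: abs_of_nonneg)
  qed
  show "?P \<longlonglongrightarrow> 1"
  proof (rule tendsto_sandwich)
    show "(\<lambda>n. 1 - 1 / real n - real n powr (- 1 / 8)) \<longlonglongrightarrow> 1" by real_asymp
    show "(\<lambda>_. 1 :: real) \<longlonglongrightarrow> 1" by simp
    show "eventually (\<lambda>n. ?P n \<le> 1) at_top" by simp
    show "eventually (\<lambda>n. 1 - 1 / real n - real n powr (- 1 / 8) \<le> ?P n) at_top"
      using small eventually_ge_at_top[of 2]
    proof eventually_elim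
      case (elim n)
      then show ?case using prob_small_dim[of n "c n"] assms(1)[of n] by simp
    qed
  qed
qed simp

end
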